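(* For each integer $n \ge 2$, let $k_n \in \{1, \ldots, \lfloor n/2 \rfloor\}$, and let $d^n_{\mathrm{TV}}(t)$ denote the worst-case total-variation distance to equilibrium, at time $t$, of the Bernoulli--Laplace urn with parameters $(k_n, n)$. Then the following hold for every fixed $\theta \in \mathbb{R}$. (a) Suppose that $k_n/\sqrt n \to \infty$ as $n \to \infty$. Then $$ d^n_{\mathrm{TV}}\bigl( \tfrac14 n \log n + \theta n \bigr) \to \bigl\| N(e^{-2\theta}, 1) - N(0,1) \bigr\|_{\mathrm{TV}} \quad \text{as } n \to \infty. $$ (b) Suppose that $k_n/\sqrt n \to \sqrt\alpha$ as $n \to \infty$ for some $\alpha > 0$. Then $$ d^n_{\mathrm{TV}}\bigl( \tfrac14 n \log n + \theta n \bigr) \to \bigl\| \mathrm{Pois}(\alpha + \sqrt\alpha\, e^{-2\theta}) - \mathrm{Pois}(\alpha) \bigr\|_{\mathrm{TV}} \quad \text{as } n \to \infty, $$ and, reparametrising, $$ d^n_{\mathrm{TV}}\bigl( \tfrac12 n \log k_n + \theta n \bigr) \to \bigl\| \mathrm{Pois}(\alpha + e^{-2\theta}) - \mathrm{Pois}(\alpha) \bigr\|_{\mathrm{TV}} \quad \text{as } n \to \infty. $$ (c) Suppose that $k_n/\sqrt n \to 0$ and $k_n \to \infty$ as $n \to \infty$. Then $$ d^n_{\mathrm{TV}}\bigl( \tfrac12 n \log k_n + \theta n \bigr) \to \mathbb{P}(G > 2\theta) \quad \text{as } n \to \infty, $$ where $G$ is a standard Gumbel random variable.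
   Context: Bernoulli--Laplace urn with parameters $(k,n)$, $1 \le k \le n/2$: there are $n$ balls, $k$ red and $n-k$ black, in two urns; the first urn always contains $k$ balls and the second $n-k$. At the points of a rate-1 Poisson process, a pair of balls is drawn uniformly at random (with replacement); if they are in the same urn nothing happens, otherwise their positions are switched. The state is $X^n_t$, the number of red balls in the first urn at time $t \ge 0$. Equivalently, $(X^n_t)_{t\ge0}$ is the continuous-time birth--death chain on $\{0,1,\ldots,k\}$ with rates $$ q_n(x,x+1) = \frac{2(k-x)^2}{n^2} \ (x+1 \le k), \qquad q_n(x,x-1) = \frac{2x(n-2k+x)}{n^2} \ (x-1 \ge 0). $$ Its equilibrium distribution $\pi_n$ is hypergeometric: $\pi_n(r) = \binom{k}{r}\binom{n-k}{k-r}/\binom{n}{k}$. For probability measures $\mu,\nu$ on the same space, $\|\mu-\nu\|_{\mathrm{TV}} = \sup_A |\mu(A)-\nu(A)|$. The worst-case distance to equilibrium is $d^n_{\mathrm{TV}}(t) = \max_{x \in \{0,\ldots,k_n\}} \| \mathbb{P}(X^n_t \in \cdot \mid X^n_0 = x) - \pi_n \|_{\mathrm{TV}}$ (with $k=k_n$). $N(m,v)$ denotes the Gaussian law with mean $m$ and variance $v$; $\mathrm{Pois}(\lambda)$ the Poisson law with mean $\lambda$; a standard Gumbel random variable $G$ has $\mathbb{P}(G \le x) = \exp(-e^{-x})$ for $x \in \mathbb{R}$. *)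

theory Defs
  imports "HOL-Probability.Probability"
begin

section \<open>Total variation distance\<close>

definition tv_dist :: "'a measure \<Rightarrow> 'a measure \<Rightarrow> real" where
  "tv_dist \<mu> \<nu> = (SUP A\<in>sets \<mu>. \<bar>measure \<mu> A - measure \<nu> A\<bar>)"


section \<open>The Bernoulli--Laplace urn\<close>

text \<open>
  The balls are \<open>{..<n}\<close>, the red ones are \<open>{..<k}\<close>. A configuration is the set \<open>U\<close> of the
  \<open>k\<close> balls in the first urn.
\<close>

definition switch :: "nat \<Rightarrow> nat \<Rightarrow> nat set \<Rightarrow> nat set" where
  "switch i j U =
     (if i \<in> U \<and> j \<notin> U then insert j (U - {i})
      else if j \<in> U \<and> i \<notin> U then insert i (U - {j})
      else U)"

definition draw_pair :: "nat \<Rightarrow> nat set \<Rightarrow> nat set pmf" where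
  "draw_pair n U = map_pmf (\<lambda>(i, j). switch i j U) (pmf_of_set ({..<n} \<times> {..<n}))"

primrec after_draws :: "nat \<Rightarrow> nat set \<Rightarrow> nat \<Rightarrow> nat set pmf" where
  "after_draws n U 0 = return_pmf U"
| "after_draws n U (Suc m) = bind_pmf (after_draws n U m) (draw_pair n)"

text \<open>
  The number of points in \<open>[0, t]\<close> of a rate-1 Poisson process. The case distinction is needed
  since \<^const>\<open>poisson_pmf\<close> is only specified for positive parameters.
\<close>

definition num_points :: "real \<Rightarrow> nat pmf" where
  "num_points t = (if t > 0 then poisson_pmf t else return_pmf 0)"

definition config_law :: "nat \<Rightarrow> nat set \<Rightarrow> real \<Rightarrow> nat set pmf" where
  "config_law n U t = bind_pmf (num_points t) (after_draws n U)"

definition red_count :: "nat \<Rightarrow> nat set \<Rightarrow> nat" where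
  "red_count k U = card (U \<inter> {..<k})"

text \<open>
  A configuration with \<open>x\<close> red balls in the first urn. The law of the number of red
  balls at time \<open>t\<close> is the same for every other such configuration; see
  \<open>urn_law_eq_config_law\<close> below.
\<close>

definition start_config :: "nat \<Rightarrow> nat \<Rightarrow> nat set" where
  "start_config k x = {..<x} \<union> {k..<k + (k - x)}"

text \<open>The law of \<open>X\<^sub>t\<close> given \<open>X\<^sub>0 = x\<close>.\<close>

definition urn_law :: "nat \<Rightarrow> nat \<Rightarrow> nat \<Rightarrow> real \<Rightarrow> nat pmf" where
  "urn_law k n x t = map_pmf (red_count k) (config_law n (start_config k x) t)"

definition urn_equilibrium :: "nat \<Rightarrow> nat \<Rightarrow> nat pmf" where
  "urn_equilibrium k n =
     embed_pmf (\<lambda>r. real (k choose r) * real ((n - k) choose (k - r)) / real (n choose k))"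

definition urn_tv :: "nat \<Rightarrow> nat \<Rightarrow> real \<Rightarrow> real" where
  "urn_tv k n t =
     Max ((\<lambda>x. tv_dist (measure_pmf (urn_law k n x t)) (measure_pmf (urn_equilibrium k n))) ` {0..k})"


section \<open>Limit laws\<close>

definition gaussian :: "real \<Rightarrow> real \<Rightarrow> real measure" where
  "gaussian m v = density lborel (normal_density m (sqrt v))"

definition standard_gumbel :: "'w measure \<Rightarrow> ('w \<Rightarrow> real) \<Rightarrow> bool" where
  "standard_gumbel M G \<longleftrightarrow>
     prob_space M \<and> G \<in> borel_measurable M \<and> (\<forall>x. \<P>(\<omega> in M. G \<omega> \<le> x) = exp (- exp (- x)))"


section \<open>The urn as a birth--death chain\<close>

lemma pmf_urn_equilibrium:
  assumes "k \<le> n"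
  shows "pmf (urn_equilibrium k n) r =
           real (k choose r) * real ((n - k) choose (k - r)) / real (n choose k)"
  unfolding urn_equilibrium_def
proof (rule pmf_embed_pmf)
  let ?f = "\<lambda>r. real (k choose r) * real ((n - k) choose (k - r)) / real (n choose k)"
  show "0 \<le> ?f r" for r by simp
  have "(\<Sum>r\<le>k. (k choose r) * ((n - k) choose (k - r))) = n choose k"
    using vandermonde[of k "n - k" k] assms by simp
  hence "(\<Sum>r\<le>k. real (k choose r) * real ((n - k) choose (k - r))) = real (n choose k)"
    by (metis (mono_tags, lifting) of_nat_mult of_nat_sum sum.cong)
  hence *: "(\<Sum>r\<le>k. ?f r) = 1"
    using assms by (simp add: sum_divide_distrib[symmetric])
  have "(\<integral>\<^sup>+ r. ennreal (?f r) \<partial>count_space UNIV) = (\<integral>\<^sup>+ r. ennreal (?f r) \<partial>count_space {..k})"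
    by (rule nn_integral_count_space_eq) (auto simp: binomial_eq_0)
  also have "\<dots> = ennreal (\<Sum>r\<le>k. ?f r)"
    by (subst nn_integral_count_space_finite) (simp_all add: sum_ennreal)
  finally show "(\<integral>\<^sup>+ r. ennreal (?f r) \<partial>count_space UNIV) = 1"
    using * by simp
qed

definition urn_rate :: "nat \<Rightarrow> nat \<Rightarrow> nat \<Rightarrow> nat \<Rightarrow> real" where
  "urn_rate k n x y =
     (if y = x + 1 \<and> y \<le> k then 2 * (real k - real x)\<^sup>2 / (real n)\<^sup>2
      else if x = y + 1 then 2 * real x * (real n - 2 * real k + real x) / (real n)\<^sup>2
      else 0)"

definition urn_config :: "nat \<Rightarrow> nat \<Rightarrow> nat set \<Rightarrow> bool" where
  "urn_config k n U \<longleftrightarrow> U \<subseteq> {..<n} \<and> card U = k"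

lemma start_config:
  assumes "x \<le> k" "2 * k \<le> n"
  shows "urn_config k n (start_config k x)" "red_count k (start_config k x) = x"
proof -
  have "{..<x} \<inter> {k..<k + (k - x)} = {}" using assms by auto
  thus "urn_config k n (start_config k x)" using assms
    by (auto simp: urn_config_def start_config_def card_Un_disjoint)
  have "start_config k x \<inter> {..<k} = {..<x}" using assms by (auto simp: start_config_def)
  thus "red_count k (start_config k x) = x" by (simp add: red_count_def)
qed

lemma urn_config_switch:
  assumes "urn_config k n U" "i < n" "j < n"
  shows "urn_config k n (switch i j U)"
proof -
  have "finite U" using assms by (auto simp: urn_config_def intro: finite_subset)
  moreover have "card U > 0" if "a \<in> U" for a
    using \<open>finite U\<close> that by (auto simp: card_gt_0_iff)
  ultimately show ?thesis
    using assms by (auto simp: urn_config_def switch_def)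
qed

lemma red_count_swap:
  assumes "finite U" "i \<in> U" "j \<notin> U"
  shows "int (red_count k (insert j (U - {i}))) =
           int (red_count k U) + of_bool (j < k) - of_bool (i < k)"
proof -
  have eq: "insert j (U - {i}) \<inter> {..<k} =
      (if j < k then insert j (U \<inter> {..<k} - {i}) else U \<inter> {..<k} - {i})"
    by auto
  have pos: "card (U \<inter> {..<k}) > 0" if "i < k"
    using assms that by (auto simp: card_gt_0_iff)
  have "card (U \<inter> {..<k} - {i}) = (if i < k then card (U \<inter> {..<k}) - 1 else card (U \<inter> {..<k}))"
    using assms by (auto simp: card_Diff_singleton_if)
  thus ?thesis unfolding red_count_def eq using assms pos
    by (auto simp: of_nat_diff Suc_le_eq)
qed

lemma pmf_draw_pair:
  assumes "n > 0"
  shows "pmf (map_pmf (red_count k) (draw_pair n U)) y =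
    card {(i, j). i < n \<and> j < n \<and> red_count k (switch i j U) = y} / (real n)\<^sup>2"
proof -
  have ne: "{..<n} \<times> {..<n} \<noteq> {}" using assms by auto
  have "map_pmf (red_count k) (draw_pair n U) =
      map_pmf (\<lambda>(i, j). red_count k (switch i j U)) (pmf_of_set ({..<n} \<times> {..<n}))"
    by (simp add: draw_pair_def pmf.map_comp o_def case_prod_unfold)
  hence "pmf (map_pmf (red_count k) (draw_pair n U)) y =
      measure (pmf_of_set ({..<n} \<times> {..<n})) ((\<lambda>(i, j). red_count k (switch i j U)) -` {y})"
    by (simp add: pmf_map)
  also have "\<dots> = card (({..<n} \<times> {..<n}) \<inter> ((\<lambda>(i, j). red_count k (switch i j U)) -` {y})) / (real n)\<^sup>2"
    using ne by (subst measure_pmf_of_set) (simp_all add: power2_eq_square)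
  also have "({..<n} \<times> {..<n}) \<inter> ((\<lambda>(i, j). red_count k (switch i j U)) -` {y}) =
      {(i, j). i < n \<and> j < n \<and> red_count k (switch i j U) = y}" by auto
  finally show ?thesis .
qed

lemma card_times_swap:
  assumes "finite A" "finite B" "A \<inter> B = {}"
  shows "card (A \<times> B \<union> B \<times> A) = 2 * card A * card B"
  using assms by (subst card_Un_disjoint) (auto simp: card_cartesian_product)

lemma pmf_draw_pair_off_diag:
  assumes U: "urn_config k n U" and k: "2 * k \<le> n" "k > 0" and y: "y \<noteq> red_count k U"
  shows "pmf (map_pmf (red_count k) (draw_pair n U)) y = urn_rate k n (red_count k U) y"
proof -
  define x where "x = red_count k U"
  define R1 where "R1 = U \<inter> {..<k}"
  define B1 where "B1 = U - {..<k}"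
  define R2 where "R2 = {..<k} - U"
  define B2 where "B2 = {k..<n} - U"
  have fin: "finite U" using U by (auto simp: urn_config_def intro: finite_subset)
  have R1: "card R1 = x" by (simp add: R1_def x_def red_count_def)
  have xk: "x \<le> k" using card_mono[of "{..<k}" R1] R1 by (auto simp: R1_def)
  have "card U = card R1 + card B1" unfolding R1_def B1_def
    using fin by (subst card_Un_disjoint[symmetric]) (auto intro: arg_cong[where f = card])
  hence B1: "card B1 = k - x" using U R1 by (auto simp: urn_config_def)
  have "{..<k} = R1 \<union> R2" by (auto simp: R1_def R2_def)
  hence "card {..<k} = card R1 + card R2"
    by (simp only:) (rule card_Un_disjoint, auto simp: R1_def R2_def)
  hence R2: "card R2 = k - x" using R1 by simp
  have "{k..<n} = B1 \<union> B2" using U by (auto simp: B1_def B2_def urn_config_def)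
  hence "card {k..<n} = card B1 + card B2"
    by (simp only:) (rule card_Un_disjoint, use fin in \<open>auto simp: B1_def B2_def\<close>)
  hence B2: "int (card B2) = int n - 2 * int k + int x" using B1 xk k by simp
  define P where "P = B1 \<times> R2 \<union> R2 \<times> B1"
  define D where "D = R1 \<times> B2 \<union> B2 \<times> R1"
  have cases: "int (red_count k (switch i j U)) =
      int x + of_bool ((i, j) \<in> P) - of_bool ((i, j) \<in> D)"
    if "i < n" "j < n" for i j
    using that fin red_count_swap[of U i j k] red_count_swap[of U j i k]
    by (auto simp: switch_def P_def D_def x_def R1_def B1_def R2_def B2_def)
  have sub: "i < n \<and> j < n" if "(i, j) \<in> P \<or> (i, j) \<in> D" for i j
    using that U k by (auto simp: P_def D_def R1_def B1_def R2_def B2_def urn_config_def)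
  have dj: "\<not> ((i, j) \<in> P \<and> (i, j) \<in> D)" for i j
    by (auto simp: P_def D_def R1_def B1_def R2_def B2_def)
  have up: "(i < n \<and> j < n \<and> red_count k (switch i j U) = x + 1) \<longleftrightarrow> (i, j) \<in> P" for i j
    using cases[of i j] sub[of i j] dj[of i j] by (auto simp: of_bool_def split: if_splits)
  have down: "(i < n \<and> j < n \<and> x = red_count k (switch i j U) + 1) \<longleftrightarrow> (i, j) \<in> D" for i j
    using cases[of i j] sub[of i j] dj[of i j] by (auto simp: of_bool_def split: if_splits)
  let ?S = "{(i, j). i < n \<and> j < n \<and> red_count k (switch i j U) = y}"
  have n: "n > 0" using k by simp
  consider "y = x + 1" | "x = y + 1" | "y \<noteq> x + 1" "x \<noteq> y + 1" by blast
  hence "real (card ?S) / (real n)\<^sup>2 = urn_rate k n x y"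
  proof cases
    case 1
    have "?S = P" using up 1 by auto
    moreover have "finite B1" "finite R2" "B1 \<inter> R2 = {}" using fin by (auto simp: B1_def R2_def)
    ultimately have "card ?S = 2 * (k - x) * (k - x)"
      using card_times_swap[of B1 R2] B1 R2 by (simp add: P_def)
    moreover have "urn_rate k n x y = 2 * (real k - real x)\<^sup>2 / (real n)\<^sup>2"
      using 1 xk by (cases "x = k") (auto simp: urn_rate_def)
    ultimately show ?thesis using xk by (simp add: of_nat_diff power2_eq_square)
  next
    case 2
    have "?S = {(i, j). i < n \<and> j < n \<and> x = red_count k (switch i j U) + 1}" using 2 by auto
    hence "?S = D" unfolding down by simp
    moreover have "finite R1" "finite B2" "R1 \<inter> B2 = {}" by (auto simp: R1_def B2_def)
    ultimately have "card ?S = 2 * x * card B2"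
      using card_times_swap[of R1 B2] R1 by (simp add: D_def)
    hence "real (card ?S) = 2 * real x * real (card B2)" by simp
    moreover have "real (card B2) = real n - 2 * real k + real x" 
      using arg_cong[OF B2, of real_of_int] by simp
    moreover have "urn_rate k n x y = 2 * real x * (real n - 2 * real k + real x) / (real n)\<^sup>2"
      using 2 by (simp add: urn_rate_def)
    ultimately show ?thesis by simp
  next
    case 3
    have "red_count k (switch i j U) \<noteq> y" if "i < n" "j < n" for i j
      using cases[OF that] 3 y by (auto simp: x_def[symmetric] of_bool_def split: if_splits)
    hence "?S = {}" by auto
    hence "card ?S = 0" by (simp only: card.empty)
    thus ?thesis using 3 by (simp add: urn_rate_def)
  qed
  thus ?thesis using pmf_draw_pair[OF n] by (simp add: x_def)
qed

lemma red_count_le: "red_count k U \<le> k"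
  using card_mono[of "{..<k}" "U \<inter> {..<k}"] by (simp add: red_count_def)

lemma sum_pmf_red_count: "(\<Sum>y\<le>k. pmf (map_pmf (red_count k) p) y) = 1"
  by (rule sum_pmf_eq_1) (auto simp: red_count_le)

definition urn_generator :: "nat \<Rightarrow> nat \<Rightarrow> nat \<Rightarrow> nat \<Rightarrow> real" where
  "urn_generator k n x y =
     (if x = y then - (\<Sum>z\<in>{..k} - {x}. urn_rate k n x z) else urn_rate k n x y)"

lemma pmf_draw_pair_eq:
  assumes U: "urn_config k n U" and k: "2 * k \<le> n" "k > 0"
  shows "pmf (map_pmf (red_count k) (draw_pair n U)) y =
           of_bool (red_count k U = y) + urn_generator k n (red_count k U) y"
proof (cases "y = red_count k U")
  case False
  thus ?thesis using pmf_draw_pair_off_diag[OF assms] by (simp add: urn_generator_def)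
next
  case True
  let ?f = "pmf (map_pmf (red_count k) (draw_pair n U))"
  have "1 = ?f y + (\<Sum>z\<in>{..k} - {y}. ?f z)"
    using sum_pmf_red_count[of k "draw_pair n U"] True red_count_le[of k U]
    by (subst (asm) sum.remove[of _ y]) auto
  also have "(\<Sum>z\<in>{..k} - {y}. ?f z) = (\<Sum>z\<in>{..k} - {y}. urn_rate k n (red_count k U) z)"
    using True by (intro sum.cong) (auto simp: pmf_draw_pair_off_diag[OF assms])
  finally show ?thesis using True by (simp add: urn_generator_def)
qed

lemma urn_config_after_draws:
  assumes "urn_config k n U" "V \<in> set_pmf (after_draws n U m)" "n > 0"
  shows "urn_config k n V"
  using assms(2)
proof (induction m arbitrary: V)
  case 0
  thus ?case using assms by simp
next
  case (Suc m)
  have "set_pmf (pmf_of_set ({..<n} \<times> {..<n})) = {..<n} \<times> {..<n}"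
    using assms by (intro set_pmf_of_set) auto
  thus ?case using Suc by (auto simp: draw_pair_def intro: urn_config_switch)
qed

lemma pmf_after_draws_Suc:
  assumes U: "urn_config k n U" and k: "2 * k \<le> n" "k > 0" and y: "y \<le> k"
  shows "pmf (map_pmf (red_count k) (after_draws n U (Suc m))) y =
    pmf (map_pmf (red_count k) (after_draws n U m)) y +
    (\<Sum>x\<le>k. pmf (map_pmf (red_count k) (after_draws n U m)) x * urn_generator k n x y)"
proof -
  let ?p = "map_pmf (red_count k) (after_draws n U m)"
  have "map_pmf (red_count k) (after_draws n U (Suc m)) =
      bind_pmf (after_draws n U m) (\<lambda>V. map_pmf (red_count k) (draw_pair n V))"
    by (simp add: map_bind_pmf)
  hence "pmf (map_pmf (red_count k) (after_draws n U (Suc m))) y =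
      measure_pmf.expectation (after_draws n U m)
        (\<lambda>V. pmf (map_pmf (red_count k) (draw_pair n V)) y)"
    by (simp add: pmf_bind)
  also have "\<dots> = measure_pmf.expectation (after_draws n U m)
      (\<lambda>V. of_bool (red_count k V = y) + urn_generator k n (red_count k V) y)"
    using k pmf_draw_pair_eq[OF urn_config_after_draws[OF U] k]
    by (intro integral_cong_AE) (simp_all add: AE_measure_pmf_iff)
  also have "\<dots> = measure_pmf.expectation ?p (\<lambda>x. of_bool (x = y) + urn_generator k n x y)"
    by simp
  also have "\<dots> = (\<Sum>x\<le>k. (of_bool (x = y) + urn_generator k n x y) * pmf ?p x)"
    by (subst integral_measure_pmf_real[where A = "{..k}"]) (auto simp: red_count_le)
  also have "\<dots> = (\<Sum>x\<le>k. (if x = y then pmf ?p x else 0)) +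
      (\<Sum>x\<le>k. pmf ?p x * urn_generator k n x y)"
    by (subst sum.distrib[symmetric]) (auto intro!: sum.cong simp: algebra_simps)
  also have "(\<Sum>x\<le>k. (if x = y then pmf ?p x else 0)) = pmf ?p y" using y by simp
  finally show ?thesis .
qed

lemma pmf_config_law:
  assumes "t \<ge> 0"
  shows "(\<lambda>m. exp (- t) * (pmf (map_pmf (red_count k) (after_draws n U m)) y / fact m * t ^ m)) sums
           pmf (map_pmf (red_count k) (config_law n U t)) y"
proof -
  let ?r = "\<lambda>m. pmf (map_pmf (red_count k) (after_draws n U m)) y"
  have eq: "pmf (map_pmf (red_count k) (config_law n U t)) y =
      measure_pmf.expectation (num_points t) ?r"
    by (simp add: config_law_def map_bind_pmf pmf_bind)
  show ?thesis
  proof (cases "t > 0")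
    case False
    hence "t = 0" using assms by simp
    thus ?thesis unfolding eq using powser_sums_zero[of "\<lambda>m. ?r m / fact m"]
      by (simp add: num_points_def)
  next
    case True
    have int: "integrable (measure_pmf (poisson_pmf t)) ?r"
      by (intro measure_pmf.integrable_const_bound[where B = 1]) (auto simp: pmf_le_1)
    have "measure_pmf.expectation (poisson_pmf t) ?r =
        (\<integral>m. pmf (poisson_pmf t) m * ?r m \<partial>count_space UNIV)"
      by (simp add: measure_pmf_eq_density integral_density)
    moreover have "integrable (count_space UNIV) (\<lambda>m. pmf (poisson_pmf t) m * ?r m)"
      using int by (simp add: measure_pmf_eq_density integrable_density)
    ultimately have "(\<lambda>m. pmf (poisson_pmf t) m * ?r m) sums measure_pmf.expectation (poisson_pmf t) ?r"
      by (simp add: sums_integral_count_space_nat)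
    thus ?thesis unfolding eq using True by (simp add: num_points_def field_simps)
  qed
qed

theorem urn_law_eq_config_law:
  assumes k: "2 * k \<le> n" "k > 0" and U: "urn_config k n U"
  shows "urn_law k n (red_count k U) t = map_pmf (red_count k) (config_law n U t)"
proof -
  define V where "V = start_config k (red_count k U)"
  have V: "urn_config k n V" "red_count k V = red_count k U"
    using start_config[OF red_count_le[of k U] k(1)] by (simp_all add: V_def)
  have *: "pmf (map_pmf (red_count k) (after_draws n V m)) y =
      pmf (map_pmf (red_count k) (after_draws n U m)) y" if "y \<le> k" for m y
    using that
  proof (induction m arbitrary: y)
    case 0
    thus ?case using V by simp
  next
    case (Suc m)
    thus ?case by (simp only: pmf_after_draws_Suc[OF V(1) k] pmf_after_draws_Suc[OF U k])
      (auto intro!: arg_cong2[where f = "(+)"] sum.cong)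
  qed
  have "pmf (map_pmf (red_count k) (after_draws n V m)) y =
      pmf (map_pmf (red_count k) (after_draws n U m)) y" for m y
  proof (cases "y \<le> k")
    case False
    hence "y \<notin> set_pmf (map_pmf (red_count k) (after_draws n W m))" for W
      using red_count_le[of k] by auto
    thus ?thesis by (metis set_pmf_iff)
  qed (rule *)
  hence "map_pmf (red_count k) (after_draws n V m) = map_pmf (red_count k) (after_draws n U m)" for m
    by (intro pmf_eqI) simp
  thus ?thesis by (simp add: urn_law_def config_law_def map_bind_pmf V_def)
qed

theorem urn_law_0:
  assumes "x \<le> k" "2 * k \<le> n"
  shows "urn_law k n x 0 = return_pmf x"
  using start_config[OF assms]
  by (simp add: urn_law_def config_law_def num_points_def bind_return_pmf)

lemma pmf_config_law_deriv:
  assumes U: "urn_config k n U" and k: "2 * k \<le> n" "k > 0" and y: "y \<le> k" and t: "t \<ge> 0"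
  shows "((\<lambda>t. pmf (map_pmf (red_count k) (config_law n U t)) y) has_real_derivative
    (\<Sum>x\<le>k. pmf (map_pmf (red_count k) (config_law n U t)) x * urn_generator k n x y))
    (at t within {0..})"
proof -
  define r where "r = (\<lambda>m y. pmf (map_pmf (red_count k) (after_draws n U m)) y)"
  define p where "p = (\<lambda>t y. pmf (map_pmf (red_count k) (config_law n U t)) y)"
  define c where "c = (\<lambda>m. r m y / fact m)"
  have p_sums: "(\<lambda>m. exp (- s) * (r m z / fact m * s ^ m)) sums p s z" if "s \<ge> 0" for s z
    using pmf_config_law[OF that] unfolding r_def p_def by simp
  have summ: "summable (\<lambda>m. r m z / fact m * s ^ m)" for s :: real and z
  proof (rule summable_comparison_test)
    show "\<exists>N. \<forall>m\<ge>N. norm (r m z / fact m * s ^ m) \<le> inverse (fact m) * \<bar>s\<bar> ^ m"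
      by (auto simp: r_def abs_mult power_abs field_simps pmf_le_1 mult_left_le
               intro!: divide_right_mono)
    show "summable (\<lambda>m. inverse (fact m) * \<bar>s\<bar> ^ m)" by (rule summable_exp)
  qed
  define F where "F = (\<lambda>s z. \<Sum>m. r m z / fact m * s ^ m)"
  have p_eq: "p s z = exp (- s) * F s z" if "s \<ge> 0" for s z
    using p_sums[OF that] summ sums_mult[OF summable_sums, of _ "exp (- s)"]
    unfolding F_def by (metis sums_unique2)
  have step: "r (Suc m) y = r m y + (\<Sum>x\<le>k. r m x * urn_generator k n x y)" for m
    using pmf_after_draws_Suc[OF U k y] unfolding r_def by blast
  have "((\<lambda>s. F s y) has_real_derivative (\<Sum>m. diffs c m * t ^ m)) (at t)"
  proof -
    have "(\<lambda>s. F s y) = (\<lambda>s. \<Sum>m. c m * s ^ m)" by (simp add: F_def c_def)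
    thus ?thesis
      using termdiffs_strong_converges_everywhere[of c t] summ by (simp add: c_def)
  qed
  moreover have "(\<lambda>m. diffs c m * t ^ m) sums
      (F t y + (\<Sum>x\<le>k. F t x * urn_generator k n x y))"
  proof -
    have "diffs c m * t ^ m = r m y / fact m * t ^ m +
        (\<Sum>x\<le>k. (r m x / fact m * t ^ m) * urn_generator k n x y)" for m
    proof -
      have "diffs c m = r (Suc m) y / fact m"
        by (simp add: diffs_def c_def del: of_nat_Suc)
      thus ?thesis unfolding step
        by (simp add: add_divide_distrib distrib_left sum_divide_distrib sum_distrib_left mult_ac)
    qed
    moreover have "(\<lambda>m. r m y / fact m * t ^ m +
        (\<Sum>x\<le>k. (r m x / fact m * t ^ m) * urn_generator k n x y)) sums
        (F t y + (\<Sum>x\<le>k. F t x * urn_generator k n x y))"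
      unfolding F_def by (intro sums_add sums_sum sums_mult2 summable_sums summ)
    ultimately show ?thesis by simp
  qed
  ultimately have F': "((\<lambda>s. F s y) has_real_derivative
      (F t y + (\<Sum>x\<le>k. F t x * urn_generator k n x y))) (at t)"
    by (simp add: sums_iff)
  have "((\<lambda>s. exp (- s) * F s y) has_real_derivative
      (exp (- t) * (\<Sum>x\<le>k. F t x * urn_generator k n x y))) (at t)"
    by (auto intro!: derivative_eq_intros F' simp: algebra_simps)
  also have "exp (- t) * (\<Sum>x\<le>k. F t x * urn_generator k n x y) =
      (\<Sum>x\<le>k. p t x * urn_generator k n x y)"
    using t by (simp add: p_eq sum_distrib_left mult_ac)
  finally have "((\<lambda>s. exp (- s) * F s y) has_real_derivative
      (\<Sum>x\<le>k. p t x * urn_generator k n x y)) (at t within {0..})"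
    by (rule has_field_derivative_at_within)
  hence "((\<lambda>s. p s y) has_real_derivative
      (\<Sum>x\<le>k. p t x * urn_generator k n x y)) (at t within {0..})"
    by (rule has_field_derivative_transform_within[where d = 1]) (use t in \<open>auto simp: p_eq\<close>)
  thus ?thesis unfolding p_def .
qed

text \<open>
  The Kolmogorov forward equation for the rates \<^const>\<open>urn_rate\<close>: the number of red balls in
  the first urn is the birth--death chain with these rates.
\<close>

theorem pmf_urn_law_deriv:
  assumes k: "2 * k \<le> n" "k > 0" and "x \<le> k" "y \<le> k" "t \<ge> 0"
  shows "((\<lambda>t. pmf (urn_law k n x t) y) has_real_derivative
    (\<Sum>z\<le>k. pmf (urn_law k n x t) z * urn_generator k n z y)) (at t within {0..})"
  using pmf_config_law_deriv[OF start_config(1) k] assms unfolding urn_law_def by blast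

end

theory Submission
  imports Defs
begin

text \<open>
  Let \<open>W\<close> be the set of balls in the first urn. The number of red balls started from any \<open>x\<close> is a
  function of \<open>W\<close>, while by symmetry the law of \<open>W\<close> is, given its overlap with its starting set,
  uniform. Hence the start \<open>k\<close> (all red balls in the first urn) is exactly the worst one, and only
  the chain started from \<open>k\<close> has to be compared with equilibrium.

  In the time scale \<open>s = t / n\<close>, the functions \<open>(1 + w\<^sub>s)\<^sup>x\<close> with \<open>w\<^sub>s = w exp (- 2 (S - s))\<close> almost
  solve the backward equation when \<open>k\<^sup>2 / n\<close> is bounded. This yields the limits of the generating
  functions at time \<open>S\<close>, which are Poisson; evaluated at \<open>0\<close> they give the Gumbel regime. When
  \<open>k\<^sup>2 / n\<close> diverges, the same is true of \<open>exp (i \<xi>\<^sub>s v(x))\<close> with \<open>v\<close> the standardised deviation from the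
  equilibrium mean and \<open>\<xi>\<^sub>s = \<xi> exp (- 2 (S - s))\<close>, which yields a central limit theorem. There the
  density of the chain started from \<open>k\<close> with respect to equilibrium is increasing, so that the total
  variation distance is a difference of distribution functions and weak convergence suffices.
\<close>

section \<open>Total variation distance\<close>

text \<open>The rate 2 in the exponents comes from the drift: the quadratic terms of the two rates
  cancel and leave -2 times the deviation from k^2 / n, which a parameter growing like exp (2 s)
  absorbs. The equilibrium is never expanded from its binomial formula. It is a constant solution of
  the same forward equation, so every estimate along the flow is used twice, and the two uses differ
  only in the term at time 0. There the parameter is so small that it still sees the start
  \<open>k\<close>, while the equilibrium term tends to 1. The obstacle in the Gaussian regime is
  that weak convergence on an ever finer lattice does not control total variation; the usual way out
  would be a local limit theorem. The monotone density replaces it, at the price of a threshold that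
  is unknown and moves with n, so that the distribution functions have to converge uniformly. In the
  Poisson regime the lattice is fixed and weak convergence already gives the point masses.\<close>

lemma tv_dist_upper:
  assumes "prob_space \<mu>" "prob_space \<nu>" "A \<in> sets \<mu>"
  shows "\<bar>measure \<mu> A - measure \<nu> A\<bar> \<le> tv_dist \<mu> \<nu>"
  unfolding tv_dist_def
proof (rule cSUP_upper[OF assms(3)])
  have "\<bar>measure \<mu> B - measure \<nu> B\<bar> \<le> 1" for B
    using prob_space.prob_le_1[OF assms(1), of B] prob_space.prob_le_1[OF assms(2), of B]
      measure_nonneg[of \<mu> B] measure_nonneg[of \<nu> B] by linarith
  thus "bdd_above ((\<lambda>B. \<bar>measure \<mu> B - measure \<nu> B\<bar>) ` sets \<mu>)"
    by (auto intro!: bdd_aboveI2[where M = 1])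
qed

lemma tv_dist_least:
  assumes "\<And>A. A \<in> sets \<mu> \<Longrightarrow> \<bar>measure \<mu> A - measure \<nu> A\<bar> \<le> c"
  shows "tv_dist \<mu> \<nu> \<le> c"
  unfolding tv_dist_def by (rule cSUP_least) (use assms in auto)

text \<open>\<open>H\<close> is the positive side of a Hahn decomposition of the difference.
  Replacing \<open>A\<close> by \<open>H\<close> gains the difference on \<open>H - A\<close> and
  drops the one on \<open>A - H\<close>, both in the right direction. The absolute value is harmless
  because passing to the complement changes the sign.\<close>

lemma tv_dist_eq_hahn:
  assumes prob: "prob_space \<mu>" "prob_space \<nu>" and sets: "sets \<nu> = sets \<mu>" and H: "H \<in> sets \<mu>"
    and pos: "\<And>A. A \<in> sets \<mu> \<Longrightarrow> A \<subseteq> H \<Longrightarrow> measure \<nu> A \<le> measure \<mu> A"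
    and neg: "\<And>A. A \<in> sets \<mu> \<Longrightarrow> A \<inter> H = {} \<Longrightarrow> measure \<mu> A \<le> measure \<nu> A"
  shows "tv_dist \<mu> \<nu> = measure \<mu> H - measure \<nu> H"
proof (rule antisym)
  interpret \<mu>: prob_space \<mu> by fact
  interpret \<nu>: prob_space \<nu> by fact
  have split: "measure \<mu> B = measure \<mu> (B \<inter> C) + measure \<mu> (B - C)"
    "measure \<nu> B = measure \<nu> (B \<inter> C) + measure \<nu> (B - C)" if "B \<in> sets \<mu>" "C \<in> sets \<mu>" for B C
  proof -
    have "B \<inter> C \<union> (B - C) = B" "(B \<inter> C) \<inter> (B - C) = {}" by auto
    thus "measure \<mu> B = measure \<mu> (B \<inter> C) + measure \<mu> (B - C)"
      "measure \<nu> B = measure \<nu> (B \<inter> C) + measure \<nu> (B - C)"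
      using that sets \<mu>.finite_measure_Union[of "B \<inter> C" "B - C"]
        \<nu>.finite_measure_Union[of "B \<inter> C" "B - C"] by simp_all
  qed
  have le: "measure \<mu> A - measure \<nu> A \<le> measure \<mu> H - measure \<nu> H" if A: "A \<in> sets \<mu>" for A
  proof -
    have "measure \<nu> (H - A) \<le> measure \<mu> (H - A)" "measure \<mu> (A - H) \<le> measure \<nu> (A - H)"
      using A H by (auto intro!: pos neg)
    thus ?thesis using split[OF A H] split[OF H A] by (simp add: Int_commute)
  qed
  show "tv_dist \<mu> \<nu> \<le> measure \<mu> H - measure \<nu> H"
  proof (rule tv_dist_least)
    fix A assume A: "A \<in> sets \<mu>"
    have "measure \<mu> (space \<mu> - A) = 1 - measure \<mu> A" "measure \<nu> (space \<mu> - A) = 1 - measure \<nu> A"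
      using A \<mu>.prob_compl \<nu>.prob_compl[of A] sets sets_eq_imp_space_eq[OF sets] by auto
    thus "\<bar>measure \<mu> A - measure \<nu> A\<bar> \<le> measure \<mu> H - measure \<nu> H"
      using le[OF A] le[of "space \<mu> - A"] A by auto
  qed
  show "measure \<mu> H - measure \<nu> H \<le> tv_dist \<mu> \<nu>"
    using tv_dist_upper[OF prob H] by linarith
qed

lemma measure_pmf_mono_pointwise:
  assumes "\<And>x. x \<in> A \<Longrightarrow> pmf p x \<le> pmf q x"
  shows "measure (measure_pmf p) A \<le> measure (measure_pmf q) A"
proof -
  have "emeasure (measure_pmf p) A \<le> emeasure (measure_pmf q) A"
    unfolding nn_integral_pmf[symmetric]
    by (intro nn_integral_mono) (use assms in \<open>auto intro!: ennreal_leI\<close>)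
  thus ?thesis by (simp add: measure_pmf.emeasure_eq_measure)
qed

lemma tv_dist_pmf_eq:
  assumes "\<And>x. x \<in> H \<Longrightarrow> pmf q x \<le> pmf p x" "\<And>x. x \<notin> H \<Longrightarrow> pmf p x \<le> pmf q x"
  shows "tv_dist (measure_pmf p) (measure_pmf q) = measure (measure_pmf p) H - measure (measure_pmf q) H"
  by (rule tv_dist_eq_hahn)
    (auto intro!: measure_pmf_mono_pointwise assms measure_pmf.prob_space_axioms)

lemmas tv_dist_pmf_upper = tv_dist_upper[OF measure_pmf.prob_space_axioms measure_pmf.prob_space_axioms]

lemma tv_dist_map_pmf_le:
  "tv_dist (measure_pmf (map_pmf f p)) (measure_pmf (map_pmf f q)) \<le> tv_dist (measure_pmf p) (measure_pmf q)"
  by (rule tv_dist_least) (auto intro!: tv_dist_pmf_upper)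

text \<open>The set where \<open>p\<close> exceeds \<open>q\<close> is optimal, and it is a preimage
  under \<open>T\<close> since both densities factor through \<open>T\<close>. Hence observing only
  \<open>T\<close> loses no distance.\<close>

lemma tv_dist_sufficient_statistic:
  assumes supp: "set_pmf p \<subseteq> S" "set_pmf q \<subseteq> S"
    and dens: "\<And>x. x \<in> S \<Longrightarrow> pmf p x = f (T x)" "\<And>x. x \<in> S \<Longrightarrow> pmf q x = g (T x)"
  shows "tv_dist (measure_pmf p) (measure_pmf q)
    \<le> tv_dist (measure_pmf (map_pmf T p)) (measure_pmf (map_pmf T q))"
proof -
  define H where "H = {r. g r < f r}"
  have zero: "pmf p x = 0 \<and> pmf q x = 0" if "x \<notin> S" for x
    using that supp by (auto simp: pmf_eq_0_set_pmf)
  have "tv_dist (measure_pmf p) (measure_pmf q) =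
      measure (measure_pmf p) (T -` H) - measure (measure_pmf q) (T -` H)"
  proof (rule tv_dist_pmf_eq)
    fix x
    show "pmf q x \<le> pmf p x" if "x \<in> T -` H"
      using that dens[of x] zero[of x] by (cases "x \<in> S") (auto simp: H_def)
    show "pmf p x \<le> pmf q x" if "x \<notin> T -` H"
      using that dens[of x] zero[of x] by (cases "x \<in> S") (auto simp: H_def)
  qed
  also have "\<dots> \<le> tv_dist (measure_pmf (map_pmf T p)) (measure_pmf (map_pmf T q))"
    using tv_dist_pmf_upper[of H "map_pmf T p" "map_pmf T q"] by simp
  finally show ?thesis .
qed

text \<open>The ratio condition makes the set where \<open>p\<close> exceeds \<open>q\<close> an
  upper set, so the optimal event is a half-line. It is stated with products so that zeros of
  \<open>q\<close> are allowed. The cut is real so that it survives a later affine rescaling;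
  \<open>real j - 1/2\<close> also covers \<open>j = 0\<close>.\<close>

lemma tv_dist_monotone_likelihood_ratio:
  fixes p q :: "nat pmf"
  assumes mlr: "\<And>i j. i \<le> j \<Longrightarrow> pmf p i * pmf q j \<le> pmf p j * pmf q i"
  shows "\<exists>y::real. tv_dist (measure_pmf p) (measure_pmf q) =
    measure (measure_pmf q) {x. real x \<le> y} - measure (measure_pmf p) {x. real x \<le> y}"
proof (cases "\<exists>x. pmf q x < pmf p x")
  case False
  hence "tv_dist (measure_pmf p) (measure_pmf q) = 0"
    by (subst tv_dist_pmf_eq[where H = "{}"]) (auto simp: not_less)
  thus ?thesis by (intro exI[of _ "-1"]) (simp add: not_le)
next
  case True
  define j where "j = (LEAST x. pmf q x < pmf p x)"
  have j: "pmf q j < pmf p j" using True unfolding j_def by (rule LeastI_ex)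
  have below: "pmf p x \<le> pmf q x" if "x < j" for x
    using not_less_Least[of x "\<lambda>x. pmf q x < pmf p x"] that unfolding j_def by auto
  \<comment> \<open>If \<open>q\<close> vanishes at \<open>j\<close>, where \<open>p\<close> is
    positive, the condition forces \<open>q\<close> to vanish from \<open>j\<close> on; otherwise
    \<open>pmf q j\<close> can be cancelled.\<close>
  have above: "pmf q x \<le> pmf p x" if "j \<le> x" for x
  proof (cases "pmf q j = 0")
    case True
    hence "pmf p j * pmf q x \<le> 0" using mlr[OF that] by simp
    thus ?thesis using j True pmf_nonneg[of q x] pmf_nonneg[of p x] by (simp add: mult_le_0_iff)
  next
    case False
    hence pos: "pmf q j > 0" by (simp add: pmf_pos)
    have "pmf q j * pmf q x \<le> pmf p j * pmf q x" using j by (intro mult_right_mono) auto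
    also have "\<dots> \<le> pmf q j * pmf p x" using mlr[OF that] by (simp add: mult.commute)
    finally show ?thesis using pos by simp
  qed
  have "tv_dist (measure_pmf p) (measure_pmf q) =
      measure (measure_pmf p) {j..} - measure (measure_pmf q) {j..}"
    using above below by (intro tv_dist_pmf_eq) auto
  moreover have "measure (measure_pmf r) {j..} = 1 - measure (measure_pmf r) {x. real x \<le> real j - 1/2}" for r
  proof -
    have "{j..} = UNIV - {x. real x \<le> real j - 1/2}" by auto
    thus ?thesis using measure_pmf.prob_compl[of "{x. real x \<le> real j - 1/2}" r] by simp
  qed
  ultimately show ?thesis by (intro exI[of _ "real j - 1/2"]) simp
qed

lemma tv_dist_pmf_approx:
  "\<bar>tv_dist (measure_pmf p) (measure_pmf q) - tv_dist (measure_pmf p') (measure_pmf q')\<bar>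
    \<le> tv_dist (measure_pmf p) (measure_pmf p') + tv_dist (measure_pmf q) (measure_pmf q')"
proof -
  have sym: "tv_dist (measure_pmf r) (measure_pmf r') = tv_dist (measure_pmf r') (measure_pmf r)" for r r' :: "'a pmf"
    unfolding tv_dist_def by (simp add: abs_minus_commute)
  have "tv_dist (measure_pmf r) (measure_pmf s) \<le> tv_dist (measure_pmf r') (measure_pmf s') +
      (tv_dist (measure_pmf r) (measure_pmf r') + tv_dist (measure_pmf s) (measure_pmf s'))" for r s r' s' :: "'a pmf"
  proof (rule tv_dist_least)
    fix A
    show "\<bar>measure (measure_pmf r) A - measure (measure_pmf s) A\<bar> \<le> tv_dist (measure_pmf r') (measure_pmf s') +
      (tv_dist (measure_pmf r) (measure_pmf r') + tv_dist (measure_pmf s) (measure_pmf s'))"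
      using tv_dist_pmf_upper[of A r r'] tv_dist_pmf_upper[of A s s'] tv_dist_pmf_upper[of A r' s']
      by auto
  qed
  from this[of p q p' q'] this[of p' q' p q] show ?thesis using sym[of p' p] sym[of q' q] by linarith
qed

text \<open>Scheffe's lemma. Only the tail of \<open>q\<close> has to be cut off: the estimate is
  made for \<open>q\<close> minus \<open>p n\<close> on a set, where the tail of \<open>p n\<close>
  has the favourable sign, and the other direction follows by taking complements.\<close>

lemma tv_dist_tendsto_0_pmf:
  fixes p :: "'b \<Rightarrow> nat pmf"
  assumes lim: "\<And>y. ((\<lambda>n. pmf (p n) y) \<longlongrightarrow> pmf q y) F"
  shows "((\<lambda>n. tv_dist (measure_pmf (p n)) (measure_pmf q)) \<longlongrightarrow> 0) F"
proof (rule tendstoI)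
  fix e :: real assume e: "e > 0"
  have "(\<lambda>N. measure (measure_pmf q) {..N}) \<longlonglongrightarrow> measure (measure_pmf q) (\<Union>N. {..N})"
    by (intro measure_pmf.finite_Lim_measure_incseq) (auto simp: incseq_def)
  moreover have "(\<Union>N. {..N::nat}) = UNIV" by auto
  ultimately have "(\<lambda>N. measure (measure_pmf q) {..N}) \<longlonglongrightarrow> 1" by simp
  hence "eventually (\<lambda>N. measure (measure_pmf q) {..N} > 1 - e/3) sequentially"
    using e by (intro order_tendstoD) auto
  then obtain N where N: "measure (measure_pmf q) {..N} > 1 - e/3"
    by (auto simp: eventually_sequentially)
  have "((\<lambda>n. \<Sum>y\<le>N. \<bar>pmf (p n) y - pmf q y\<bar>) \<longlongrightarrow> (\<Sum>y\<le>N. \<bar>pmf q y - pmf q y\<bar>)) F"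
    by (intro tendsto_intros lim)
  hence "eventually (\<lambda>n. (\<Sum>y\<le>N. \<bar>pmf (p n) y - pmf q y\<bar>) < e/3) F"
    using e by (intro order_tendstoD) auto
  thus "eventually (\<lambda>n. dist (tv_dist (measure_pmf (p n)) (measure_pmf q)) 0 < e) F"
  proof eventually_elim
    case (elim n)
    have le: "measure (measure_pmf q) A - measure (measure_pmf (p n)) A \<le> 2*e/3" for A
    proof -
      have "measure (measure_pmf q) A \<le> measure (measure_pmf q) (A \<inter> {..N} \<union> {N<..})"
        by (intro measure_pmf.finite_measure_mono) auto
      also have "\<dots> \<le> measure (measure_pmf q) (A \<inter> {..N}) + measure (measure_pmf q) {N<..}"
        by (intro measure_Un_le) auto
      also have "{N<..} = UNIV - {..N}" by auto
      also have "measure (measure_pmf q) \<dots> = 1 - measure (measure_pmf q) {..N}"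
        using measure_pmf.prob_compl[of "{..N}" q] by simp
      finally have "measure (measure_pmf q) A \<le> measure (measure_pmf q) (A \<inter> {..N}) + e/3" using N by simp
      moreover have "measure (measure_pmf q) (A \<inter> {..N}) - measure (measure_pmf (p n)) (A \<inter> {..N})
          = (\<Sum>y\<in>A \<inter> {..N}. pmf q y - pmf (p n) y)"
        by (simp add: measure_measure_pmf_finite sum_subtractf)
      moreover have "\<dots> \<le> (\<Sum>y\<in>A \<inter> {..N}. \<bar>pmf (p n) y - pmf q y\<bar>)" by (intro sum_mono) auto
      moreover have "\<dots> \<le> (\<Sum>y\<le>N. \<bar>pmf (p n) y - pmf q y\<bar>)" by (intro sum_mono2) auto
      moreover have "measure (measure_pmf (p n)) (A \<inter> {..N}) \<le> measure (measure_pmf (p n)) A"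
        by (intro measure_pmf.finite_measure_mono) auto
      ultimately show ?thesis using elim by linarith
    qed
    have "tv_dist (measure_pmf (p n)) (measure_pmf q) \<le> 2*e/3"
    proof (rule tv_dist_least)
      fix A
      show "\<bar>measure (measure_pmf (p n)) A - measure (measure_pmf q) A\<bar> \<le> 2*e/3"
        using le[of A] le[of "UNIV - A"] measure_pmf.prob_compl[of A q] measure_pmf.prob_compl[of A "p n"]
        unfolding space_measure_pmf sets_measure_pmf by (intro abs_leI) simp_all
    qed
    moreover have "0 \<le> tv_dist (measure_pmf (p n)) (measure_pmf q)"
      using tv_dist_pmf_upper[of "{}" "p n" q] by simp
    ultimately show ?case using e by simp
  qed
qed

lemma tv_dist_pmf_tendsto:
  fixes p q :: "'b \<Rightarrow> nat pmf"
  assumes "\<And>y. ((\<lambda>n. pmf (p n) y) \<longlongrightarrow> pmf p' y) F" "\<And>y. ((\<lambda>n. pmf (q n) y) \<longlongrightarrow> pmf q' y) F"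
  shows "((\<lambda>n. tv_dist (measure_pmf (p n)) (measure_pmf (q n)))
    \<longlongrightarrow> tv_dist (measure_pmf p') (measure_pmf q')) F"
proof -
  have lim: "((\<lambda>n. tv_dist (measure_pmf (p n)) (measure_pmf p') + tv_dist (measure_pmf (q n)) (measure_pmf q')) \<longlongrightarrow> 0) F"
    by (rule tendsto_add_zero) (rule tv_dist_tendsto_0_pmf assms)+
  have "((\<lambda>n. tv_dist (measure_pmf (p n)) (measure_pmf (q n)) - tv_dist (measure_pmf p') (measure_pmf q')) \<longlongrightarrow> 0) F"
    by (rule Lim_null_comparison[OF _ lim]) (simp add: tv_dist_pmf_approx)
  thus ?thesis by (simp only: Lim_null[symmetric])
qed

section \<open>The fully sorted start is the worst one\<close>

lemma switch_switch: "switch i j (switch i j U) = U"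
proof -
  consider "i \<in> U" "j \<notin> U" | "j \<in> U" "i \<notin> U" | "i \<in> U \<longleftrightarrow> j \<in> U" by blast
  thus ?thesis
  proof cases
    case 1
    hence "switch i j U = insert j (U - {i})" by (simp add: switch_def)
    moreover have "i \<noteq> j" using 1 by auto
    ultimately show ?thesis using 1 by (simp add: switch_def insert_absorb)
  next
    case 2
    hence "switch i j U = insert i (U - {j})" by (simp add: switch_def)
    moreover have "i \<noteq> j" using 2 by auto
    ultimately show ?thesis using 2 by (simp add: switch_def insert_absorb)
  next
    case 3
    thus ?thesis by (auto simp: switch_def)
  qed
qed

text \<open>Each switch is an involution, so the pairs that lead from \<open>U\<close> to
  \<open>V\<close> are those that lead back.\<close>

lemma pmf_draw_pair_commute: "pmf (draw_pair n U) V = pmf (draw_pair n V) U"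
proof -
  have "switch i j U = V \<longleftrightarrow> switch i j V = U" for i j
    using switch_switch by metis
  hence "(\<lambda>(i, j). switch i j U) -` {V} = (\<lambda>(i, j). switch i j V) -` {U}"
    unfolding vimage_def case_prod_unfold singleton_iff by (intro Collect_cong) blast
  thus ?thesis by (simp only: draw_pair_def pmf_map)
qed

lemma finite_urn_config: "finite {V. urn_config k n V}"
  by (rule finite_subset[of _ "Pow {..<n}"]) (auto simp: urn_config_def)

lemma urn_config_draw_pair:
  assumes "urn_config k n U" "V \<in> set_pmf (draw_pair n U)" "n > 0"
  shows "urn_config k n V"
  using urn_config_after_draws[of k n U V 1] assms by (simp add: bind_return_pmf)

lemma urn_config_config_law:
  assumes "urn_config k n U" "n > 0"
  shows "set_pmf (config_law n U t) \<subseteq> {V. urn_config k n V}"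
  using urn_config_after_draws[OF assms(1) _ assms(2)] by (auto simp: config_law_def)

text \<open>Since the kernel is symmetric, the mass of \<open>V\<close> after one more draw is the
  expectation, over one draw from \<open>V\<close>, of the previous mass function. By induction the
  latter depends on the red count alone, and the law of the red count after a draw from
  \<open>V\<close> depends only on that of \<open>V\<close>. The start \<open>{..<k}\<close> enters
  because it is the only configuration with \<open>k\<close> red balls.\<close>

lemma pmf_after_draws_sorted:
  assumes k: "2 * k \<le> n" "k > 0"
  shows "\<exists>h. \<forall>V. urn_config k n V \<longrightarrow> pmf (after_draws n {..<k} m) V = h (red_count k V)"
proof (induction m)
  case 0
  have "pmf (return_pmf {..<k}) V = of_bool (red_count k V = k)" if "urn_config k n V" for V
  proof -
    have "finite V" "card V = k" using that by (auto simp: urn_config_def intro: finite_subset)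
    moreover have "V = {..<k}" if "red_count k V = k"
    proof -
      have "V \<inter> {..<k} = V"
        using that calculation by (intro card_subset_eq) (auto simp: red_count_def)
      hence "V \<subseteq> {..<k}" by blast
      thus ?thesis using calculation by (intro card_subset_eq) auto
    qed
    moreover have "V \<noteq> {..<k}" if "red_count k V \<noteq> k" using that by (auto simp: red_count_def)
    ultimately have "{..<k} = V \<longleftrightarrow> red_count k V = k" by blast
    thus ?thesis by (simp add: indicator_def)
  qed
  thus ?case unfolding after_draws.simps by (intro exI[of _ "\<lambda>r. of_bool (r = k)"]) auto
next
  case (Suc m)
  then obtain h where h: "\<And>V. urn_config k n V \<Longrightarrow> pmf (after_draws n {..<k} m) V = h (red_count k V)"
    by blast
  have n: "n > 0" using k by simp
  have c0: "urn_config k n {..<k}" using k by (auto simp: urn_config_def)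
  let ?C = "{V. urn_config k n V}"
  have "pmf (after_draws n {..<k} (Suc m)) V =
      (\<Sum>y\<le>k. h y * (of_bool (red_count k V = y) + urn_generator k n (red_count k V) y))"
    if V: "urn_config k n V" for V
  proof -
    have "pmf (after_draws n {..<k} (Suc m)) V =
        measure_pmf.expectation (after_draws n {..<k} m) (\<lambda>U. pmf (draw_pair n U) V)"
      by (simp add: pmf_bind)
    also have "\<dots> = (\<Sum>U\<in>?C. pmf (draw_pair n U) V * pmf (after_draws n {..<k} m) U)"
      using urn_config_after_draws[OF c0 _ n]
      by (intro integral_measure_pmf_real) (auto simp: finite_urn_config)
    also have "\<dots> = (\<Sum>U\<in>?C. h (red_count k U) * pmf (draw_pair n V) U)"
      by (intro sum.cong) (auto simp: h pmf_draw_pair_commute[of n _ V])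
    also have "\<dots> = measure_pmf.expectation (draw_pair n V) (\<lambda>U. h (red_count k U))"
      using urn_config_draw_pair[OF V _ n]
      by (intro integral_measure_pmf_real[symmetric]) (auto simp: finite_urn_config)
    also have "\<dots> = measure_pmf.expectation (map_pmf (red_count k) (draw_pair n V)) h" by simp
    also have "\<dots> = (\<Sum>y\<le>k. h y * pmf (map_pmf (red_count k) (draw_pair n V)) y)"
      by (intro integral_measure_pmf_real) (auto simp: red_count_le)
    finally show ?thesis by (simp add: pmf_draw_pair_eq[OF V k])
  qed
  thus ?case by (intro exI[of _ "\<lambda>r. \<Sum>y\<le>k. h y * (of_bool (r = y) + urn_generator k n r y)"]) auto
qed

lemma pmf_config_law_sorted:
  assumes "2 * k \<le> n" "k > 0"
  shows "\<exists>h. \<forall>V. urn_config k n V \<longrightarrow> pmf (config_law n {..<k} t) V = h (red_count k V)"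
proof -
  obtain h where h: "\<And>m V. urn_config k n V \<Longrightarrow> pmf (after_draws n {..<k} m) V = h m (red_count k V)"
    using pmf_after_draws_sorted[OF assms] by metis
  thus ?thesis
    by (intro exI[of _ "\<lambda>r. measure_pmf.expectation (num_points t) (\<lambda>m. h m r)"])
      (simp add: config_law_def pmf_bind)
qed

section \<open>Uniform configurations and the hypergeometric law\<close>

lemma card_urn_config_red_count:
  assumes "k \<le> n"
  shows "card {V. urn_config k n V \<and> red_count k V = r} = (k choose r) * ((n - k) choose (k - r))"
proof (cases "r \<le> k")
  case False
  hence "{V. urn_config k n V \<and> red_count k V = r} = {}" using red_count_le[of k] by auto
  thus ?thesis using False by (simp only:) (simp add: binomial_eq_0)
next
  case True
  let ?A = "{A. A \<subseteq> {..<k} \<and> card A = r}" and ?B = "{B. B \<subseteq> {k..<n} \<and> card B = k - r}"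
  have fin: "finite V" if "V \<subseteq> {..<n}" for V using that by (rule finite_subset) auto
  have "bij_betw (\<lambda>(A, B). A \<union> B) (?A \<times> ?B) {V. urn_config k n V \<and> red_count k V = r}"
  proof (rule bij_betw_byWitness[where f' = "\<lambda>V. (V \<inter> {..<k}, V \<inter> {k..<n})"], goal_cases)
    case 1
    show ?case by auto
  next
    case 2
    show ?case by (auto simp: urn_config_def)
  next
    case 3
    have "card (A \<union> B) = k \<and> red_count k (A \<union> B) = r \<and> A \<union> B \<subseteq> {..<n}"
      if "A \<in> ?A" "B \<in> ?B" for A B
    proof -
      have *: "finite A" "finite B" using that by (auto intro: finite_subset)
      have "A \<inter> B = {}" "(A \<union> B) \<inter> {..<k} = A" using that by fastforce+
      thus ?thesis using that * True assms by (auto simp: card_Un_disjoint red_count_def)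
    qed
    thus ?case by (auto simp: urn_config_def)
  next
    case 4
    have "card (V \<inter> {..<k}) = r \<and> card (V \<inter> {k..<n}) = k - r"
      if "urn_config k n V" "red_count k V = r" for V
    proof -
      have V: "V \<subseteq> {..<n}" "card V = k" using that by (auto simp: urn_config_def)
      have "card V = card (V \<inter> {..<k}) + card (V \<inter> {k..<n})"
        using fin[OF V(1)] V(1) by (subst card_Un_disjoint[symmetric]) (auto intro!: arg_cong[where f = card])
      thus ?thesis using that V by (auto simp: red_count_def)
    qed
    thus ?case by auto
  qed
  hence "card {V. urn_config k n V \<and> red_count k V = r} = card (?A \<times> ?B)"
    by (simp add: bij_betw_same_card)
  also have "\<dots> = (k choose r) * ((n - k) choose (k - r))"
    using n_subsets[of "{..<k}" r] n_subsets[of "{k..<n}" "k - r"] by (simp add: card_cartesian_product)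
  finally show ?thesis .
qed

definition uniform_config :: "nat \<Rightarrow> nat \<Rightarrow> nat set pmf" where
  "uniform_config k n = pmf_of_set {V. urn_config k n V}"

lemma set_pmf_uniform_config:
  assumes "k \<le> n"
  shows "set_pmf (uniform_config k n) = {V. urn_config k n V}"
proof -
  have "urn_config k n {..<k}" using assms by (auto simp: urn_config_def)
  thus ?thesis unfolding uniform_config_def using finite_urn_config by (intro set_pmf_of_set) auto
qed

lemma pmf_uniform_config:
  assumes "k \<le> n"
  shows "pmf (uniform_config k n) V = of_bool (urn_config k n V) / real (n choose k)"
proof -
  have "urn_config k n {..<k}" using assms by (auto simp: urn_config_def)
  moreover have "card {V. urn_config k n V} = n choose k"
    using n_subsets[of "{..<n}" k] by (simp add: urn_config_def)
  ultimately show ?thesis unfolding uniform_config_def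
    using finite_urn_config by (subst pmf_of_set) (auto simp: indicator_def)
qed

lemma map_pmf_red_count_uniform_config:
  assumes "k \<le> n"
  shows "map_pmf (red_count k) (uniform_config k n) = urn_equilibrium k n"
proof (rule pmf_eqI)
  fix r
  let ?C = "{V. urn_config k n V}"
  have ne: "{..<k} \<in> ?C" using assms by (auto simp: urn_config_def)
  have "?C \<inter> red_count k -` {r} = {V. urn_config k n V \<and> red_count k V = r}" by auto
  moreover have "card ?C = n choose k"
    using n_subsets[of "{..<n}" k] by (simp add: urn_config_def)
  ultimately show "pmf (map_pmf (red_count k) (uniform_config k n)) r = pmf (urn_equilibrium k n) r"
    using ne card_urn_config_red_count[OF assms, of r]
    unfolding pmf_urn_equilibrium[OF assms] pmf_map uniform_config_def
    by (subst measure_pmf_of_set) (auto simp: finite_urn_config)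
qed

section \<open>Invariance under relabelling of the balls\<close>

lemma draw_pair_permutes:
  assumes "\<sigma> permutes {..<n}" "n > 0"
  shows "draw_pair n (\<sigma> ` U) = map_pmf (image \<sigma>) (draw_pair n U)"
proof -
  have inj: "inj \<sigma>" using assms permutes_inj by blast
  have sw: "switch (\<sigma> i) (\<sigma> j) (\<sigma> ` U) = \<sigma> ` switch i j U" for i j
    by (auto simp: switch_def inj_image_mem_iff[OF inj] image_set_diff[OF inj])
  have img: "map_prod \<sigma> \<sigma> ` ({..<n} \<times> {..<n}) = {..<n} \<times> {..<n}"
    using permutes_image[OF assms(1)] by (simp add: map_prod_surj_on)
  have "pmf_of_set ({..<n} \<times> {..<n}) = map_pmf (map_prod \<sigma> \<sigma>) (pmf_of_set ({..<n} \<times> {..<n}))"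
    using assms inj img
    by (subst map_pmf_of_set_inj) (auto intro!: inj_on_subset[OF prod.inj_map])
  hence "draw_pair n (\<sigma> ` U) = map_pmf (\<lambda>(i, j). switch i j (\<sigma> ` U))
      (map_pmf (map_prod \<sigma> \<sigma>) (pmf_of_set ({..<n} \<times> {..<n})))"
    by (simp add: draw_pair_def)
  thus ?thesis by (simp add: draw_pair_def pmf.map_comp o_def case_prod_unfold sw)
qed

lemma config_law_permutes:
  assumes "\<sigma> permutes {..<n}" "n > 0"
  shows "config_law n (\<sigma> ` U) t = map_pmf (image \<sigma>) (config_law n U t)"
proof -
  have "after_draws n (\<sigma> ` U) = (\<lambda>m. map_pmf (image \<sigma>) (after_draws n U m))"
  proof
    show "after_draws n (\<sigma> ` U) m = map_pmf (image \<sigma>) (after_draws n U m)" for m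
      by (induction m) (simp_all add: map_bind_pmf bind_map_pmf draw_pair_permutes[OF assms])
  qed
  thus ?thesis by (simp add: config_law_def map_bind_pmf)
qed

lemma uniform_config_permutes:
  assumes "\<sigma> permutes {..<n}" "k \<le> n"
  shows "map_pmf (image \<sigma>) (uniform_config k n) = uniform_config k n"
proof -
  have inj: "inj \<sigma>" using assms permutes_inj by blast
  have ne: "{..<k} \<in> {V. urn_config k n V}" using assms by (auto simp: urn_config_def)
  have sub: "image \<tau> ` {V. urn_config k n V} \<subseteq> {V. urn_config k n V}" if "\<tau> permutes {..<n}" for \<tau>
    using that permutes_image[OF that] permutes_inj[OF that]
    by (auto simp: urn_config_def card_image inj_on_subset)
  have eq: "image \<sigma> ` {V. urn_config k n V} = {V. urn_config k n V}"
  proof (rule antisym[OF sub[OF assms(1)]])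
    have "{V. urn_config k n V} = image \<sigma> ` image (inv \<sigma>) ` {V. urn_config k n V}"
      by (simp add: image_image permutes_inverses[OF assms(1)])
    also have "\<dots> \<subseteq> image \<sigma> ` {V. urn_config k n V}"
      by (rule image_mono[OF sub[OF permutes_inv[OF assms(1)]]])
    finally show "{V. urn_config k n V} \<subseteq> image \<sigma> ` {V. urn_config k n V}" .
  qed
  have "inj_on (image \<sigma>) {V. urn_config k n V}"
    by (auto intro!: inj_onI simp: inj_image_eq_iff[OF inj])
  hence "map_pmf (image \<sigma>) (uniform_config k n) = pmf_of_set (image \<sigma> ` {V. urn_config k n V})"
    unfolding uniform_config_def using ne finite_urn_config by (intro map_pmf_of_set_inj) auto
  thus ?thesis by (simp only: eq uniform_config_def)
qed

lemma start_config_permutes: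
  assumes "x \<le> k" "2 * k \<le> n"
  shows "\<exists>\<sigma>. \<sigma> permutes {..<n} \<and> start_config k x = \<sigma> ` {..<k}"
proof -
  \<comment> \<open>The involution that exchanges the blocks \<open>{x..<k}\<close> and
    \<open>{k..<k + (k - x)}\<close> and fixes all other balls.\<close>
  define \<sigma> where "\<sigma> i = (if i < x then i else if i < k then i + (k - x)
    else if i < k + (k - x) then i - (k - x) else i)" for i
  have inv: "\<sigma> (\<sigma> i) = i" for i using assms by (auto simp: \<sigma>_def)
  have "\<sigma> permutes {..<n}"
  proof (rule bij_imp_permutes)
    have "i \<in> {..<n} \<Longrightarrow> \<sigma> i \<in> {..<n}" for i using assms by (auto simp: \<sigma>_def)
    thus "bij_betw \<sigma> {..<n} {..<n}" using inv by (intro bij_betw_byWitness[where f' = \<sigma>]) auto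
    show "\<sigma> i = i" if "i \<notin> {..<n}" for i using that assms by (auto simp: \<sigma>_def)
  qed
  moreover have "start_config k x = \<sigma> ` {..<k}"
  proof
    show "\<sigma> ` {..<k} \<subseteq> start_config k x" using assms by (auto simp: \<sigma>_def start_config_def)
    have "\<sigma> i < k" if "i \<in> start_config k x" for i
      using that assms by (auto simp: \<sigma>_def start_config_def)
    thus "start_config k x \<subseteq> \<sigma> ` {..<k}" using inv by (metis imageI lessThan_iff subsetI)
  qed
  ultimately show ?thesis by blast
qed

lemma tv_dist_urn_law_le:
  assumes x: "x \<le> k" and k: "2 * k \<le> n" "k > 0"
  shows "tv_dist (measure_pmf (urn_law k n x t)) (measure_pmf (urn_equilibrium k n))
    \<le> tv_dist (measure_pmf (urn_law k n k t)) (measure_pmf (urn_equilibrium k n))"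
proof -
  have n: "n > 0" "k \<le> n" using k by auto
  have c0: "urn_config k n {..<k}" using k by (auto simp: urn_config_def)
  obtain \<sigma> where \<sigma>: "\<sigma> permutes {..<n}" "start_config k x = \<sigma> ` {..<k}"
    using start_config_permutes[OF x k(1)] by blast
  \<comment> \<open>The dependence on \<open>x\<close> is moved from the initial configuration into
    the observable: the dynamics now always starts from \<open>{..<k}\<close>, and \<open>f\<close>
    counts red balls after relabelling.\<close>
  define f where "f V = red_count k (\<sigma> ` V)" for V
  let ?W = "config_law n {..<k} t" and ?Q = "uniform_config k n"
  have "urn_law k n x t = map_pmf f ?W"
    by (simp add: urn_law_def \<sigma>(2) config_law_permutes[OF \<sigma>(1) n(1)] pmf.map_comp o_def f_def[abs_def])
  moreover have "urn_equilibrium k n = map_pmf f ?Q"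
  proof -
    have "urn_equilibrium k n = map_pmf (red_count k) (map_pmf (image \<sigma>) ?Q)"
      by (simp add: uniform_config_permutes[OF \<sigma>(1) n(2)] map_pmf_red_count_uniform_config[OF n(2)])
    thus ?thesis by (simp add: pmf.map_comp o_def f_def[abs_def])
  qed
  ultimately have "tv_dist (measure_pmf (urn_law k n x t)) (measure_pmf (urn_equilibrium k n))
      \<le> tv_dist (measure_pmf ?W) (measure_pmf ?Q)"
    by (simp only: tv_dist_map_pmf_le)
  also obtain h where h: "\<And>V. urn_config k n V \<Longrightarrow> pmf ?W V = h (red_count k V)"
    using pmf_config_law_sorted[OF k] by blast
  \<comment> \<open>In contrast to the passage to configurations, this step back to red counts is
    lossless: on configurations one density is a function of the red count and the other is
    constant.\<close>
  have "tv_dist (measure_pmf ?W) (measure_pmf ?Q)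
      \<le> tv_dist (measure_pmf (map_pmf (red_count k) ?W)) (measure_pmf (map_pmf (red_count k) ?Q))"
    by (rule tv_dist_sufficient_statistic[where S = "{V. urn_config k n V}" and f = h
          and g = "\<lambda>_. 1 / real (n choose k)"])
      (use n in \<open>auto simp: h set_pmf_uniform_config pmf_uniform_config
        dest: subsetD[OF urn_config_config_law[OF c0 n(1)]]\<close>)
  also have "map_pmf (red_count k) ?W = urn_law k n k t" by (simp add: urn_law_def start_config_def)
  also have "map_pmf (red_count k) ?Q = urn_equilibrium k n"
    by (rule map_pmf_red_count_uniform_config[OF n(2)])
  finally show ?thesis .
qed

lemma urn_tv_eq:
  assumes "2 * k \<le> n" "k > 0"
  shows "urn_tv k n t = tv_dist (measure_pmf (urn_law k n k t)) (measure_pmf (urn_equilibrium k n))"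
  unfolding urn_tv_def by (intro Max_eqI) (auto intro!: tv_dist_urn_law_le assms)

section \<open>The generator\<close>

text \<open>The rates of the birth--death chain in the time scale \<open>s = t / n\<close>.\<close>

locale urn =
  fixes k n :: nat
  assumes k_pos: "k > 0" and k_le: "2 * k \<le> n"
begin

lemma n_pos: "n > 0" using k_pos k_le by simp

definition up :: "nat \<Rightarrow> real" where
  "up x = 2 * (real k - real x)\<^sup>2 / real n"

definition down :: "nat \<Rightarrow> real" where
  "down x = 2 * real x * (real n - 2 * real k + real x) / real n"

lemma up_nonneg: "0 \<le> up x" by (simp add: up_def)

lemma down_nonneg: "0 \<le> down x"
proof -
  have "2 * real k \<le> real n" using k_le by linarith
  thus ?thesis by (simp add: down_def)
qed

text \<open>No boundary cases remain: \<open>up\<close> vanishes at \<open>k\<close> and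
  \<open>down\<close> at 0, so the values at \<open>k + 1\<close> and at the truncated
  \<open>0 - 1\<close> carry weight zero. The values lie in a real vector space because the test
  functions below are complex.\<close>

lemma sum_generator:
  fixes f :: "nat \<Rightarrow> 'a :: real_vector"
  assumes x: "x \<le> k"
  shows "(\<Sum>y\<le>k. (real n * urn_generator k n x y) *\<^sub>R f y) =
    up x *\<^sub>R (f (x + 1) - f x) + down x *\<^sub>R (f (x - 1) - f x)"
proof -
  have rate: "real n * urn_rate k n x y = (if y = x + 1 \<and> y \<le> k then up x else 0) + (if x = y + 1 then down x else 0)" for y
    using n_pos by (simp add: urn_rate_def up_def down_def power2_eq_square field_simps)
  have diag: "urn_generator k n x x = - (\<Sum>y\<in>{..k} - {x}. urn_rate k n x y)"
    by (simp add: urn_generator_def)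
  have "(\<Sum>y\<le>k. (real n * urn_generator k n x y) *\<^sub>R f y) =
      (real n * urn_generator k n x x) *\<^sub>R f x + (\<Sum>y\<in>{..k} - {x}. (real n * urn_generator k n x y) *\<^sub>R f y)"
    using x by (intro sum.remove) auto
  also have "(\<Sum>y\<in>{..k} - {x}. (real n * urn_generator k n x y) *\<^sub>R f y) =
      (\<Sum>y\<in>{..k} - {x}. (real n * urn_rate k n x y) *\<^sub>R f y)"
    by (intro sum.cong) (auto simp: urn_generator_def)
  also have "(real n * urn_generator k n x x) *\<^sub>R f x = - (\<Sum>y\<in>{..k} - {x}. (real n * urn_rate k n x y) *\<^sub>R f x)"
    unfolding diag by (simp add: scaleR_sum_left sum_distrib_left)
  also have "- (\<Sum>y\<in>{..k} - {x}. (real n * urn_rate k n x y) *\<^sub>R f x) +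
      (\<Sum>y\<in>{..k} - {x}. (real n * urn_rate k n x y) *\<^sub>R f y) =
      (\<Sum>y\<in>{..k} - {x}. (real n * urn_rate k n x y) *\<^sub>R (f y - f x))"
    by (simp add: scaleR_diff_right sum_subtractf)
  also have "\<dots> = (\<Sum>y\<le>k. (real n * urn_rate k n x y) *\<^sub>R (f y - f x))"
    by (intro sum.mono_neutral_left) auto
  also have "\<dots> = (\<Sum>y\<le>k. (if y = x + 1 then up x *\<^sub>R (f y - f x) else 0)) +
      (\<Sum>y\<le>k. (if x = y + 1 then down x *\<^sub>R (f y - f x) else 0))"
    unfolding rate sum.distrib[symmetric] by (intro sum.cong) (auto simp: scaleR_left_distrib)
  also have "(\<Sum>y\<le>k. (if y = x + 1 then up x *\<^sub>R (f y - f x) else 0)) = up x *\<^sub>R (f (x + 1) - f x)"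
  proof (cases "x = k")
    case True
    thus ?thesis by (auto simp: up_def intro!: sum.neutral)
  next
    case False
    thus ?thesis using x by (simp add: sum.delta)
  qed
  also have "(\<Sum>y\<le>k. (if x = y + 1 then down x *\<^sub>R (f y - f x) else 0)) = down x *\<^sub>R (f (x - 1) - f x)"
  proof (cases x)
    case 0
    thus ?thesis by (simp add: down_def)
  next
    case (Suc w)
    have "(\<Sum>y\<le>k. (if x = y + 1 then down x *\<^sub>R (f y - f x) else 0)) =
        (\<Sum>y\<le>k. (if y = w then down x *\<^sub>R (f y - f x) else 0))"
      using Suc by (intro sum.cong) auto
    thus ?thesis using x Suc by (simp add: sum.delta)
  qed
  finally show ?thesis .
qed

section \<open>Reversibility with respect to the hypergeometric law\<close>

abbreviation equilibrium :: "nat \<Rightarrow> real" where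
  "equilibrium \<equiv> pmf (urn_equilibrium k n)"

lemma equilibrium_eq:
  "equilibrium r = real (k choose r) * real ((n - k) choose (k - r)) / real (n choose k)"
  using k_le by (intro pmf_urn_equilibrium) simp

lemma equilibrium_pos: "r \<le> k \<Longrightarrow> equilibrium r > 0"
  using k_le by (simp add: equilibrium_eq)

lemma equilibrium_eq_0: "r > k \<Longrightarrow> equilibrium r = 0"
  by (simp add: equilibrium_eq)

text \<open>The absorption identity, once for each of the two binomials in the numerator. The factor
  \<open>n - k - j\<close> that it produces is the number of black balls in the second urn in state
  \<open>Suc x\<close>.\<close>

lemma detailed_balance_step:
  assumes "x < k"
  shows "equilibrium x * urn_rate k n x (Suc x) = equilibrium (Suc x) * urn_rate k n (Suc x) x"
proof -
  have choose: "Suc j * (m choose Suc j) = (m - j) * (m choose j)" for m j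
    by (simp only: binomial_absorption binomial_absorb_comp)
  define j where "j = k - Suc x"
  have kx: "k - x = Suc j" using assms by (simp add: j_def)
  have 1: "real (Suc x) * real (k choose Suc x) = real (Suc j) * real (k choose x)"
    using choose[of x k] kx by (metis of_nat_mult)
  have 2: "real (Suc j) * real ((n - k) choose Suc j) = real (n - k - j) * real ((n - k) choose j)"
    using choose[of j "n - k"] by (metis of_nat_mult)
  have 3: "real (n - k - j) = real n - 2 * real k + real (Suc x)"
    using assms k_le by (simp add: j_def of_nat_diff)
  have 4: "real k - real x = real (Suc j)" using kx assms by linarith
  have "equilibrium x * urn_rate k n x (Suc x) =
      2 / (real (n choose k) * (real n)\<^sup>2) * ((real (Suc j) * real (k choose x)) * (real (Suc j) * real ((n - k) choose Suc j)))"
    unfolding equilibrium_eq kx using assms by (simp add: urn_rate_def 4 power2_eq_square)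
  also have "\<dots> = equilibrium (Suc x) * urn_rate k n (Suc x) x"
    unfolding 1[symmetric] 2 3 equilibrium_eq j_def[symmetric]
    by (simp add: urn_rate_def)
  finally show ?thesis .
qed

lemma detailed_balance:
  assumes "x \<le> k" "y \<le> k"
  shows "equilibrium x * urn_generator k n x y = equilibrium y * urn_generator k n y x"
proof -
  consider "x = y" | "y = Suc x" | "x = Suc y" | "x \<noteq> y" "y \<noteq> Suc x" "x \<noteq> Suc y" by blast
  thus ?thesis
  proof cases
    case 2
    thus ?thesis using detailed_balance_step[of x] assms by (simp add: urn_generator_def)
  next
    case 3
    thus ?thesis using detailed_balance_step[of y] assms by (simp add: urn_generator_def)
  qed (simp_all add: urn_generator_def urn_rate_def)
qed

lemma equilibrium_stationary:
  assumes "y \<le> k"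
  shows "(\<Sum>x\<le>k. equilibrium x * urn_generator k n x y) = 0"
proof -
  have "real n * (\<Sum>x\<le>k. urn_generator k n y x) = 0"
    using sum_generator[OF assms, of "\<lambda>_. 1 :: real"] by (simp add: sum_distrib_left)
  hence "(\<Sum>x\<le>k. urn_generator k n y x) = 0" using n_pos by simp
  moreover have "(\<Sum>x\<le>k. equilibrium x * urn_generator k n x y) = equilibrium y * (\<Sum>x\<le>k. urn_generator k n y x)"
    unfolding sum_distrib_left using assms by (intro sum.cong) (auto simp: detailed_balance[of _ y])
  ultimately show ?thesis by simp
qed

section \<open>Monotone likelihood ratio\<close>

text \<open>For a single draw, the probabilities of moving from \<open>x\<close> to
  \<open>x + 1\<close> and from \<open>x + 1\<close> to \<open>x\<close> add up to at most 1. This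
  is the condition under which one step of a birth--death chain maps increasing functions to
  increasing functions.\<close>

lemma rates_le:
  assumes "x < k"
  shows "up x + down (Suc x) \<le> real n"
proof -
  \<comment> \<open>In these terms the two rates are 2 a^2 / n and 2 b c / n, and n = 2 (a - 1) + b
    + c.\<close>
  define a b c where "a = real k - real x" and "b = real n - 2 * real k + real (Suc x)" and "c = real (Suc x)"
  have a: "a \<ge> 1" using assms by (simp add: a_def)
  have bc: "b \<ge> 1" "c \<ge> 1" using k_le by (simp_all add: b_def c_def)
  have n: "real n = 2 * (a - 1) + (b + c)" by (simp add: a_def b_def c_def)
  have "2 * a\<^sup>2 + 2 * b * c \<le> (real n)\<^sup>2"
  proof -
    have "4 * (a - 1) * (b + c) \<ge> 4 * (a - 1) * 2" using a bc by (intro mult_left_mono) auto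
    moreover have "(b + c)\<^sup>2 \<ge> 2\<^sup>2" using bc by (intro power_mono) auto
    moreover have "a\<^sup>2 \<ge> 1" using a by simp
    moreover have "(b - c)\<^sup>2 \<ge> 0" by simp
    ultimately show ?thesis unfolding n by (simp add: power2_eq_square algebra_simps)
  qed
  moreover have "real n - 2 * real k + c = b" by (simp add: b_def c_def)
  hence "up x + down (Suc x) = (2 * a\<^sup>2 + 2 * b * c) / real n"
    unfolding up_def down_def a_def[symmetric] c_def[symmetric]
    by (simp add: add_divide_distrib mult_ac)
  ultimately show ?thesis using n_pos by (simp add: divide_le_eq power2_eq_square)
qed

text \<open>By detailed balance, the density with respect to equilibrium evolves by applying the
  one-draw kernel to it as a function. Its new increment at \<open>y\<close> is then a combination
  of the old increments at \<open>y - 1\<close>, \<open>y\<close> and \<open>y + 1\<close> with the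
  weights \<open>down y\<close>, \<open>n - up y - down (Suc y)\<close> and
  \<open>up (Suc y)\<close>, up to the factor 1 / n; the middle one is nonnegative by
  \<open>rates_le\<close>. The initial density is concentrated at \<open>k\<close>, hence
  increasing.\<close>

lemma likelihood_ratio_after_draws_mono:
  fixes m
  defines "g \<equiv> \<lambda>y. pmf (map_pmf (red_count k) (after_draws n {..<k} m)) y / equilibrium y"
  assumes "y < k"
  shows "g y \<le> g (Suc y)"
  using assms(2) unfolding g_def
proof (induction m arbitrary: y)
  case 0
  thus ?case by (simp add: red_count_def)
next
  case (Suc m)
  define r where "r y = pmf (map_pmf (red_count k) (after_draws n {..<k} m)) y" for y
  define g where "g y = r y / equilibrium y" for y
  have n: "real n > 0" using n_pos by simp
  have c0: "urn_config k n {..<k}" using k_le by (auto simp: urn_config_def)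
  have mono: "g y \<le> g (Suc y)" if "y < k" for y using Suc.IH[OF that] by (simp add: g_def r_def)
  have r: "r y = equilibrium y * g y" if "y \<le> k" for y
    using equilibrium_pos[OF that] by (simp add: g_def)
  have step: "pmf (map_pmf (red_count k) (after_draws n {..<k} (Suc m))) y / equilibrium y =
      g y + (up y * (g (Suc y) - g y) + down y * (g (y - 1) - g y)) / real n" if y: "y \<le> k" for y
  proof -
    have "(\<Sum>x\<le>k. r x * urn_generator k n x y) = (\<Sum>x\<le>k. equilibrium y * (urn_generator k n y x * g x))"
      using y by (intro sum.cong) (auto simp: r detailed_balance[of _ y, symmetric])
    also have "\<dots> = equilibrium y / real n * (\<Sum>x\<le>k. (real n * urn_generator k n y x) *\<^sub>R g x)"
      using n by (simp add: sum_distrib_left mult_ac)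
    also have "\<dots> = equilibrium y * ((up y * (g (Suc y) - g y) + down y * (g (y - 1) - g y)) / real n)"
      unfolding sum_generator[OF y] by simp
    finally show ?thesis
      unfolding pmf_after_draws_Suc[OF c0 k_le k_pos y] r_def[symmetric]
      using equilibrium_pos[OF y] by (simp add: r[OF y] add_divide_distrib)
  qed
  have "0 \<le> up (Suc y) * (g (Suc (Suc y)) - g (Suc y))"
    using mono[of "Suc y"] Suc.prems up_nonneg[of "Suc y"] by (cases "Suc y = k") (auto simp: up_def)
  moreover have "0 \<le> down y * (g y - g (y - 1))"
    using mono[of "y - 1"] Suc.prems mult_nonneg_nonneg[OF down_nonneg[of y], of "g y - g (y - 1)"]
    by (cases y) (simp_all add: down_def)
  moreover have "0 \<le> (real n - up y - down (Suc y)) * (g (Suc y) - g y)"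
    using rates_le[OF Suc.prems] mono[OF Suc.prems] by (intro mult_nonneg_nonneg) auto
  ultimately have "real n * g y + (up y * (g (Suc y) - g y) + down y * (g (y - 1) - g y))
      \<le> real n * g (Suc y) + (up (Suc y) * (g (Suc (Suc y)) - g (Suc y)) + down (Suc y) * (g y - g (Suc y)))"
    by (simp add: algebra_simps)
  hence "(real n * g y + (up y * (g (Suc y) - g y) + down y * (g (y - 1) - g y))) / real n
      \<le> (real n * g (Suc y) + (up (Suc y) * (g (Suc (Suc y)) - g (Suc y)) + down (Suc y) * (g y - g (Suc y)))) / real n"
    using n by (intro divide_right_mono) auto
  thus ?case using Suc.prems step[of y] step[of "Suc y"] n by (simp add: add_divide_distrib)
qed

lemma likelihood_ratio_after_draws:
  assumes "i \<le> j" "j \<le> k"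
  defines "r \<equiv> \<lambda>m. pmf (map_pmf (red_count k) (after_draws n {..<k} m))"
  shows "r m i * equilibrium j \<le> r m j * equilibrium i"
proof -
  have "r m i / equilibrium i \<le> r m j / equilibrium j"
    using assms(1,2)
  proof (induction j rule: dec_induct)
    case (step l)
    thus ?case using likelihood_ratio_after_draws_mono[of l m] unfolding r_def by force
  qed simp
  thus ?thesis using equilibrium_pos[of i] equilibrium_pos[of j] assms by (simp add: field_simps)
qed

text \<open>With the equilibrium fixed, the product form of the inequality is linear in the other
  law, so it survives mixing over the Poisson number of draws.\<close>

lemma likelihood_ratio_urn_law:
  assumes "i \<le> j"
  shows "pmf (urn_law k n k t) i * equilibrium j \<le> pmf (urn_law k n k t) j * equilibrium i"
proof (cases "j \<le> k")
  case False
  thus ?thesis by (simp add: equilibrium_eq_0)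
next
  case True
  define r where "r m = pmf (map_pmf (red_count k) (after_draws n {..<k} m))" for m
  have int: "integrable (measure_pmf (num_points t)) (\<lambda>m. r m y)" for y
    by (intro measure_pmf.integrable_const_bound[where B = 1]) (auto simp: pmf_le_1 r_def)
  have eq: "pmf (urn_law k n k t) y = measure_pmf.expectation (num_points t) (\<lambda>m. r m y)" for y
    by (simp add: urn_law_def start_config_def config_law_def map_bind_pmf pmf_bind r_def)
  have "measure_pmf.expectation (num_points t) (\<lambda>m. r m i * equilibrium j)
      \<le> measure_pmf.expectation (num_points t) (\<lambda>m. r m j * equilibrium i)"
    using likelihood_ratio_after_draws[OF assms True]
    by (intro integral_mono integrable_mult_left int) (auto simp: r_def)
  thus ?thesis by (simp add: eq)
qed

lemma urn_tv_eq_cdf_diff: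
  "\<exists>y::real. urn_tv k n t = measure (measure_pmf (urn_equilibrium k n)) {x. real x \<le> y}
     - measure (measure_pmf (urn_law k n k t)) {x. real x \<le> y}"
  unfolding urn_tv_eq[OF k_le k_pos]
  by (rule tv_dist_monotone_likelihood_ratio) (rule likelihood_ratio_urn_law)

end

section \<open>Solutions of the forward equation\<close>

text \<open>A mean value inequality with an explicit primitive \<open>\<phi>\<close> of the error
  bound in place of an integral. The derivatives are taken within \<open>{0..}\<close> because the
  forward equation is available only from time 0 on.\<close>

lemma norm_diff_le_of_deriv_bound:
  fixes f :: "real \<Rightarrow> 'a :: real_normed_vector"
  assumes "0 \<le> S"
    and f: "\<And>s. s \<in> {0..S} \<Longrightarrow> (f has_vector_derivative f' s) (at s within {0..})"
    and \<phi>: "\<And>s. s \<in> {0..S} \<Longrightarrow> (\<phi> has_vector_derivative \<phi>' s) (at s within {0..})"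
    and le: "\<And>s. s \<in> {0..S} \<Longrightarrow> norm (f' s) \<le> \<phi>' s"
  shows "norm (f S - f 0) \<le> \<phi> S - \<phi> 0"
proof (cases "S = 0")
  case False
  have at: "at s within {0..} = at s" if "0 < s" for s :: real
    using that by (intro at_within_interior) (auto simp: interior_real_atLeast)
  show ?thesis
  proof (rule differentiable_bound_general)
    show "0 < S" using assms(1) False by simp
    show "continuous_on {0..S} f" "continuous_on {0..S} \<phi>"
      by (rule continuous_on_vector_derivative, rule has_vector_derivative_within_subset[OF f], auto)
        (rule continuous_on_vector_derivative, rule has_vector_derivative_within_subset[OF \<phi>], auto)
    show "(f has_vector_derivative f' s) (at s)" "(\<phi> has_vector_derivative \<phi>' s) (at s)"
      "norm (f' s) \<le> \<phi>' s" if "0 < s" "s < S" for s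
      using f[of s] \<phi>[of s] le[of s] at[of s] that by auto
  qed
qed simp

context urn
begin

section \<open>Drift and total rate\<close>

definition dev :: "nat \<Rightarrow> real" where
  "dev y = real y - (real k)\<^sup>2 / real n"

lemma drift: "up y - down y = - 2 * dev y"
  using n_pos by (simp add: up_def down_def dev_def power2_eq_square field_simps)

lemma abs_dev_le:
  assumes "y \<le> k"
  shows "\<bar>dev y\<bar> \<le> real k"
proof -
  have "(real k)\<^sup>2 \<le> real k * real n" using k_le by (simp add: power2_eq_square mult_left_mono)
  hence "(real k)\<^sup>2 / real n \<le> real k" using n_pos by (simp add: divide_le_eq)
  moreover have "0 \<le> (real k)\<^sup>2 / real n" by simp
  ultimately show ?thesis using assms unfolding dev_def by linarith
qed

text \<open>The bound is linear in \<open>dev\<close>, so that its mean along the flow is explicit;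
  this is what closes the second moment equation.\<close>

lemma total_rate_le:
  assumes "y \<le> k"
  shows "up y + down y \<le> 4 * (real k)\<^sup>2 / real n + 2 * dev y"
proof -
  have "real y * real y \<le> (2 * real k) * real y" using assms by (intro mult_right_mono) auto
  hence "2 * (real k - real y)\<^sup>2 + 2 * real y * (real n - 2 * real k + real y) \<le> 2 * ((real k)\<^sup>2 + real n * real y)"
    by (simp add: power2_eq_square algebra_simps del: of_nat_mult)
  hence "up y + down y \<le> 2 * ((real k)\<^sup>2 + real n * real y) / real n"
    unfolding up_def down_def add_divide_distrib[symmetric] by (intro divide_right_mono) auto
  thus ?thesis using n_pos by (simp add: dev_def add_divide_distrib)
qed

text \<open>Up to a factor \<open>1 + o(1)\<close>, the standard deviation of the equilibrium.\<close>

definition sd :: real where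
  "sd = real k * (real n - real k) / (real n * sqrt (real n))"

lemma sd_pos: "sd > 0"
  unfolding sd_def using k_pos k_le by (intro divide_pos_pos mult_pos_pos) auto

text \<open>Where \<open>dev\<close> vanishes, both rates equal \<open>2 * sd\<^sup>2\<close>; noise
  of intensity \<open>4 * sd\<^sup>2\<close> against a restoring drift of rate 2 has stationary
  variance \<open>sd\<^sup>2\<close>. The difference is exactly a quadratic polynomial in
  \<open>dev\<close> without constant term, and its quadratic part is reduced to a linear one by
  |\<open>dev y\<close>| \<le> n / 2.\<close>

lemma total_rate_approx:
  assumes "y \<le> k"
  shows "\<bar>up y + down y - 4 * sd\<^sup>2\<bar> \<le> 4 * \<bar>dev y\<bar>"
proof -
  define N \<kappa> v where "N = real n" and "\<kappa> = real k / real n" and "v = dev y"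
  have N: "N > 0" using n_pos by (simp add: N_def)
  have k: "real k = \<kappa> * N" using N by (simp add: \<kappa>_def N_def)
  have y: "real y = v + \<kappa>\<^sup>2 * N" using N by (simp add: v_def dev_def k N_def[symmetric] power2_eq_square)
  have \<kappa>: "0 \<le> \<kappa>" "\<kappa> \<le> 1 / 2" using k_le n_pos by (auto simp: \<kappa>_def divide_le_eq)
  have sd: "sd\<^sup>2 = \<kappa>\<^sup>2 * (1 - \<kappa>)\<^sup>2 * N"
  proof -
    have "sd = \<kappa> * (1 - \<kappa>) * (N / sqrt N)"
      unfolding sd_def k N_def[symmetric] using N by (simp add: field_simps)
    also have "N / sqrt N = sqrt N" using N by (simp add: real_div_sqrt)
    finally show ?thesis using N by (simp add: power_mult_distrib)
  qed
  have "up y + down y - 4 * sd\<^sup>2 = 2 * (1 - 2 * \<kappa>)\<^sup>2 * v + 4 * v / N * v"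
    unfolding up_def down_def k y sd N_def[symmetric] using N
    by (simp add: field_simps power2_eq_square)
  also have "\<bar>\<dots>\<bar> \<le> \<bar>2 * (1 - 2 * \<kappa>)\<^sup>2 * v\<bar> + \<bar>4 * v / N * v\<bar>" by (rule abs_triangle_ineq)
  also have "\<dots> \<le> 2 * \<bar>v\<bar> + 2 * \<bar>v\<bar>"
  proof (rule add_mono)
    have "(1 - 2 * \<kappa>)\<^sup>2 \<le> 1" using \<kappa> by (simp add: power_le_one_iff)
    hence "(1 - 2 * \<kappa>)\<^sup>2 * \<bar>v\<bar> \<le> 1 * \<bar>v\<bar>" by (intro mult_right_mono) auto
    thus "\<bar>2 * (1 - 2 * \<kappa>)\<^sup>2 * v\<bar> \<le> 2 * \<bar>v\<bar>" by (simp add: abs_mult)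
    have "\<bar>v\<bar> \<le> \<kappa> * N" using abs_dev_le[OF assms] by (simp add: v_def k)
    also have "\<dots> \<le> 1 / 2 * N" using \<kappa> N by (intro mult_right_mono) auto
    finally have "4 * \<bar>v\<bar> / N \<le> 2" using N by (simp add: divide_le_eq)
    hence "4 * \<bar>v\<bar> / N * \<bar>v\<bar> \<le> 2 * \<bar>v\<bar>" by (intro mult_right_mono) auto
    thus "\<bar>4 * v / N * v\<bar> \<le> 2 * \<bar>v\<bar>" using N by (simp add: abs_mult)
  qed
  finally show ?thesis by (simp add: v_def)
qed

end

text \<open>The initial law is left open, so that the estimates hold at once for the law started
  from \<open>k\<close> and for the constant flow at equilibrium.\<close>

locale urn_flow = urn +
  fixes p :: "real \<Rightarrow> nat \<Rightarrow> real"
  assumes p_nonneg: "\<And>s y. 0 \<le> p s y"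
    and p_sum: "\<And>s. 0 \<le> s \<Longrightarrow> (\<Sum>y\<le>k. p s y) = 1"
    and p_deriv: "\<And>s y. 0 \<le> s \<Longrightarrow> y \<le> k \<Longrightarrow> ((\<lambda>s. p s y) has_real_derivative
      real n * (\<Sum>z\<le>k. p s z * urn_generator k n z y)) (at s within {0..})"
begin

section \<open>Means along the flow\<close>

definition mean :: "real \<Rightarrow> (nat \<Rightarrow> 'a :: real_vector) \<Rightarrow> 'a" where
  "mean s f = (\<Sum>y\<le>k. p s y *\<^sub>R f y)"

lemma mean_add: "mean s (\<lambda>y. f y + g y) = mean s f + mean s g"
  by (simp add: mean_def scaleR_add_right sum.distrib)

lemma mean_cmult: "mean s (\<lambda>y. c * f y) = c * mean s f" for c :: real
  by (simp add: mean_def sum_distrib_left mult_ac)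

lemma mean_const: "0 \<le> s \<Longrightarrow> mean s (\<lambda>y. c) = c"
  using p_sum[of s] by (simp add: mean_def scaleR_sum_left[symmetric])

lemma mean_mono:
  fixes f g :: "nat \<Rightarrow> real"
  assumes "\<And>y. y \<le> k \<Longrightarrow> f y \<le> g y"
  shows "mean s f \<le> mean s g"
  unfolding mean_def using assms p_nonneg by (auto intro!: sum_mono mult_left_mono)

lemma mean_cong: "(\<And>y. y \<le> k \<Longrightarrow> f y = g y) \<Longrightarrow> mean s f = mean s g"
  by (simp add: mean_def)

lemma norm_mean_le:
  fixes f :: "nat \<Rightarrow> 'a :: real_normed_vector"
  assumes "\<And>y. y \<le> k \<Longrightarrow> norm (f y) \<le> g y"
  shows "norm (mean s f) \<le> mean s g"
proof -
  have "norm (mean s f) \<le> (\<Sum>y\<le>k. norm (p s y *\<^sub>R f y))" unfolding mean_def by (rule norm_sum)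
  also have "\<dots> \<le> mean s g" unfolding mean_def
    using assms p_nonneg by (auto intro!: sum_mono mult_left_mono)
  finally show ?thesis .
qed

text \<open>Dynkin's formula in differentiated form: exchanging the two sums moves the generator
  from the law to the test function.\<close>

lemma mean_has_vector_derivative:
  fixes f :: "real \<Rightarrow> nat \<Rightarrow> 'a :: real_normed_vector"
  assumes s: "0 \<le> s"
    and f: "\<And>y. y \<le> k \<Longrightarrow> ((\<lambda>s. f s y) has_vector_derivative f' y) (at s within {0..})"
  shows "((\<lambda>s. mean s (f s)) has_vector_derivative
    mean s (\<lambda>y. f' y + (up y *\<^sub>R (f s (y + 1) - f s y) + down y *\<^sub>R (f s (y - 1) - f s y))))
    (at s within {0..})"
proof -
  let ?p' = "\<lambda>y. real n * (\<Sum>z\<le>k. p s z * urn_generator k n z y)"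
  have "((\<lambda>s. mean s (f s)) has_vector_derivative (\<Sum>y\<le>k. p s y *\<^sub>R f' y + ?p' y *\<^sub>R f s y)) (at s within {0..})"
    unfolding mean_def
    by (intro has_vector_derivative_sum has_vector_derivative_scaleR p_deriv f s) auto
  moreover have "(\<Sum>y\<le>k. ?p' y *\<^sub>R f s y) =
      (\<Sum>y\<le>k. \<Sum>z\<le>k. p s z *\<^sub>R ((real n * urn_generator k n z y) *\<^sub>R f s y))"
    by (intro sum.cong refl) (simp add: scaleR_sum_left sum_distrib_left mult_ac)
  moreover have "\<dots> = (\<Sum>z\<le>k. p s z *\<^sub>R (\<Sum>y\<le>k. (real n * urn_generator k n z y) *\<^sub>R f s y))"
    by (subst sum.swap) (simp add: scaleR_sum_right)
  moreover have "\<dots> = (\<Sum>z\<le>k. p s z *\<^sub>R (up z *\<^sub>R (f s (z + 1) - f s z) + down z *\<^sub>R (f s (z - 1) - f s z)))"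
    by (intro sum.cong refl) (simp only: sum_generator atMost_iff)
  ultimately show ?thesis by (simp add: mean_def sum.distrib scaleR_add_right)
qed

text \<open>As the drift is linear, the time derivative of \<open>exp (2 * s) * dev y\<close>
  cancels the action of the generator on it.\<close>

lemma mean_dev:
  assumes "0 \<le> s"
  shows "mean s dev = exp (- 2 * s) * mean 0 dev"
proof -
  have *: "((\<lambda>s. mean s (\<lambda>y. exp (2 * s) * dev y)) has_vector_derivative 0) (at s within {0..})" if "0 \<le> s" for s
  proof -
    have "((\<lambda>s. mean s (\<lambda>y. exp (2 * s) * dev y)) has_vector_derivative
      mean s (\<lambda>y. 2 * exp (2 * s) * dev y + (up y *\<^sub>R (exp (2 * s) * dev (y + 1) - exp (2 * s) * dev y) +
        down y *\<^sub>R (exp (2 * s) * dev (y - 1) - exp (2 * s) * dev y)))) (at s within {0..})"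
      using that by (intro mean_has_vector_derivative) (auto intro!: derivative_eq_intros
        simp: has_real_derivative_iff_has_vector_derivative[symmetric])
    also have "mean s (\<lambda>y. 2 * exp (2 * s) * dev y + (up y *\<^sub>R (exp (2 * s) * dev (y + 1) - exp (2 * s) * dev y) +
        down y *\<^sub>R (exp (2 * s) * dev (y - 1) - exp (2 * s) * dev y))) = mean s (\<lambda>y. 0)"
    proof (rule mean_cong)
      fix y
      \<comment> \<open>At \<open>y = 0\<close> the truncated difference is wrong, but its weight
        \<open>down 0\<close> is zero.\<close>
      have d: "down y * (dev (y - 1) - dev y) = - down y" by (cases y) (simp_all add: down_def dev_def)
      have u: "up y * (dev (y + 1) - dev y) = up y" by (simp add: dev_def)
      have "2 * dev y + (up y * (dev (y + 1) - dev y) + down y * (dev (y - 1) - dev y)) = 0"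
        unfolding u d using drift[of y] by simp
      hence "exp (2 * s) * (2 * dev y + (up y * (dev (y + 1) - dev y) + down y * (dev (y - 1) - dev y))) = 0"
        by simp
      thus "2 * exp (2 * s) * dev y + (up y *\<^sub>R (exp (2 * s) * dev (y + 1) - exp (2 * s) * dev y) +
        down y *\<^sub>R (exp (2 * s) * dev (y - 1) - exp (2 * s) * dev y)) = 0"
        by (simp add: algebra_simps)
    qed
    finally show ?thesis by (simp add: mean_def)
  qed
  have "norm (mean s (\<lambda>y. exp (2 * s) * dev y) - mean 0 (\<lambda>y. exp (2 * 0) * dev y)) \<le> 0 - 0"
    by (rule norm_diff_le_of_deriv_bound[where f' = "\<lambda>_. 0" and \<phi>' = "\<lambda>_. 0"]) (use * assms in auto)
  hence "exp (2 * s) * mean s dev = mean 0 dev" by (simp add: mean_cmult)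
  thus ?thesis by (simp add: exp_minus field_simps)
qed

text \<open>For \<open>exp (4 * s) * (dev y)\<^sup>2\<close> the drift cancels and only the total
  jump rate is left, whose mean is controlled by \<open>total_rate_le\<close> and
  \<open>mean_dev\<close>. The three summands are the forgotten initial deviation, the stationary
  variance and the extra noise while the mean still relaxes.\<close>

lemma mean_dev_sq_le:
  assumes s: "0 \<le> s" and m0: "0 \<le> mean 0 dev" "mean 0 dev \<le> real k"
  shows "mean s (\<lambda>y. (dev y)\<^sup>2) \<le> (real k)\<^sup>2 * exp (- 4 * s) + (real k)\<^sup>2 / real n + real k * exp (- 2 * s)"
proof -
  define \<phi> where "\<phi> s = exp (4 * s) * ((real k)\<^sup>2 / real n) + exp (2 * s) * mean 0 dev" for s
  define G where "G s = mean s (\<lambda>y. exp (4 * s) * (dev y)\<^sup>2)" for s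
  define G' where "G' s = mean s (\<lambda>y. exp (4 * s) * (up y + down y))" for s
  have G': "(G has_vector_derivative G' s) (at s within {0..})" if s: "0 \<le> s" for s
  proof -
    have "(G has_vector_derivative
      mean s (\<lambda>y. 4 * exp (4 * s) * (dev y)\<^sup>2 + (up y *\<^sub>R (exp (4 * s) * (dev (y + 1))\<^sup>2 - exp (4 * s) * (dev y)\<^sup>2) +
        down y *\<^sub>R (exp (4 * s) * (dev (y - 1))\<^sup>2 - exp (4 * s) * (dev y)\<^sup>2)))) (at s within {0..})"
      unfolding G_def using s by (intro mean_has_vector_derivative) (auto intro!: derivative_eq_intros
        simp: has_real_derivative_iff_has_vector_derivative[symmetric])
    also have "mean s (\<lambda>y. 4 * exp (4 * s) * (dev y)\<^sup>2 + (up y *\<^sub>R (exp (4 * s) * (dev (y + 1))\<^sup>2 - exp (4 * s) * (dev y)\<^sup>2) +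
        down y *\<^sub>R (exp (4 * s) * (dev (y - 1))\<^sup>2 - exp (4 * s) * (dev y)\<^sup>2))) = G' s"
      unfolding G'_def
    proof (rule mean_cong)
      fix y
      have u: "up y * ((dev (y + 1))\<^sup>2 - (dev y)\<^sup>2) = up y * (2 * dev y + 1)"
      proof -
        have "dev (y + 1) = dev y + 1" by (simp add: dev_def)
        thus ?thesis by (simp add: power2_eq_square algebra_simps)
      qed
      have d: "down y * ((dev (y - 1))\<^sup>2 - (dev y)\<^sup>2) = down y * (1 - 2 * dev y)"
      proof (cases y)
        case (Suc z)
        hence eq: "dev (y - 1) = dev y - 1" by (simp add: dev_def)
        show ?thesis unfolding eq by (simp add: power2_eq_square algebra_simps)
      qed (simp add: down_def)
      have "2 * dev y * (up y - down y) = 2 * dev y * (- 2 * dev y)" by (simp only: drift)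
      hence "4 * (dev y)\<^sup>2 + (up y * ((dev (y + 1))\<^sup>2 - (dev y)\<^sup>2) + down y * ((dev (y - 1))\<^sup>2 - (dev y)\<^sup>2)) = up y + down y"
        unfolding u d by (simp add: power2_eq_square algebra_simps)
      hence "exp (4 * s) * (4 * (dev y)\<^sup>2 + (up y * ((dev (y + 1))\<^sup>2 - (dev y)\<^sup>2) + down y * ((dev (y - 1))\<^sup>2 - (dev y)\<^sup>2)))
          = exp (4 * s) * (up y + down y)" by (simp only:)
      thus "4 * exp (4 * s) * (dev y)\<^sup>2 + (up y *\<^sub>R (exp (4 * s) * (dev (y + 1))\<^sup>2 - exp (4 * s) * (dev y)\<^sup>2) +
        down y *\<^sub>R (exp (4 * s) * (dev (y - 1))\<^sup>2 - exp (4 * s) * (dev y)\<^sup>2)) = exp (4 * s) * (up y + down y)"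
        by (simp add: algebra_simps)
    qed
    finally show ?thesis .
  qed
  have bound: "norm (G' s) \<le> 4 * exp (4 * s) * ((real k)\<^sup>2 / real n) + 2 * exp (2 * s) * mean 0 dev" if s: "0 \<le> s" for s
  proof -
    have "norm (G' s) \<le> mean s (\<lambda>y. exp (4 * s) * (4 * (real k)\<^sup>2 / real n + 2 * dev y))"
      unfolding G'_def using total_rate_le up_nonneg down_nonneg
      by (intro norm_mean_le) (simp add: add_nonneg_nonneg)
    also have "\<dots> = exp (4 * s) * (4 * (real k)\<^sup>2 / real n + 2 * (exp (- 2 * s) * mean 0 dev))"
      by (simp only: mean_cmult mean_add mean_const[OF s] mean_dev[OF s])
    also have "\<dots> = 4 * exp (4 * s) * ((real k)\<^sup>2 / real n) + 2 * (exp (4 * s) * exp (- 2 * s)) * mean 0 dev"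
      by (simp add: algebra_simps)
    also have "exp (4 * s) * exp (- 2 * s) = exp (2 * s)" by (simp add: exp_add[symmetric])
    finally show ?thesis .
  qed
  have "norm (G s - G 0) \<le> \<phi> s - \<phi> 0"
  proof (rule norm_diff_le_of_deriv_bound[where f' = G' and \<phi>' = "\<lambda>s. 4 * exp (4 * s) * ((real k)\<^sup>2 / real n) + 2 * exp (2 * s) * mean 0 dev"])
    show "(\<phi> has_vector_derivative 4 * exp (4 * t) * ((real k)\<^sup>2 / real n) + 2 * exp (2 * t) * mean 0 dev) (at t within {0..})" for t
      unfolding \<phi>_def has_real_derivative_iff_has_vector_derivative[symmetric]
      using n_pos by (auto intro!: derivative_eq_intros)
  qed (use s G' bound in auto)
  moreover have "G 0 \<le> (real k)\<^sup>2"
  proof -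
    have "G 0 \<le> mean 0 (\<lambda>y. (real k)\<^sup>2)" unfolding G_def
      using abs_dev_le by (intro mean_mono) (simp add: abs_le_square_iff[symmetric])
    thus ?thesis by (simp add: mean_const)
  qed
  moreover have "exp (2 * s) * mean 0 dev \<le> exp (2 * s) * real k" using m0 by simp
  moreover have "\<phi> 0 \<ge> 0" using m0 by (simp add: \<phi>_def)
  ultimately have "G s \<le> (real k)\<^sup>2 + exp (4 * s) * ((real k)\<^sup>2 / real n) + exp (2 * s) * real k"
    unfolding \<phi>_def[of s] real_norm_def by linarith
  hence "exp (4 * s) * mean s (\<lambda>y. (dev y)\<^sup>2) \<le> (real k)\<^sup>2 + exp (4 * s) * ((real k)\<^sup>2 / real n) + exp (2 * s) * real k"
    by (simp only: G_def mean_cmult)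
  hence "exp (- 4 * s) * (exp (4 * s) * mean s (\<lambda>y. (dev y)\<^sup>2))
      \<le> exp (- 4 * s) * ((real k)\<^sup>2 + exp (4 * s) * ((real k)\<^sup>2 / real n) + exp (2 * s) * real k)"
    by (intro mult_left_mono) auto
  moreover have "exp (- 4 * s) * (exp (4 * s) * mean s (\<lambda>y. (dev y)\<^sup>2)) = mean s (\<lambda>y. (dev y)\<^sup>2)"
    by (simp add: mult.assoc[symmetric] exp_add[symmetric])
  moreover have "exp (- 4 * s) * (A + exp (4 * s) * B + exp (2 * s) * C) = A * exp (- 4 * s) + B + C * exp (- 2 * s)" for A B C
  proof -
    have "exp (- 4 * s) * exp (4 * s) = 1" "exp (- 4 * s) * exp (2 * s) = exp (- 2 * s)"
      by (simp_all add: exp_add[symmetric])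
    thus ?thesis by algebra
  qed
  ultimately show ?thesis by (simp only:)
qed

text \<open>The square of the mean is at most the mean of the square, because a variance is
  nonnegative; the sum of three squares is then bounded by the square of the sum.\<close>

lemma mean_abs_dev_le:
  assumes s: "0 \<le> s" and m0: "0 \<le> mean 0 dev" "mean 0 dev \<le> real k"
  shows "mean s (\<lambda>y. \<bar>dev y\<bar>) \<le> real k * exp (- 2 * s) + real k / sqrt (real n) + sqrt (real k) * exp (- s)"
proof -
  define m where "m = mean s (\<lambda>y. \<bar>dev y\<bar>)"
  have "0 \<le> mean s (\<lambda>y. (\<bar>dev y\<bar> - m)\<^sup>2)"
    using mean_mono[of "\<lambda>_. 0" "\<lambda>y. (\<bar>dev y\<bar> - m)\<^sup>2" s] mean_const[OF s, of "0 :: real"] by simp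
  also have "(\<lambda>y. (\<bar>dev y\<bar> - m)\<^sup>2) = (\<lambda>y. ((dev y)\<^sup>2 + m\<^sup>2) + (- 2 * m) * \<bar>dev y\<bar>)"
    by (simp add: power2_diff fun_eq_iff)
  also have "mean s \<dots> = mean s (\<lambda>y. (dev y)\<^sup>2) - m\<^sup>2"
    unfolding mean_add mean_cmult mean_const[OF s] m_def[symmetric] by (simp add: power2_eq_square)
  finally have "m\<^sup>2 \<le> (real k)\<^sup>2 * exp (- 4 * s) + (real k)\<^sup>2 / real n + real k * exp (- 2 * s)"
    using mean_dev_sq_le[OF assms] by simp
  also have "\<dots> = (real k * exp (- 2 * s))\<^sup>2 + (real k / sqrt (real n))\<^sup>2 + (sqrt (real k) * exp (- s))\<^sup>2"
    by (simp add: power_mult_distrib power_divide exp_double[symmetric])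
  also have "\<dots> \<le> (real k * exp (- 2 * s) + real k / sqrt (real n) + sqrt (real k) * exp (- s))\<^sup>2"
  proof -
    have "a\<^sup>2 + b\<^sup>2 + c\<^sup>2 \<le> (a + b + c)\<^sup>2" if "0 \<le> a" "0 \<le> b" "0 \<le> c" for a b c :: real
      using mult_nonneg_nonneg[OF that(1,2)] mult_nonneg_nonneg[OF that(1,3)] mult_nonneg_nonneg[OF that(2,3)]
      by (simp add: power2_eq_square algebra_simps)
    thus ?thesis by simp
  qed
  finally show ?thesis unfolding m_def by (rule power2_le_imp_le) simp
qed

end

section \<open>Poisson and Gaussian approximation of the flow\<close>

text \<open>A convex combination of 1 and \<open>z\<close>. It keeps the moving argument of the
  generating function in the unit disc at all times.\<close>

lemma norm_convex_comb_le_1: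
  fixes z :: complex
  assumes "0 \<le> r" "r \<le> 1" "norm z \<le> 1"
  shows "norm (1 + of_real r * (z - 1)) \<le> 1"
proof -
  have "1 + of_real r * (z - 1) = of_real (1 - r) + of_real r * z" by (simp add: algebra_simps)
  hence "norm (1 + of_real r * (z - 1)) \<le> norm (of_real (1 - r) :: complex) + norm (of_real r * z)"
    by (simp only: norm_triangle_ineq)
  also have "\<dots> \<le> (1 - r) + r * 1" unfolding norm_mult norm_of_real
    using assms by (intro add_mono mult_mono) auto
  finally show ?thesis by simp
qed

text \<open>The expression is the drift of the moving character divided by the character, with
  \<open>\<eta>\<close> the phase gained per jump. Expanding the exponentials to second order, the
  linear terms cancel by the drift identity, the quadratic ones leave the defect of the total rate,
  and the cubic remainder costs (u + d) / 6 \<le> \<sigma>^2 + |v|.\<close>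

lemma gaussian_drift_le:
  fixes \<eta> u d v \<sigma> :: real
  assumes ud: "u - d = - 2 * v" "0 \<le> u" "0 \<le> d" "\<bar>u + d - 4 * \<sigma>\<^sup>2\<bar> \<le> 4 * \<bar>v\<bar>"
  shows "norm (of_real (2 * \<sigma>\<^sup>2 * \<eta>\<^sup>2) + 2 * \<i> * of_real (\<eta> * v)
      + of_real u * (exp (\<i> * of_real \<eta>) - 1) + of_real d * (exp (- (\<i> * of_real \<eta>)) - 1))
    \<le> 2 * \<eta>\<^sup>2 * \<bar>v\<bar> + \<bar>\<eta>\<bar> ^ 3 * (\<sigma>\<^sup>2 + \<bar>v\<bar>)"
proof -
  define R where "R x = exp (\<i> * complex_of_real x) - 1 - \<i> * of_real x + of_real (x\<^sup>2 / 2)" for x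
  have R: "norm (R x) \<le> \<bar>x\<bar> ^ 3 / 6" for x
  proof -
    have "(\<Sum>j\<le>2. (\<i> * complex_of_real x) ^ j / fact j) = 1 + \<i> * of_real x - of_real (x\<^sup>2 / 2)"
      by (simp add: numeral_2_eq_2 power_mult_distrib)
    hence "R x = exp (\<i> * complex_of_real x) - (\<Sum>j\<le>2. (\<i> * complex_of_real x) ^ j / fact j)"
      by (simp add: R_def)
    thus ?thesis using iexp_approx1[of x 2] by (simp add: fact_numeral numeral_3_eq_3)
  qed
  have "complex_of_real (u - d) = of_real (- 2 * v)" using ud(1) by (rule arg_cong)
  hence ud': "complex_of_real u - of_real d = - 2 * of_real v" by simp
  have "of_real (2 * \<sigma>\<^sup>2 * \<eta>\<^sup>2) + 2 * \<i> * of_real (\<eta> * v)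
      + of_real u * (exp (\<i> * of_real \<eta>) - 1) + of_real d * (exp (- (\<i> * of_real \<eta>)) - 1) =
      of_real (- (\<eta>\<^sup>2 / 2) * (u + d - 4 * \<sigma>\<^sup>2)) + (of_real u * R \<eta> + of_real d * R (- \<eta>))
      + (\<i> * of_real \<eta>) * (of_real u - of_real d + 2 * of_real v)"
    by (simp add: R_def algebra_simps)
  also have "\<dots> = of_real (- (\<eta>\<^sup>2 / 2) * (u + d - 4 * \<sigma>\<^sup>2)) + (of_real u * R \<eta> + of_real d * R (- \<eta>))"
    unfolding ud' by simp
  also have "norm \<dots> \<le> norm (complex_of_real (- (\<eta>\<^sup>2 / 2) * (u + d - 4 * \<sigma>\<^sup>2))) + (norm (of_real u * R \<eta>) + norm (of_real d * R (- \<eta>)))"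
    by (meson add_left_mono norm_triangle_ineq order_trans)
  also have "\<dots> \<le> 2 * \<eta>\<^sup>2 * \<bar>v\<bar> + (u * (\<bar>\<eta>\<bar> ^ 3 / 6) + d * (\<bar>\<eta>\<bar> ^ 3 / 6))"
  proof (intro add_mono)
    have "\<eta>\<^sup>2 / 2 * \<bar>u + d - 4 * \<sigma>\<^sup>2\<bar> \<le> \<eta>\<^sup>2 / 2 * (4 * \<bar>v\<bar>)" using ud by (intro mult_left_mono) auto
    thus "norm (complex_of_real (- (\<eta>\<^sup>2 / 2) * (u + d - 4 * \<sigma>\<^sup>2))) \<le> 2 * \<eta>\<^sup>2 * \<bar>v\<bar>"
      by (simp only: norm_of_real abs_mult abs_minus_cancel) (simp add: mult_ac)
    have "norm (of_real a * R x) \<le> a * (\<bar>x\<bar> ^ 3 / 6)" if "0 \<le> a" for a x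
      unfolding norm_mult norm_of_real abs_of_nonneg[OF that] by (intro mult_left_mono R that)
    from this[of u \<eta>] this[of d "- \<eta>"] ud
    show "norm (of_real u * R \<eta>) \<le> u * (\<bar>\<eta>\<bar> ^ 3 / 6)" "norm (of_real d * R (- \<eta>)) \<le> d * (\<bar>\<eta>\<bar> ^ 3 / 6)"
      by simp_all
  qed
  also have "\<dots> = 2 * \<eta>\<^sup>2 * \<bar>v\<bar> + \<bar>\<eta>\<bar> ^ 3 * ((u + d) / 6)" by (simp add: algebra_simps)
  also have "\<dots> \<le> 2 * \<eta>\<^sup>2 * \<bar>v\<bar> + \<bar>\<eta>\<bar> ^ 3 * (\<sigma>\<^sup>2 + \<bar>v\<bar>)"
  proof (intro add_left_mono mult_left_mono)
    have aux: "a / 6 \<le> b + c" if "a - 4 * b \<le> 4 * c" "0 \<le> b" "0 \<le> c" for a b c :: real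
      using that by simp
    show "(u + d) / 6 \<le> \<sigma>\<^sup>2 + \<bar>v\<bar>"
      by (rule aux[OF abs_le_D1[OF ud(4)]]) simp_all
  qed simp
  finally show ?thesis .
qed

context urn_flow
begin

lemma mean_real_le:
  assumes s: "0 \<le> s" and m0: "mean 0 dev \<le> real k"
  shows "mean s real \<le> (real k)\<^sup>2 / real n + real k * exp (- 2 * s)"
proof -
  have "mean s real = mean s (\<lambda>y. dev y + (real k)\<^sup>2 / real n)"
    by (rule mean_cong) (simp add: dev_def)
  also have "\<dots> = exp (- 2 * s) * mean 0 dev + (real k)\<^sup>2 / real n"
    by (simp only: mean_add mean_const[OF s] mean_dev[OF s])
  also have "exp (- 2 * s) * mean 0 dev \<le> exp (- 2 * s) * real k" using m0 by simp
  finally show ?thesis by (simp add: mult.commute)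
qed

text \<open>For arrivals at rate 2 L and departures at rate 2 y the left-hand side would vanish:
  this is the M/M/infinity queue, with Poisson equilibrium of mean L. Both urn rates fall short of
  these by the same amount (2 / n) y (2 k - y), so the error is a second difference of (1 + W)^y,
  which explains the factor W^2.\<close>

lemma pgf_drift:
  fixes W :: complex and y :: nat
  defines "L \<equiv> complex_of_real ((real k)\<^sup>2 / real n)"
  shows "- (2 * L * W) * (1 + W) ^ y + of_nat y * (1 + W) ^ (y - 1) * (2 * W) +
      (up y *\<^sub>R ((1 + W) ^ (y + 1) - (1 + W) ^ y) + down y *\<^sub>R ((1 + W) ^ (y - 1) - (1 + W) ^ y)) =
    - (of_real (2 / real n * (real y * (2 * real k - real y))) * W\<^sup>2 * (1 + W) ^ (y - 1))"
proof -
  define u d where "u = complex_of_real (up y)" and "d = complex_of_real (down y)"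
  have "up y - 2 * ((real k)\<^sup>2 / real n) = - (2 / real n * (real y * (2 * real k - real y)))"
    using n_pos by (simp add: up_def field_simps power2_eq_square)
  from arg_cong[OF this, of complex_of_real]
  have e1: "u - 2 * L = - of_real (2 / real n * (real y * (2 * real k - real y)))"
    by (simp add: u_def L_def)
  have "up y - down y = - 2 * (real y - (real k)\<^sup>2 / real n)" using drift[of y] by (simp add: dev_def)
  from arg_cong[OF this, of complex_of_real]
  have e2: "u - d = - 2 * (of_nat y - L)" by (simp add: u_def d_def L_def)
  show ?thesis
  proof (cases y)
    case 0
    hence "complex_of_real (up 0) = 2 * L" using e1 by (simp add: u_def)
    thus ?thesis using 0 by (simp add: scaleR_conv_of_real down_def algebra_simps)
  next
    case (Suc x)
    have "- (2 * L * W) * ((1 + W) * q) + of_nat y * q * (2 * W) +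
        (u * ((1 + W) * ((1 + W) * q) - (1 + W) * q) + d * (q - (1 + W) * q)) = (u - 2 * L) * W\<^sup>2 * q" for q
      using e2 by algebra
    from this[of "(1 + W) ^ x"] show ?thesis unfolding e1
      using Suc by (simp add: u_def d_def scaleR_conv_of_real)
  qed
qed

text \<open>Integrates the error of \<open>pgf_drift\<close> along the flow. In the factor W^2 the
  decay is fast enough for the integral to stay bounded in S, and k / n supplies the
  smallness.\<close>

lemma pgf_estimate:
  fixes z :: complex and S :: real
  defines "L \<equiv> (real k)\<^sup>2 / real n" and "w0 \<equiv> of_real (exp (- 2 * S)) * (z - 1)"
  assumes S: "0 \<le> S" and m0: "0 \<le> mean 0 dev" "mean 0 dev \<le> real k" and z: "norm z \<le> 1"
  shows "norm (exp (- of_real L * (z - 1)) * mean S (\<lambda>y. z ^ y)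
      - exp (- of_real L * w0) * mean 0 (\<lambda>y. (1 + w0) ^ y))
    \<le> exp (2 * L) * (16 * real k / real n) * (L + real k * exp (- 2 * S))"
proof -
  have L0: "0 \<le> L" by (simp add: L_def)
  \<comment> \<open>Defined for complex times, so that the complex differentiation rules apply
    before restricting to the real axis. It solves W' = 2 W, with values \<open>w0\<close> at time 0
    and \<open>z - 1\<close> at time \<open>S\<close>.\<close>
  define W where "W c = exp (- 2 * (of_real S - c)) * (z - 1)" for c :: complex
  define f where "f s y = exp (- of_real L * W (of_real s)) * (1 + W (of_real s)) ^ y" for s :: real and y :: nat
  define f' where "f' s y = exp (- of_real L * W (of_real s)) * (- (2 * of_real L * W (of_real s)) * (1 + W (of_real s)) ^ y
      + of_nat y * (1 + W (of_real s)) ^ (y - 1) * (2 * W (of_real s)))" for s :: real and y :: nat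
  define G' where "G' s = mean s (\<lambda>y. f' s y + (up y *\<^sub>R (f s (y + 1) - f s y) + down y *\<^sub>R (f s (y - 1) - f s y)))" for s
  \<comment> \<open>The factor 16 is 4 from (2 / n) y (2 k) times 4 from |w|^2 \<le> (2 r)^2;
    \<open>exp (2 * L)\<close> bounds the prefactor, as |w| \<le> 2.\<close>
  define C where "C = exp (2 * L) * (16 * real k / real n)"
  have W': "(W has_field_derivative 2 * W c) (at c)" for c
    unfolding W_def by (auto intro!: derivative_eq_intros)
  have f': "((\<lambda>s. f s y) has_vector_derivative f' s y) (at s within {0..})" for s y
    unfolding f_def f'_def
    by (rule has_vector_derivative_real_field[of "\<lambda>c. exp (- of_real L * W c) * (1 + W c) ^ y"])
      (auto intro!: derivative_eq_intros W' simp: algebra_simps)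
  have G': "((\<lambda>s. mean s (f s)) has_vector_derivative G' s) (at s within {0..})" if "0 \<le> s" for s
    unfolding G'_def by (rule mean_has_vector_derivative[OF that f'])
  have bound: "norm (G' s) \<le> C * (exp (- 4 * (S - s)) * L + real k * exp (- 4 * S + 2 * s))" if s: "s \<in> {0..S}" for s
  proof -
    define w where "w = W (of_real s)"
    define r where "r = exp (- 2 * (S - s))"
    have r: "0 \<le> r" "r \<le> 1" using s by (simp_all add: r_def)
    have w: "w = of_real r * (z - 1)" by (simp add: w_def W_def r_def exp_of_real[symmetric])
    have "norm w \<le> r * 2" unfolding w norm_mult
      using r z norm_triangle_ineq4[of z 1] by (intro mult_mono) auto
    hence w_le: "norm w \<le> 2 * r" by simp
    have w1: "norm (1 + w) \<le> 1" unfolding w by (rule norm_convex_comb_le_1[OF r z])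
    have "L * norm w \<le> L * 2" using w_le r by (intro mult_left_mono) (auto simp: L_def)
    have "norm (exp (- of_real L * w)) \<le> exp (norm (- of_real L * w))" by (rule norm_exp)
    also have "norm (- of_real L * w) = L * norm w"
      by (simp only: norm_mult norm_minus_cancel norm_of_real abs_of_nonneg[OF L0])
    also have "exp (L * norm w) \<le> exp (2 * L)" using \<open>L * norm w \<le> L * 2\<close> by simp
    finally have exp_le: "norm (exp (- of_real L * w)) \<le> exp (2 * L)" .
    have eq: "f' s y + (up y *\<^sub>R (f s (y + 1) - f s y) + down y *\<^sub>R (f s (y - 1) - f s y)) =
      exp (- of_real L * w) * - (of_real (2 / real n * (real y * (2 * real k - real y))) * w\<^sup>2 * (1 + w) ^ (y - 1))" for y
      unfolding pgf_drift[of w y, symmetric] f_def f'_def w_def[symmetric] L_def[symmetric]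
      by (simp add: scaleR_conv_of_real algebra_simps)
    have "norm (G' s) \<le> mean s (\<lambda>y. (C * r\<^sup>2) * real y)"
      unfolding G'_def
    proof (rule norm_mean_le)
      fix y assume y: "y \<le> k"
      have "2 / real n * (real y * (2 * real k - real y)) \<le> 2 / real n * (real y * (2 * real k))"
        by (intro mult_left_mono) auto
      moreover have "0 \<le> 2 / real n * (real y * (2 * real k - real y))"
        using y by (intro mult_nonneg_nonneg) auto
      ultimately have abs_le: "\<bar>2 / real n * (real y * (2 * real k - real y))\<bar> \<le> 2 / real n * (real y * (2 * real k))"
        by (simp only: abs_of_nonneg)
      have "norm (exp (- of_real L * w)) * (\<bar>2 / real n * (real y * (2 * real k - real y))\<bar> * norm w ^ 2 * norm (1 + w) ^ (y - 1))
          \<le> exp (2 * L) * ((2 / real n * (real y * (2 * real k))) * (2 * r) ^ 2 * 1)"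
        by (intro mult_mono exp_le abs_le power_mono w_le power_le_one w1) (use r in simp_all)
      also have "\<dots> = (C * r\<^sup>2) * real y" by (simp add: C_def power_mult_distrib mult_ac)
      finally show "norm (f' s y + (up y *\<^sub>R (f s (y + 1) - f s y) + down y *\<^sub>R (f s (y - 1) - f s y))) \<le> (C * r\<^sup>2) * real y"
        unfolding eq norm_mult norm_minus_cancel norm_power norm_of_real by (simp only: mult.assoc)
    qed
    also have "\<dots> = C * r\<^sup>2 * mean s real" by (simp only: mean_cmult)
    also have "\<dots> \<le> C * r\<^sup>2 * (L + real k * exp (- 2 * s))"
      using s mean_real_le[OF _ m0(2)] by (intro mult_left_mono) (auto simp: C_def L_def)
    also have "\<dots> = C * (r\<^sup>2 * L + real k * (r\<^sup>2 * exp (- 2 * s)))" by (simp add: algebra_simps)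
    also have "r\<^sup>2 = exp (- 4 * (S - s))" by (simp add: r_def exp_double[symmetric])
    also have "exp (- 4 * (S - s)) * exp (- 2 * s) = exp (- 4 * S + 2 * s)" by (simp add: exp_add[symmetric] algebra_simps)
    finally show ?thesis .
  qed
  define \<phi> where "\<phi> s = C * (exp (- 4 * (S - s)) * L / 4 + real k * exp (- 4 * S + 2 * s) / 2)" for s
  have "norm (mean S (f S) - mean 0 (f 0)) \<le> \<phi> S - \<phi> 0"
  proof (rule norm_diff_le_of_deriv_bound[where f' = G' and \<phi>' = "\<lambda>s. C * (exp (- 4 * (S - s)) * L + real k * exp (- 4 * S + 2 * s))"])
    show "(\<phi> has_vector_derivative C * (exp (- 4 * (S - s)) * L + real k * exp (- 4 * S + 2 * s))) (at s within {0..})" for s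
      unfolding \<phi>_def has_real_derivative_iff_has_vector_derivative[symmetric]
      by (rule derivative_eq_intros refl | simp)+
  qed (use S G' bound in auto)
  also have "\<phi> S - \<phi> 0 \<le> \<phi> S" by (simp add: \<phi>_def C_def L_def)
  also have "\<dots> \<le> C * (L + real k * exp (- 2 * S))"
    unfolding \<phi>_def using L0 by (intro mult_left_mono add_mono) (auto simp: C_def)
  also have "mean S (f S) = exp (- of_real L * (z - 1)) * mean S (\<lambda>y. z ^ y)"
    by (simp add: mean_def f_def W_def sum_distrib_left scaleR_conv_of_real mult_ac)
  also have "mean 0 (f 0) = exp (- of_real L * w0) * mean 0 (\<lambda>y. (1 + w0) ^ y)"
  proof -
    have "W 0 = w0" by (simp add: W_def w0_def exp_of_real[symmetric])
    thus ?thesis by (simp add: mean_def f_def sum_distrib_left scaleR_conv_of_real mult_ac)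
  qed
  finally show ?thesis by (simp add: C_def)
qed

text \<open>The test functions solve the backward equation of the Ornstein--Uhlenbeck process with
  drift -2 \<open>dev\<close> and noise intensity \<open>4 * sd\<^sup>2\<close> exactly;
  \<open>gaussian_drift_le\<close> measures how far the urn is from it. The error is small once
  \<open>sd\<close> is large and the mean of |\<open>dev\<close>| is of order
  \<open>sd\<close>.\<close>

lemma char_estimate:
  fixes \<xi> S :: real
  defines "\<xi>0 \<equiv> \<xi> * exp (- 2 * S)"
  assumes S: "0 \<le> S" and m0: "0 \<le> mean 0 dev" "mean 0 dev \<le> real k" and sd: "sd \<ge> 1"
  shows "norm (exp (of_real (\<xi>\<^sup>2 / 2)) * mean S (\<lambda>y. exp (\<i> * of_real (\<xi> * (dev y / sd))))
      - exp (of_real (\<xi>0\<^sup>2 / 2)) * mean 0 (\<lambda>y. exp (\<i> * of_real (\<xi>0 * (dev y / sd)))))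
    \<le> exp (\<xi>\<^sup>2 / 2) * (2 * \<xi>\<^sup>2 + \<bar>\<xi>\<bar> ^ 3) *
      (1 / sd + (real k * exp (- 2 * S) + real k / sqrt (real n) + sqrt (real k) * exp (- S)) / sd\<^sup>2)"
proof -
  define a where "a = \<xi> / sd"
  define \<eta> where "\<eta> s = a * exp (- 2 * (S - s))" for s
  \<comment> \<open>At a real time s this is \<xi>_s^2 / 2 + i \<xi>_s \<open>dev y / sd\<close>
    with \<xi>_s = \<xi> exp (- 2 (S - s)); the first summand compensates for the noise.\<close>
  define Q where "Q c y = of_real (\<xi>\<^sup>2 / 2) * exp (- 4 * (of_real S - c))
      + \<i> * of_real (a * dev y) * exp (- 2 * (of_real S - c))" for c :: complex and y
  define f where "f s y = exp (Q (of_real s) y)" for s :: real and y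
  define Q' where "Q' s y = of_real (2 * sd\<^sup>2 * (\<eta> s)\<^sup>2) + 2 * \<i> * of_real (\<eta> s * dev y)" for s :: real and y
  define G' where "G' s = mean s (\<lambda>y. Q' s y * f s y + (up y *\<^sub>R (f s (y + 1) - f s y) + down y *\<^sub>R (f s (y - 1) - f s y)))" for s
  define C where "C = exp (\<xi>\<^sup>2 / 2) * (2 * \<xi>\<^sup>2 + \<bar>\<xi>\<bar> ^ 3)"
  \<comment> \<open>The error is sorted by its decay in s, following \<open>mean_abs_dev_le\<close>:
    \<open>B1\<close> collects what does not decay, \<open>B2\<close> goes with exp (- 2 s) and
    \<open>B3\<close> with exp (- s).\<close>
  define B1 where "B1 = 1 / sd + real k / sqrt (real n) / sd\<^sup>2"
  define B2 where "B2 = real k / sd\<^sup>2"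
  define B3 where "B3 = sqrt (real k) / sd\<^sup>2"
  have nonneg: "0 \<le> C" "0 \<le> B1" "0 \<le> B2" "0 \<le> B3"
    using sd by (simp_all add: C_def B1_def B2_def B3_def)
  have Q_eq: "Q (of_real s) y = of_real (\<xi>\<^sup>2 / 2 * exp (- 4 * (S - s))) + \<i> * of_real (\<eta> s * dev y)" for s y
    by (simp add: Q_def \<eta>_def exp_of_real[symmetric])
  have \<eta>_sq: "2 * sd\<^sup>2 * (\<eta> s)\<^sup>2 = 2 * \<xi>\<^sup>2 * exp (- 4 * (S - s))" for s
    using sd by (simp add: \<eta>_def a_def power_mult_distrib power_divide exp_double[symmetric])
  have f': "((\<lambda>s. f s y) has_vector_derivative Q' s y * f s y) (at s within {0..})" for s y
  proof -
    have "((\<lambda>c. exp (Q c y)) has_field_derivative (of_real (\<xi>\<^sup>2 / 2) * (4 * exp (- 4 * (of_real S - of_real s)))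
      + \<i> * of_real (a * dev y) * (2 * exp (- 2 * (of_real S - of_real s)))) * exp (Q (of_real s) y)) (at (of_real s))"
      unfolding Q_def by (rule derivative_eq_intros refl | simp)+
    also have "of_real (\<xi>\<^sup>2 / 2) * (4 * exp (- 4 * (of_real S - of_real s)))
      + \<i> * of_real (a * dev y) * (2 * exp (- 2 * (of_real S - of_real s))) = Q' s y"
      unfolding Q'_def \<eta>_sq by (simp add: \<eta>_def exp_of_real[symmetric])
    finally show ?thesis unfolding f_def by (rule has_vector_derivative_real_field)
  qed
  have G': "((\<lambda>s. mean s (f s)) has_vector_derivative G' s) (at s within {0..})" if "0 \<le> s" for s
    unfolding G'_def by (rule mean_has_vector_derivative[OF that f'])
  have bound: "norm (G' s) \<le> C * (exp (- 4 * (S - s)) * B1 + exp (- 4 * S + 2 * s) * B2 + exp (- 4 * S + 3 * s) * B3)"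
    if s: "s \<in> {0..S}" for s
  proof -
    define e where "e = exp (- 4 * (S - s))"
    have "exp (- 2 * (S - s)) \<le> 1" using s by simp
    \<comment> \<open>The cubic remainder would decay faster; it is weakened to the square so that
      all errors share the factor \<open>e\<close>.\<close>
    hence "exp (- 2 * (S - s)) ^ 3 \<le> exp (- 2 * (S - s)) ^ 2" by (intro power_decreasing) auto
    also have "exp (- 2 * (S - s)) ^ 2 = e" by (simp add: e_def exp_double[symmetric])
    finally have e3: "exp (- 2 * (S - s)) ^ 3 \<le> e" .
    have e1: "e \<le> 1" using s by (simp add: e_def)
    have eq: "Q' s y * f s y + (up y *\<^sub>R (f s (y + 1) - f s y) + down y *\<^sub>R (f s (y - 1) - f s y)) =
      f s y * (of_real (2 * sd\<^sup>2 * (\<eta> s)\<^sup>2) + 2 * \<i> * of_real (\<eta> s * dev y)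
      + of_real (up y) * (exp (\<i> * of_real (\<eta> s)) - 1) + of_real (down y) * (exp (- (\<i> * of_real (\<eta> s))) - 1))" for y
    proof -
      have "Q (of_real s) (y + 1) = Q (of_real s) y + \<i> * of_real (\<eta> s)"
        unfolding Q_eq by (simp add: dev_def algebra_simps)
      hence u: "f s (y + 1) = f s y * exp (\<i> * of_real (\<eta> s))" by (simp only: f_def exp_add)
      have d: "of_real (down y) * f s (y - 1) = of_real (down y) * (f s y * exp (- (\<i> * of_real (\<eta> s))))"
      proof (cases y)
        case (Suc x)
        hence "Q (of_real s) (y - 1) = Q (of_real s) y + - (\<i> * of_real (\<eta> s))"
          unfolding Q_eq by (simp add: dev_def algebra_simps)
        thus ?thesis by (simp only: f_def exp_add)
      qed (simp add: down_def)
      have "Q' s y * f s y + (up y *\<^sub>R (f s (y + 1) - f s y) + down y *\<^sub>R (f s (y - 1) - f s y)) =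
        Q' s y * f s y + (of_real (up y) * (f s (y + 1) - f s y) + (of_real (down y) * f s (y - 1) - of_real (down y) * f s y))"
        by (simp add: scaleR_conv_of_real algebra_simps)
      thus ?thesis unfolding u d Q'_def by (simp add: algebra_simps)
    qed
    have "norm (G' s) \<le> mean s (\<lambda>y. (C * e) * (1 / sd + 1 / sd\<^sup>2 * \<bar>dev y\<bar>))"
      unfolding G'_def
    proof (rule norm_mean_le)
      fix y assume y: "y \<le> k"
      have "norm (f s y) = exp (\<xi>\<^sup>2 / 2 * e)" unfolding f_def Q_eq e_def by simp
      also have "\<xi>\<^sup>2 / 2 * e \<le> \<xi>\<^sup>2 / 2 * 1" by (intro mult_left_mono e1) simp
      finally have fle: "norm (f s y) \<le> exp (\<xi>\<^sup>2 / 2)" by simp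
      have "2 * (\<eta> s)\<^sup>2 * \<bar>dev y\<bar> = 2 * sd\<^sup>2 * (\<eta> s)\<^sup>2 * (1 / sd\<^sup>2 * \<bar>dev y\<bar>)" using sd by simp
      also have "\<dots> = 2 * \<xi>\<^sup>2 * e * (1 / sd\<^sup>2 * \<bar>dev y\<bar>)" unfolding \<eta>_sq e_def ..
      also have "\<dots> \<le> 2 * \<xi>\<^sup>2 * e * (1 / sd + 1 / sd\<^sup>2 * \<bar>dev y\<bar>)"
        using sd by (intro mult_left_mono) (auto simp: e_def)
      finally have 1: "2 * (\<eta> s)\<^sup>2 * \<bar>dev y\<bar> \<le> 2 * \<xi>\<^sup>2 * e * (1 / sd + 1 / sd\<^sup>2 * \<bar>dev y\<bar>)" .
      have "\<bar>\<eta> s\<bar> ^ 3 * (sd\<^sup>2 + \<bar>dev y\<bar>) = \<bar>\<xi>\<bar> ^ 3 * exp (- 2 * (S - s)) ^ 3 * ((sd\<^sup>2 + \<bar>dev y\<bar>) / sd ^ 3)"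
        using sd by (simp add: \<eta>_def a_def abs_mult power_mult_distrib power_divide)
      also have "\<dots> \<le> \<bar>\<xi>\<bar> ^ 3 * e * (1 / sd + 1 / sd\<^sup>2 * \<bar>dev y\<bar>)"
      proof (intro mult_mono)
        have "\<bar>dev y\<bar> / sd ^ 3 \<le> \<bar>dev y\<bar> / sd ^ 2"
          using sd by (intro divide_left_mono power_increasing) auto
        moreover have "sd\<^sup>2 / sd ^ 3 = 1 / sd" using sd by (simp add: power2_eq_square power3_eq_cube)
        ultimately show "(sd\<^sup>2 + \<bar>dev y\<bar>) / sd ^ 3 \<le> 1 / sd + 1 / sd\<^sup>2 * \<bar>dev y\<bar>"
          by (simp add: add_divide_distrib)
      qed (use e3 sd in \<open>auto simp: e_def\<close>)
      finally have 2: "\<bar>\<eta> s\<bar> ^ 3 * (sd\<^sup>2 + \<bar>dev y\<bar>) \<le> \<bar>\<xi>\<bar> ^ 3 * e * (1 / sd + 1 / sd\<^sup>2 * \<bar>dev y\<bar>)" .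
      have "norm (of_real (2 * sd\<^sup>2 * (\<eta> s)\<^sup>2) + 2 * \<i> * of_real (\<eta> s * dev y)
        + of_real (up y) * (exp (\<i> * of_real (\<eta> s)) - 1) + of_real (down y) * (exp (- (\<i> * of_real (\<eta> s))) - 1))
        \<le> 2 * (\<eta> s)\<^sup>2 * \<bar>dev y\<bar> + \<bar>\<eta> s\<bar> ^ 3 * (sd\<^sup>2 + \<bar>dev y\<bar>)"
        by (rule gaussian_drift_le[OF drift up_nonneg down_nonneg total_rate_approx[OF y]])
      also have "\<dots> \<le> (2 * \<xi>\<^sup>2 + \<bar>\<xi>\<bar> ^ 3) * e * (1 / sd + 1 / sd\<^sup>2 * \<bar>dev y\<bar>)"
        using add_mono[OF 1 2] by (simp add: distrib_right)
      finally have "norm (f s y) * norm (of_real (2 * sd\<^sup>2 * (\<eta> s)\<^sup>2) + 2 * \<i> * of_real (\<eta> s * dev y)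
        + of_real (up y) * (exp (\<i> * of_real (\<eta> s)) - 1) + of_real (down y) * (exp (- (\<i> * of_real (\<eta> s))) - 1))
        \<le> exp (\<xi>\<^sup>2 / 2) * ((2 * \<xi>\<^sup>2 + \<bar>\<xi>\<bar> ^ 3) * e * (1 / sd + 1 / sd\<^sup>2 * \<bar>dev y\<bar>))"
        by (intro mult_mono fle) auto
      thus "norm (Q' s y * f s y + (up y *\<^sub>R (f s (y + 1) - f s y) + down y *\<^sub>R (f s (y - 1) - f s y)))
        \<le> (C * e) * (1 / sd + 1 / sd\<^sup>2 * \<bar>dev y\<bar>)"
        unfolding eq norm_mult[of "f s y"] by (simp only: C_def mult.assoc)
    qed
    also have "\<dots> = C * e * (1 / sd + 1 / sd\<^sup>2 * mean s (\<lambda>y. \<bar>dev y\<bar>))"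
      using s by (simp only: mean_cmult mean_add mean_const atLeastAtMost_iff)
    also have "\<dots> \<le> C * e * (1 / sd + 1 / sd\<^sup>2 * (real k * exp (- 2 * s) + real k / sqrt (real n) + sqrt (real k) * exp (- s)))"
      using s nonneg mean_abs_dev_le[OF _ m0]
      by (intro mult_left_mono add_left_mono) (auto simp: e_def)
    also have "\<dots> = C * (e * B1 + (e * exp (- 2 * s)) * B2 + (e * exp (- s)) * B3)"
      by (simp add: B1_def B2_def B3_def algebra_simps)
    also have "e * exp (- 2 * s) = exp (- 4 * S + 2 * s)"
      by (simp add: e_def exp_add[symmetric] algebra_simps)
    also have "e * exp (- s) = exp (- 4 * S + 3 * s)"
      by (simp add: e_def exp_add[symmetric] algebra_simps)
    finally show ?thesis by (simp only: e_def)
  qed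
  define \<phi> where "\<phi> s = C * (exp (- 4 * (S - s)) * B1 / 4 + exp (- 4 * S + 2 * s) * B2 / 2 + exp (- 4 * S + 3 * s) * B3 / 3)" for s
  have "norm (mean S (f S) - mean 0 (f 0)) \<le> \<phi> S - \<phi> 0"
  proof (rule norm_diff_le_of_deriv_bound[where f' = G'
        and \<phi>' = "\<lambda>s. C * (exp (- 4 * (S - s)) * B1 + exp (- 4 * S + 2 * s) * B2 + exp (- 4 * S + 3 * s) * B3)"])
    show "(\<phi> has_vector_derivative C * (exp (- 4 * (S - s)) * B1 + exp (- 4 * S + 2 * s) * B2 + exp (- 4 * S + 3 * s) * B3))
      (at s within {0..})" for s
      unfolding \<phi>_def has_real_derivative_iff_has_vector_derivative[symmetric]
      by (rule derivative_eq_intros refl | simp)+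
  qed (use S G' bound in auto)
  also have "\<phi> S - \<phi> 0 \<le> \<phi> S" using nonneg by (simp add: \<phi>_def)
  also have "\<dots> \<le> C * (B1 + exp (- 2 * S) * B2 + exp (- S) * B3)"
    unfolding \<phi>_def using nonneg by (intro mult_left_mono add_mono) auto
  also have "mean S (f S) = exp (of_real (\<xi>\<^sup>2 / 2)) * mean S (\<lambda>y. exp (\<i> * of_real (\<xi> * (dev y / sd))))"
    unfolding mean_def f_def Q_eq exp_add
    by (simp add: \<eta>_def a_def sum_distrib_left scaleR_conv_of_real mult_ac)
  also have "mean 0 (f 0) = exp (of_real (\<xi>0\<^sup>2 / 2)) * mean 0 (\<lambda>y. exp (\<i> * of_real (\<xi>0 * (dev y / sd))))"
  proof -
    have "\<xi>\<^sup>2 / 2 * exp (- 4 * (S - 0)) = \<xi>0\<^sup>2 / 2"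
      by (simp add: \<xi>0_def power_mult_distrib exp_double[symmetric])
    moreover have "\<eta> 0 * dev y = \<xi>0 * (dev y / sd)" for y by (simp add: \<eta>_def a_def \<xi>0_def)
    ultimately show ?thesis unfolding mean_def f_def Q_eq exp_add
      by (simp only: sum_distrib_left scaleR_conv_of_real mult_ac)
  qed
  also have "C * (B1 + exp (- 2 * S) * B2 + exp (- S) * B3) =
      C * (1 / sd + (real k * exp (- 2 * S) + real k / sqrt (real n) + sqrt (real k) * exp (- S)) / sd\<^sup>2)"
    by (simp add: B1_def B2_def B3_def add_divide_distrib mult_ac)
  finally show ?thesis by (simp only: C_def)
qed

end

section \<open>Limit laws\<close>

text \<open>Polya's theorem. Continuity of \<open>G\<close> provides quantiles of all levels i / N;
  for large n the functions are close at these finitely many points, and monotonicity controls what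
  lies between.\<close>

lemma polya:
  fixes F :: "nat \<Rightarrow> real \<Rightarrow> real" and G :: "real \<Rightarrow> real"
  assumes F: "\<And>n. mono (F n)" "\<And>n x. 0 \<le> F n x" "\<And>n x. F n x \<le> 1"
    and G: "mono G" "\<And>x. isCont G x" "(G \<longlongrightarrow> 0) at_bot" "(G \<longlongrightarrow> 1) at_top"
    and lim: "\<And>x. (\<lambda>n. F n x) \<longlonglongrightarrow> G x"
  shows "uniform_limit UNIV F G sequentially"
proof (rule uniform_limitI)
  fix e :: real assume e: "e > 0"
  have G01: "0 \<le> G x" "G x \<le> 1" for x
  proof -
    show "0 \<le> G x" by (rule LIMSEQ_le_const[OF lim]) (use F in auto)
    show "G x \<le> 1" by (rule LIMSEQ_le_const2[OF lim]) (use F in auto)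
  qed
  obtain N where N: "N > 0" "3 / real N < e"
  proof -
    obtain N where "3 / e < real N" using reals_Archimedean2 by blast
    moreover have "0 < 3 / e" using e by simp
    ultimately have "0 < real N" by linarith
    thus thesis using e \<open>3 / e < real N\<close> by (intro that[of N]) (auto simp: field_simps)
  qed
  have "\<exists>x. G x = c" if "0 < c" "c < 1" for c
  proof -
    have "eventually (\<lambda>x. G x < c) at_bot" "eventually (\<lambda>x. G x > c) at_top"
      using G that by (auto intro: order_tendstoD)
    then obtain a b where ab: "G a < c" "c < G b"
      by (auto simp: eventually_at_bot_linorder eventually_at_top_linorder)
    have "a \<le> b" using ab G(1) by (meson leD le_cases monoD order.strict_trans)
    thus ?thesis using IVT[of G a c b] ab G(2) by auto
  qed
  hence "\<forall>i. \<exists>x. 0 < i \<and> i < N \<longrightarrow> G x = real i / real N" by auto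
  then obtain X where X: "\<And>i. 0 < i \<Longrightarrow> i < N \<Longrightarrow> G (X i) = real i / real N" by metis
  have "eventually (\<lambda>n. \<forall>i\<in>{0<..<N}. \<bar>F n (X i) - G (X i)\<bar> < 1 / real N) sequentially"
  proof (rule eventually_ball_finite)
    show "\<forall>i\<in>{0<..<N}. eventually (\<lambda>n. \<bar>F n (X i) - G (X i)\<bar> < 1 / real N) sequentially"
      using tendstoD[OF lim, of "1 / real N"] N by (auto simp: dist_real_def)
  qed simp
  thus "eventually (\<lambda>n. \<forall>x\<in>UNIV. dist (F n x) (G x) < e) sequentially"
  proof eventually_elim
    case (elim n)
    show ?case
    proof
      fix x
      define i where "i = nat \<lfloor>real N * G x\<rfloor>"
      have "0 \<le> real N * G x" using G01 by simp
      hence "real i \<le> real N * G x" "real N * G x < real i + 1"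
        unfolding i_def by linarith+
      hence i: "real i / real N \<le> G x" "G x < (real i + 1) / real N"
        using N by (simp_all add: field_simps)
      have upper: "F n x \<le> G x + 2 / real N"
      proof (cases "i + 1 < N")
        case True
        hence "G x < G (X (i + 1))" using i X[of "i + 1"] by (simp add: add.commute)
        hence "x \<le> X (i + 1)" using G(1) by (meson leD le_cases monoD)
        hence "F n x \<le> F n (X (i + 1))" using F(1) by (simp add: monoD)
        also have "\<dots> \<le> G (X (i + 1)) + 1 / real N" using elim True by force
        finally show ?thesis using i X[of "i + 1"] True by (simp add: add_divide_distrib)
      next
        case False
        hence "real N \<le> real i + 1" by linarith
        hence "1 \<le> (real i + 1) / real N" using N by simp
        moreover have "0 \<le> 1 / real N" by simp
        ultimately show ?thesis using F(3)[of n x] i by (simp add: add_divide_distrib)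
      qed
      \<comment> \<open>\<open>G x\<close> may equal i / N, and then the quantile of level i need
        not lie to the left of \<open>x\<close>. Stepping back to level i - 1 makes the comparison
        strict and costs the third 1 / N.\<close>
      have lower: "G x < F n x + 3 / real N"
      proof (cases "i \<ge> 2")
        case True
        have "real i / real N \<le> 1" using i(1) G01(2)[of x] by linarith
        hence "i \<le> N" using N by simp
        hence iN: "0 < i - 1" "i - 1 < N" using True N by auto
        have eq: "G (X (i - 1)) = (real i - 1) / real N" using X[OF iN] True by (simp add: of_nat_diff)
        also have "\<dots> < real i / real N" using N by (simp add: divide_strict_right_mono)
        also have "\<dots> \<le> G x" by (rule i)
        finally have "X (i - 1) \<le> x" using G(1) by (meson leD le_cases monoD)
        hence "F n (X (i - 1)) \<le> F n x" using F(1) by (simp add: monoD)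
        moreover have "\<bar>F n (X (i - 1)) - G (X (i - 1))\<bar> < 1 / real N"
          by (rule bspec[OF elim]) (use iN in simp)
        hence "G (X (i - 1)) < F n (X (i - 1)) + 1 / real N" by linarith
        moreover have "G x < (real i - 1) / real N + 2 / real N"
          using i(2) by (simp only: add_divide_distrib[symmetric]) (simp add: add.commute)
        ultimately show ?thesis using eq by (simp add: add_divide_distrib)
      next
        case False
        hence "(real i + 1) / real N \<le> 2 / real N" by (intro divide_right_mono) auto
        moreover have "2 / real N < 3 / real N" using N by (simp add: divide_strict_right_mono)
        ultimately show ?thesis using i F(2)[of n x] by linarith
      qed
      have "2 / real N < 3 / real N" using N by (simp add: divide_strict_right_mono)
      thus "dist (F n x) (G x) < e" using upper lower N by (simp add: dist_real_def abs_less_iff)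
    qed
  qed
qed

section \<open>Weak convergence of discrete laws\<close>

lemma real_distribution_distr_pmf: "real_distribution (distr (measure_pmf p) borel f)"
  by (rule prob_space.real_distribution_distr[OF measure_pmf.prob_space_axioms]) simp

lemma char_distr_pmf: "char (distr (measure_pmf p) borel f) \<xi> = (LINT y|measure_pmf p. iexp (\<xi> * f y))"
  unfolding char_def by (subst integral_distr) auto

lemma cdf_distr_pmf: "cdf (distr (measure_pmf p) borel f) x = measure (measure_pmf p) {y. f y \<le> x}"
  unfolding cdf_def by (subst measure_distr) (auto intro!: arg_cong[where f = "measure (measure_pmf p)"])

text \<open>Levy's continuity theorem gives convergence of distribution functions at continuity
  points. The half-integers are such points, and a point mass is the increment between two of
  them.\<close>

lemma pmf_tendsto_of_char:
  fixes p :: "nat \<Rightarrow> nat pmf"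
  assumes "\<And>\<xi>::real. (\<lambda>n. LINT y|measure_pmf (p n). iexp (\<xi> * real y)) \<longlonglongrightarrow> (LINT y|measure_pmf q. iexp (\<xi> * real y))"
  shows "(\<lambda>n. pmf (p n) y) \<longlonglongrightarrow> pmf q y"
proof -
  define M where "M r = distr (measure_pmf r) borel real" for r
  have rd: "real_distribution (M r)" for r unfolding M_def by (rule real_distribution_distr_pmf)
  have conv: "weak_conv_m (\<lambda>n. M (p n)) (M q)"
    by (rule levy_continuity[OF rd rd]) (use assms in \<open>simp add: M_def char_distr_pmf\<close>)
  have cdf: "(\<lambda>n. cdf (M (p n)) (real j - 1/2)) \<longlonglongrightarrow> cdf (M q) (real j - 1/2)" for j :: nat
  proof -
    interpret q: real_distribution "M q" by (rule rd)
    have "real -` {real j - 1/2} = {}"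
    proof -
      have "real i \<noteq> real j - 1/2" for i :: nat
      proof
        assume "real i = real j - 1/2"
        hence "real (2 * i + 1) = real (2 * j)" by simp
        hence "2 * i + 1 = 2 * j" by (simp only: of_nat_eq_iff)
        thus False by presburger
      qed
      thus ?thesis by auto
    qed
    hence "measure (M q) {real j - 1/2} = 0" unfolding M_def by (simp add: measure_distr)
    hence "isCont (cdf (M q)) (real j - 1/2)" by (simp add: q.isCont_cdf)
    thus ?thesis using conv by (simp add: weak_conv_m_def weak_conv_def)
  qed
  have eq: "cdf (M r) (real (Suc y) - 1/2) - cdf (M r) (real y - 1/2) = pmf r y" for r
  proof -
    have "{i. real i \<le> real (Suc y) - 1/2} = {..y}" "{i. real i \<le> real y - 1/2} = {..<y}"
      by auto
    hence "cdf (M r) (real (Suc y) - 1/2) - cdf (M r) (real y - 1/2) =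
        measure (measure_pmf r) {..y} - measure (measure_pmf r) {..<y}"
      unfolding M_def cdf_distr_pmf by simp
    also have "{..y} = insert y {..<y}" by auto
    finally show ?thesis by (simp add: measure_measure_pmf_finite)
  qed
  have "(\<lambda>n. cdf (M (p n)) (real (Suc y) - 1/2) - cdf (M (p n)) (real y - 1/2)) \<longlonglongrightarrow>
      cdf (M q) (real (Suc y) - 1/2) - cdf (M q) (real y - 1/2)"
    by (intro tendsto_diff cdf)
  thus ?thesis unfolding eq .
qed

lemma poisson_pgf:
  fixes z :: complex
  assumes "l > 0" "norm z \<le> 1"
  shows "(LINT y|measure_pmf (poisson_pmf l). z ^ y) = exp (of_real l * (z - 1))"
proof -
  have "integrable (measure_pmf (poisson_pmf l)) (\<lambda>y. z ^ y)"
    by (rule measure_pmf.integrable_const_bound[where B = 1])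
      (use assms in \<open>auto simp: norm_power power_le_one\<close>)
  hence "integrable (count_space UNIV) (\<lambda>y. pmf (poisson_pmf l) y *\<^sub>R z ^ y)"
    by (simp add: measure_pmf_eq_density integrable_density)
  from sums_integral_count_space_nat[OF this]
  have "(\<lambda>y. pmf (poisson_pmf l) y *\<^sub>R z ^ y) sums (LINT y|measure_pmf (poisson_pmf l). z ^ y)"
    by (simp add: measure_pmf_eq_density integral_density)
  moreover have "(\<lambda>y. pmf (poisson_pmf l) y *\<^sub>R z ^ y) = (\<lambda>y. exp (- of_real l) * ((of_real l * z) ^ y /\<^sub>R fact y))"
    using assms by (auto simp: scaleR_conv_of_real power_mult_distrib field_simps exp_of_real[symmetric])
  moreover have "(\<lambda>y. exp (- of_real l) * ((of_real l * z) ^ y /\<^sub>R fact y)) sums (exp (- of_real l) * exp (of_real l * z))"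
    by (intro sums_mult exp_converges)
  ultimately have "(LINT y|measure_pmf (poisson_pmf l). z ^ y) = exp (- of_real l) * exp (of_real l * z)"
    by (simp add: sums_iff)
  thus ?thesis by (simp add: exp_add[symmetric] algebra_simps)
qed

section \<open>Gaussian laws of variance 1\<close>

lemma gaussian_eq_distr: "gaussian m 1 = distr std_normal_distribution borel (\<lambda>x. m + x)"
proof -
  have "std_normal_distribution = distr (gaussian m 1) borel (\<lambda>x. x - m)"
  proof -
    have "distributed (gaussian m 1) lborel (\<lambda>x. x) (normal_density m 1)"
      by (simp add: distributed_def gaussian_def distr_id2)
    hence "distributed (gaussian m 1) lborel (\<lambda>x. (x - m) / 1) std_normal_density"
      by (intro prob_space.normal_standard_normal_convert[THEN iffD1])
        (auto simp: gaussian_def intro!: prob_space_normal_density)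
    thus ?thesis by (auto simp: distributed_def cong: distr_cong)
  qed
  hence "distr std_normal_distribution borel (\<lambda>x. m + x) = distr (distr (gaussian m 1) borel (\<lambda>x. x - m)) borel (\<lambda>x. m + x)"
    by simp
  also have "\<dots> = gaussian m 1"
    by (subst distr_distr) (auto simp: o_def gaussian_def distr_id2)
  finally show ?thesis ..
qed

lemma measure_gaussian_atMost: "measure (gaussian m 1) {..y} = cdf std_normal_distribution (y - m)"
  unfolding gaussian_eq_distr cdf_def
  by (subst measure_distr) (auto intro!: arg_cong[where f = "measure std_normal_distribution"])

lemma prob_space_gaussian: "prob_space (gaussian m 1)"
  unfolding gaussian_def by (simp add: prob_space_normal_density)

text \<open>The two densities cross at the midpoint. The argument \<open>c / 2 - c\<close> is kept
  in the shape of the difference between the distribution functions of the two laws at one common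
  point.\<close>

lemma tv_dist_gaussian:
  assumes "c > 0"
  shows "tv_dist (gaussian c 1) (gaussian 0 1) =
    cdf std_normal_distribution (c / 2) - cdf std_normal_distribution (c / 2 - c)"
proof -
  interpret \<mu>: prob_space "gaussian c 1" by (rule prob_space_gaussian)
  interpret \<nu>: prob_space "gaussian 0 1" by (rule prob_space_gaussian)
  have le: "measure (gaussian a 1) A \<le> measure (gaussian b 1) A"
    if "A \<in> sets borel" "\<And>x. x \<in> A \<Longrightarrow> (x - b)\<^sup>2 \<le> (x - a)\<^sup>2" for a b A
  proof -
    have "emeasure (gaussian a 1) A \<le> emeasure (gaussian b 1) A"
      unfolding gaussian_def using that
      by (subst (1 2) emeasure_density)
        (auto intro!: nn_integral_mono ennreal_leI divide_right_mono
          simp: normal_density_def indicator_def)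
    thus ?thesis
      by (simp add: prob_space_gaussian prob_space_imp_subprob_space
        finite_measure.emeasure_eq_measure prob_space.finite_measure)
  qed
  have sq: "(x - c)\<^sup>2 \<le> x\<^sup>2 \<longleftrightarrow> c / 2 \<le> x" "x\<^sup>2 \<le> (x - c)\<^sup>2 \<longleftrightarrow> x \<le> c / 2" for x
  proof -
    have "(x - c)\<^sup>2 = x\<^sup>2 + c * (c - 2 * x)" by (simp add: power2_eq_square algebra_simps)
    thus "(x - c)\<^sup>2 \<le> x\<^sup>2 \<longleftrightarrow> c / 2 \<le> x" "x\<^sup>2 \<le> (x - c)\<^sup>2 \<longleftrightarrow> x \<le> c / 2"
      using assms by (simp_all add: mult_le_0_iff zero_le_mult_iff) auto
  qed
  have "tv_dist (gaussian c 1) (gaussian 0 1) =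
      measure (gaussian c 1) {c / 2<..} - measure (gaussian 0 1) {c / 2<..}"
  proof (rule tv_dist_eq_hahn)
    fix A assume A: "A \<in> sets (gaussian c 1)"
    show "measure (gaussian 0 1) A \<le> measure (gaussian c 1) A" if "A \<subseteq> {c / 2<..}"
      using A that by (intro le) (auto simp: gaussian_def sq)
    show "measure (gaussian c 1) A \<le> measure (gaussian 0 1) A" if "A \<inter> {c / 2<..} = {}"
      using A that by (intro le) (force simp: gaussian_def sq)+
  qed (rule prob_space_gaussian | simp add: gaussian_def)+
  moreover have "measure (gaussian m 1) {y<..} = 1 - cdf std_normal_distribution (y - m)" for m y
  proof -
    have "{y<..} = space (gaussian m 1) - {..y}" by (auto simp: gaussian_def)
    thus ?thesis using prob_space.prob_compl[OF prob_space_gaussian, of "{..y}" m]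
      by (simp add: measure_gaussian_atMost) (simp add: gaussian_def)
  qed
  ultimately show ?thesis by simp
qed

lemma isCont_cdf_std_normal: "isCont (cdf std_normal_distribution) x"
proof -
  interpret real_distribution std_normal_distribution by (rule real_dist_normal_dist)
  have "absolutely_continuous lborel std_normal_distribution"
    by (rule absolutely_continuousI_density) simp
  moreover have "{x} \<in> null_sets lborel" by (rule finite_imp_null_set_lborel) simp
  ultimately have "{x} \<in> null_sets std_normal_distribution"
    unfolding absolutely_continuous_def by (rule subsetD)
  hence "emeasure std_normal_distribution {x} = 0" by (rule null_setsD1)
  thus ?thesis by (simp add: isCont_cdf measure_def)
qed

section \<open>The urn as a solution of the forward equation\<close>

context urn
begin

definition law :: "real \<Rightarrow> nat pmf" where
  "law s = urn_law k n k (real n * s)"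

lemma law_0: "law 0 = return_pmf k"
  using k_le by (simp add: law_def urn_law_0)

lemma set_pmf_law: "set_pmf (law s) \<subseteq> {..k}"
  by (auto simp: law_def urn_law_def red_count_le)

lemma set_pmf_equilibrium: "set_pmf (urn_equilibrium k n) \<subseteq> {..k}"
proof
  fix y assume "y \<in> set_pmf (urn_equilibrium k n)"
  hence "equilibrium y \<noteq> 0" by (simp add: set_pmf_iff)
  thus "y \<in> {..k}" using equilibrium_eq_0[of y] by (cases "y \<le> k") auto
qed

lemma integral_pmf_atMost:
  fixes f :: "nat \<Rightarrow> 'b :: {banach, second_countable_topology}"
  assumes "set_pmf p \<subseteq> {..k}"
  shows "(LINT y|measure_pmf p. f y) = (\<Sum>y\<le>k. pmf p y *\<^sub>R f y)"
  using assms by (intro integral_measure_pmf) auto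

sublocale law: urn_flow k n "\<lambda>s. pmf (law s)"
proof unfold_locales
  fix s :: real and y assume s: "0 \<le> s"
  show "(\<Sum>y\<le>k. pmf (law s) y) = 1"
    unfolding law_def urn_law_def by (rule sum_pmf_red_count)
  assume y: "y \<le> k"
  define p where "p t = pmf (urn_law k n k t) y" for t
  have "(p has_real_derivative (\<Sum>z\<le>k. pmf (law s) z * urn_generator k n z y)) (at (real n * s) within (\<lambda>s. real n * s) ` {0..})"
    unfolding p_def law_def
    by (rule has_field_derivative_subset[OF pmf_urn_law_deriv[OF k_le k_pos]]) (use y s in auto)
  hence "(p \<circ> (\<lambda>s. real n * s) has_real_derivative (\<Sum>z\<le>k. pmf (law s) z * urn_generator k n z y) * real n) (at s within {0..})"
    by (rule DERIV_image_chain) (auto intro!: derivative_eq_intros)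
  thus "((\<lambda>s. pmf (law s) y) has_real_derivative real n * (\<Sum>z\<le>k. pmf (law s) z * urn_generator k n z y)) (at s within {0..})"
    by (simp add: p_def law_def o_def mult.commute)
qed simp

sublocale eq: urn_flow k n "\<lambda>s. equilibrium"
proof unfold_locales
  fix s :: real and y
  show "(\<Sum>y\<le>k. equilibrium y) = 1"
    by (rule sum_pmf_eq_1) (use set_pmf_equilibrium in auto)
  show "((\<lambda>s. equilibrium y) has_real_derivative real n * (\<Sum>z\<le>k. equilibrium z * urn_generator k n z y)) (at s within {0..})"
    if "y \<le> k" using equilibrium_stationary[OF that] by simp
qed simp

lemma law_mean: "law.mean s f = (LINT y|measure_pmf (law s). f y)"
  for f :: "nat \<Rightarrow> 'b :: {banach, second_countable_topology}"
  by (simp add: law.mean_def integral_pmf_atMost set_pmf_law)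

lemma law_mean_0: "law.mean 0 f = f k"
  for f :: "nat \<Rightarrow> 'b :: {banach, second_countable_topology}"
  by (simp add: law_mean law_0)

lemma eq_mean: "eq.mean s f = (LINT y|measure_pmf (urn_equilibrium k n). f y)"
  for f :: "nat \<Rightarrow> 'b :: {banach, second_countable_topology}"
  by (simp add: eq.mean_def integral_pmf_atMost set_pmf_equilibrium)

lemma law_start: "0 \<le> law.mean 0 dev" "law.mean 0 dev \<le> real k"
proof -
  have "(real k)\<^sup>2 \<le> real k * real n" using k_le by (simp add: power2_eq_square mult_left_mono)
  hence "(real k)\<^sup>2 / real n \<le> real k" using n_pos by (simp add: divide_le_eq)
  thus "0 \<le> law.mean 0 dev" "law.mean 0 dev \<le> real k" by (simp_all add: law_mean_0 dev_def)
qed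

text \<open>The flow is constant, yet \<open>mean_dev\<close> contracts its mean by exp (- 2); so
  the mean is 0. This gives the hypergeometric mean without a binomial sum.\<close>

lemma eq_mean_dev: "eq.mean s dev = 0"
proof -
  have "eq.mean 1 dev = exp (- 2 * 1) * eq.mean 0 dev" by (rule eq.mean_dev) simp
  hence "eq.mean 0 dev = 0" by (simp add: eq_mean)
  thus ?thesis by (simp add: eq_mean)
qed

lemma eq_start: "0 \<le> eq.mean 0 dev" "eq.mean 0 dev \<le> real k"
  by (simp_all add: eq_mean_dev)

text \<open>Handles the time-0 term of the equilibrium flow: in the unit disc a power is Lipschitz
  with constant \<open>y\<close>, and the mean of \<open>y\<close> is k^2 / n.\<close>

lemma norm_pgf_equilibrium_minus_1_le:
  fixes w :: complex
  assumes "norm (1 + w) \<le> 1"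
  shows "norm ((LINT y|measure_pmf (urn_equilibrium k n). (1 + w) ^ y) - 1) \<le> norm w * ((real k)\<^sup>2 / real n)"
proof -
  have "(LINT y|measure_pmf (urn_equilibrium k n). (1 + w) ^ y) - 1 = eq.mean 0 (\<lambda>y. (1 + w) ^ y + (- 1))"
    unfolding eq.mean_add eq.mean_const[OF order_refl] by (simp add: eq_mean)
  also have "norm \<dots> \<le> eq.mean 0 (\<lambda>y. norm w * real y)"
  proof (rule eq.norm_mean_le)
    show "norm ((1 + w) ^ y + (- 1)) \<le> norm w * real y" for y
      using norm_power_diff[of "1 + w" 1 y] assms by (simp add: mult.commute)
  qed
  also have "\<dots> = norm w * eq.mean 0 (\<lambda>y. dev y + (real k)\<^sup>2 / real n)"
    by (simp add: eq.mean_cmult dev_def)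
  also have "eq.mean 0 (\<lambda>y. dev y + (real k)\<^sup>2 / real n) = (real k)\<^sup>2 / real n"
    by (simp only: eq.mean_add eq_mean_dev eq.mean_const[OF order_refl] add_0)
  finally show ?thesis .
qed

lemma sd_ge: "real k / sqrt (real n) \<le> 2 * sd"
proof -
  have "real n / 2 \<le> real n - real k" using k_le by linarith
  hence "1 / 2 \<le> (real n - real k) / real n" using n_pos by (simp add: field_simps)
  hence "real k / sqrt (real n) * (1 / 2) \<le> real k / sqrt (real n) * ((real n - real k) / real n)"
    by (intro mult_left_mono) auto
  thus ?thesis by (simp add: sd_def mult.commute)
qed

text \<open>This identity is why \<open>sd\<close> is normalised by n where the hypergeometric
  variance has n - 1: the standardised start is exactly the square root of n.\<close>

lemma dev_start: "dev k / sd = sqrt (real n)"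
proof -
  define a r where "a = real k * (real n - real k)" and "r = sqrt (real n)"
  have "r > 0" using n_pos by (simp add: r_def)
  moreover have "a > 0" unfolding a_def using k_pos k_le by (intro mult_pos_pos) auto
  moreover have "dev k = a / real n"
    using n_pos by (simp add: dev_def a_def power2_eq_square field_simps)
  ultimately show ?thesis using n_pos unfolding sd_def a_def[symmetric] r_def[symmetric] by simp
qed

text \<open>Of the three terms, the first is at most 2 q \<open>sd\<close> and the second at most 2
  \<open>sd\<close>. The third is the square root of the first, hence at most the first plus 1, and
  1 \<le> \<open>sd\<close>.\<close>

lemma width_le:
  assumes sd: "sd \<ge> 1" and S: "exp (- 2 * S) = q / sqrt (real n)"
  shows "real k * exp (- 2 * S) + real k / sqrt (real n) + sqrt (real k) * exp (- S) \<le> (4 * q + 3) * sd"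
proof -
  have q: "q \<ge> 0"
    using S n_pos exp_ge_zero[of "- 2 * S"] by (simp add: zero_le_divide_iff)
  have 1: "real k * exp (- 2 * S) \<le> 2 * q * sd"
    using mult_left_mono[OF sd_ge q] unfolding S by (simp add: mult_ac)
  have "(sqrt (real k) * exp (- S))\<^sup>2 = real k * exp (- 2 * S)"
    by (simp add: power_mult_distrib exp_double[symmetric])
  also have "\<dots> \<le> (real k * exp (- 2 * S) + 1)\<^sup>2" by (simp add: power2_eq_square algebra_simps)
  finally have "sqrt (real k) * exp (- S) \<le> real k * exp (- 2 * S) + 1"
    by (rule power2_le_imp_le) simp
  thus ?thesis using 1 sd_ge sd by (simp add: algebra_simps)
qed

text \<open>The constant 4 q + 4 is 4 q + 3 from \<open>width_le\<close> plus 1 for the term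
  \<open>1 / sd\<close>. By \<open>dev_start\<close> the initial phase of the law is exactly
  \<open>\<xi> * q\<close>, while the equilibrium at frequency \<open>\<xi>0\<close> is still
  undetermined; the third claim shows that it is close to 1.\<close>

lemma char_estimates:
  fixes \<xi> S q :: real
  defines "\<xi>0 \<equiv> \<xi> * exp (- 2 * S)" and "C \<equiv> exp (\<xi>\<^sup>2 / 2) * (2 * \<xi>\<^sup>2 + \<bar>\<xi>\<bar> ^ 3) * (4 * q + 4)"
  assumes S: "0 \<le> S" and sd: "sd \<ge> 1" and q: "exp (- 2 * S) = q / sqrt (real n)"
  shows "norm (exp (of_real (\<xi>\<^sup>2 / 2)) * (LINT y|measure_pmf (law S). iexp (\<xi> * (dev y / sd)))
      - exp (of_real (\<xi>0\<^sup>2 / 2)) * iexp (\<xi> * q)) \<le> C / sd"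
    and "norm (exp (of_real (\<xi>\<^sup>2 / 2)) * (LINT y|measure_pmf (urn_equilibrium k n). iexp (\<xi> * (dev y / sd)))
      - exp (of_real (\<xi>0\<^sup>2 / 2)) * (LINT y|measure_pmf (urn_equilibrium k n). iexp (\<xi>0 * (dev y / sd)))) \<le> C / sd"
    and "norm ((LINT y|measure_pmf (urn_equilibrium k n). iexp (\<xi>0 * (dev y / sd))) - 1) \<le> \<bar>\<xi>0\<bar> * (4 * q + 3)"
proof -
  define w where "w = real k * exp (- 2 * S) + real k / sqrt (real n) + sqrt (real k) * exp (- S)"
  have w: "w \<le> (4 * q + 3) * sd" unfolding w_def by (rule width_le[OF sd q])
  have C: "exp (\<xi>\<^sup>2 / 2) * (2 * \<xi>\<^sup>2 + \<bar>\<xi>\<bar> ^ 3) * (1 / sd + w / sd\<^sup>2) \<le> C / sd"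
  proof -
    have "w / sd\<^sup>2 \<le> (4 * q + 3) * sd / sd\<^sup>2" using w by (intro divide_right_mono) auto
    also have "\<dots> = (4 * q + 3) / sd" using sd by (simp add: power2_eq_square)
    finally have "1 / sd + w / sd\<^sup>2 \<le> (4 * q + 4) / sd" by (simp add: add_divide_distrib)
    hence "exp (\<xi>\<^sup>2 / 2) * (2 * \<xi>\<^sup>2 + \<bar>\<xi>\<bar> ^ 3) * (1 / sd + w / sd\<^sup>2) \<le>
        exp (\<xi>\<^sup>2 / 2) * (2 * \<xi>\<^sup>2 + \<bar>\<xi>\<bar> ^ 3) * ((4 * q + 4) / sd)"
      by (intro mult_left_mono) auto
    thus ?thesis by (simp add: C_def)
  qed
  have start: "\<xi>0 * (dev k / sd) = \<xi> * q" unfolding dev_start \<xi>0_def q using n_pos by simp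
  show "norm (exp (of_real (\<xi>\<^sup>2 / 2)) * (LINT y|measure_pmf (law S). iexp (\<xi> * (dev y / sd)))
      - exp (of_real (\<xi>0\<^sup>2 / 2)) * iexp (\<xi> * q)) \<le> C / sd"
    using order_trans[OF law.char_estimate[OF S law_start sd, of \<xi>, folded w_def \<xi>0_def] C]
    unfolding law_mean_0 start unfolding law_mean .
  show "norm (exp (of_real (\<xi>\<^sup>2 / 2)) * (LINT y|measure_pmf (urn_equilibrium k n). iexp (\<xi> * (dev y / sd)))
      - exp (of_real (\<xi>0\<^sup>2 / 2)) * (LINT y|measure_pmf (urn_equilibrium k n). iexp (\<xi>0 * (dev y / sd)))) \<le> C / sd"
    using order_trans[OF eq.char_estimate[OF S eq_start sd, of \<xi>, folded w_def \<xi>0_def] C]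
    unfolding eq_mean .
  have "(LINT y|measure_pmf (urn_equilibrium k n). iexp (\<xi>0 * (dev y / sd))) - 1 =
      eq.mean S (\<lambda>y. iexp (\<xi>0 * (dev y / sd)) + (- 1))"
    unfolding eq.mean_add eq.mean_const[OF S] by (simp add: eq_mean)
  also have "norm \<dots> \<le> eq.mean S (\<lambda>y. \<bar>\<xi>0\<bar> / sd * \<bar>dev y\<bar>)"
  proof (rule eq.norm_mean_le)
    show "norm (iexp (\<xi>0 * (dev y / sd)) + (- 1)) \<le> \<bar>\<xi>0\<bar> / sd * \<bar>dev y\<bar>" for y
      using iexp_approx1[of "\<xi>0 * (dev y / sd)" 0] sd by (simp add: abs_mult)
  qed
  also have "\<dots> \<le> \<bar>\<xi>0\<bar> / sd * ((4 * q + 3) * sd)"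
    unfolding eq.mean_cmult using w eq.mean_abs_dev_le[OF S eq_start] sd
    by (intro mult_left_mono) (auto simp: w_def)
  also have "\<dots> = \<bar>\<xi>0\<bar> * (4 * q + 3)" using sd by simp
  finally show "norm ((LINT y|measure_pmf (urn_equilibrium k n). iexp (\<xi>0 * (dev y / sd))) - 1) \<le> \<bar>\<xi>0\<bar> * (4 * q + 3)" .
qed

lemma pgf_estimates:
  fixes z :: complex and S :: real
  defines "L \<equiv> (real k)\<^sup>2 / real n" and "w0 \<equiv> of_real (exp (- 2 * S)) * (z - 1)"
  assumes S: "0 \<le> S" and z: "norm z \<le> 1"
  shows "norm (exp (- of_real L * (z - 1)) * (LINT y|measure_pmf (law S). z ^ y)
      - exp (- of_real L * w0) * (1 + w0) ^ k) \<le> exp (2 * L) * (16 * real k / real n) * (L + real k * exp (- 2 * S))"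
    and "norm (exp (- of_real L * (z - 1)) * (LINT y|measure_pmf (urn_equilibrium k n). z ^ y)
      - exp (- of_real L * w0) * (LINT y|measure_pmf (urn_equilibrium k n). (1 + w0) ^ y))
      \<le> exp (2 * L) * (16 * real k / real n) * (L + real k * exp (- 2 * S))"
  using law.pgf_estimate[OF S law_start z] eq.pgf_estimate[OF S eq_start z]
  unfolding L_def[symmetric] w0_def[symmetric] law_mean_0 unfolding law_mean eq_mean by simp_all

end

section \<open>Poisson and Gumbel regimes\<close>

text \<open>The bases 1 + w and exp w both lie in the unit disc, the latter because |1 + w| \<le> 1
  forces Re w \<le> 0. Hence their k-th powers differ by at most k times a Taylor remainder of order
  |w|^2.\<close>

lemma tendsto_power_exp:
  fixes w :: "nat \<Rightarrow> complex" and k :: "nat \<Rightarrow> nat"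
  assumes w: "eventually (\<lambda>n. norm (1 + w n) \<le> 1) sequentially" "w \<longlonglongrightarrow> 0" "(\<lambda>n. of_nat (k n) * w n) \<longlonglongrightarrow> a"
  shows "(\<lambda>n. (1 + w n) ^ k n) \<longlonglongrightarrow> exp a"
proof -
  have diff: "(\<lambda>n. (1 + w n) ^ k n - exp (w n) ^ k n) \<longlonglongrightarrow> 0"
  proof (rule Lim_null_comparison)
    show "eventually (\<lambda>n. norm ((1 + w n) ^ k n - exp (w n) ^ k n)
        \<le> norm (of_nat (k n) * w n) * (exp \<bar>Re (w n)\<bar> * norm (w n))) sequentially"
      using w(1)
    proof eventually_elim
      case (elim n)
      have "1 + Re (w n) \<le> 1" using elim complex_Re_le_cmod[of "1 + w n"] by simp
      hence "norm (exp (w n)) \<le> 1" by simp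
      hence "norm ((1 + w n) ^ k n - exp (w n) ^ k n) \<le> real (k n) * norm ((1 + w n) - exp (w n))"
        using elim by (intro norm_power_diff)
      also have "norm ((1 + w n) - exp (w n)) = norm (exp (w n) - (\<Sum>i\<le>1. w n ^ i / fact i))"
        by (simp add: norm_minus_commute)
      also have "real (k n) * \<dots> \<le> real (k n) * (exp \<bar>Re (w n)\<bar> * (norm (w n)) ^ Suc 1 / fact 1)"
        by (intro mult_left_mono Taylor_exp) simp
      finally show ?case by (simp add: norm_mult power2_eq_square mult_ac)
    qed
    have "(\<lambda>n. norm (of_nat (k n) * w n) * (exp \<bar>Re (w n)\<bar> * norm (w n))) \<longlonglongrightarrow> norm a * (exp \<bar>Re 0\<bar> * norm (0 :: complex))"
      by (intro tendsto_intros w)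
    thus "(\<lambda>n. norm (of_nat (k n) * w n) * (exp \<bar>Re (w n)\<bar> * norm (w n))) \<longlonglongrightarrow> 0" by simp
  qed
  have "(\<lambda>n. exp (w n) ^ k n) \<longlonglongrightarrow> exp a"
    unfolding exp_of_nat_mult[symmetric] by (intro tendsto_exp w)
  from tendsto_add[OF diff this] show ?thesis by simp
qed

lemma pgf_limits:
  fixes k :: "nat \<Rightarrow> nat" and S :: "nat \<Rightarrow> real" and z :: complex and \<alpha> c :: real
  assumes urn: "eventually (\<lambda>n. urn (k n) n) sequentially"
    and S: "eventually (\<lambda>n. 0 \<le> S n) sequentially"
    and \<alpha>: "(\<lambda>n. (real (k n))\<^sup>2 / real n) \<longlonglongrightarrow> \<alpha>"
    and c: "(\<lambda>n. real (k n) * exp (- 2 * S n)) \<longlonglongrightarrow> c"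
    and S0: "(\<lambda>n. exp (- 2 * S n)) \<longlonglongrightarrow> 0"
    and kn: "(\<lambda>n. real (k n) / real n) \<longlonglongrightarrow> 0"
    and z: "norm z \<le> 1"
  shows "(\<lambda>n. LINT y|measure_pmf (urn_law (k n) n (k n) (real n * S n)). z ^ y) \<longlonglongrightarrow> exp (of_real (\<alpha> + c) * (z - 1))" (is ?law)
    and "(\<lambda>n. LINT y|measure_pmf (urn_equilibrium (k n) n). z ^ y) \<longlonglongrightarrow> exp (of_real \<alpha> * (z - 1))" (is ?eq)
proof -
  define L where "L n = (real (k n))\<^sup>2 / real n" for n
  define w0 where "w0 n = of_real (exp (- 2 * S n)) * (z - 1)" for n
  define err where "err n = exp (2 * L n) * (16 * (real (k n) / real n)) * (L n + real (k n) * exp (- 2 * S n))" for n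
  have L: "L \<longlonglongrightarrow> \<alpha>" using \<alpha> by (simp add: L_def[abs_def])
  have "(\<lambda>n. of_real (exp (- 2 * S n)) * (z - 1)) \<longlonglongrightarrow> of_real 0 * (z - 1)" by (intro tendsto_intros S0)
  hence w0: "w0 \<longlonglongrightarrow> 0" by (simp add: w0_def[abs_def])
  have w0_le: "eventually (\<lambda>n. norm (1 + w0 n) \<le> 1) sequentially"
    using S by eventually_elim (use z in \<open>auto simp: w0_def intro!: norm_convex_comb_le_1\<close>)
  have "err \<longlonglongrightarrow> exp (2 * \<alpha>) * (16 * 0) * (\<alpha> + c)"
    unfolding err_def[abs_def] by (intro tendsto_intros L kn c)
  hence err: "err \<longlonglongrightarrow> 0" by simp
  have "(\<lambda>n. exp (- of_real (L n) * w0 n)) \<longlonglongrightarrow> exp (- of_real \<alpha> * 0)" by (intro tendsto_intros L w0)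
  hence e0: "(\<lambda>n. exp (- of_real (L n) * w0 n)) \<longlonglongrightarrow> 1" by simp
  \<comment> \<open>The passage from time 0 to time S is common to both flows. Only the limit
    \<open>l\<close> of the time-0 term differs: exp (c (z - 1)) for the law from \<open>k\<close>,
    and 1 for the equilibrium.\<close>
  have transfer: "f \<longlonglongrightarrow> exp (of_real \<alpha> * (z - 1)) * l"
    if "eventually (\<lambda>n. norm (exp (- of_real (L n) * (z - 1)) * f n - exp (- of_real (L n) * w0 n) * g n) \<le> err n) sequentially"
      "g \<longlonglongrightarrow> l" for f g :: "nat \<Rightarrow> complex" and l
  proof -
    have "(\<lambda>n. exp (- of_real (L n) * (z - 1)) * f n - exp (- of_real (L n) * w0 n) * g n) \<longlonglongrightarrow> 0"
      by (rule Lim_null_comparison[OF that(1) err])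
    moreover have "(\<lambda>n. exp (- of_real (L n) * w0 n) * g n) \<longlonglongrightarrow> 1 * l" by (intro tendsto_mult e0 that)
    ultimately have "(\<lambda>n. exp (- of_real (L n) * (z - 1)) * f n) \<longlonglongrightarrow> l"
      using Lim_transform by fastforce
    hence "(\<lambda>n. exp (of_real (L n) * (z - 1)) * (exp (- of_real (L n) * (z - 1)) * f n)) \<longlonglongrightarrow> exp (of_real \<alpha> * (z - 1)) * l"
      by (intro tendsto_intros L)
    moreover have "exp (of_real (L n) * (z - 1)) * (exp (- of_real (L n) * (z - 1)) * f n) = f n" for n
      by (simp add: mult.assoc[symmetric] exp_add[symmetric])
    ultimately show ?thesis by (simp only:)
  qed
  have "(\<lambda>n. of_real (real (k n) * exp (- 2 * S n)) * (z - 1)) \<longlonglongrightarrow> of_real c * (z - 1)"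
    by (intro tendsto_intros c)
  hence "(\<lambda>n. of_nat (k n) * w0 n) \<longlonglongrightarrow> of_real c * (z - 1)" by (simp add: w0_def mult.assoc)
  hence "(\<lambda>n. (1 + w0 n) ^ k n) \<longlonglongrightarrow> exp (of_real c * (z - 1))"
    by (rule tendsto_power_exp[OF w0_le w0])
  moreover have "eventually (\<lambda>n. norm (exp (- of_real (L n) * (z - 1)) * (LINT y|measure_pmf (urn_law (k n) n (k n) (real n * S n)). z ^ y)
      - exp (- of_real (L n) * w0 n) * (1 + w0 n) ^ k n) \<le> err n) sequentially"
    using urn S
  proof eventually_elim
    case (elim n)
    thus ?case using urn.pgf_estimates(1)[OF elim(1,2) z] by (simp add: urn.law_def L_def w0_def err_def)
  qed
  ultimately have "(\<lambda>n. LINT y|measure_pmf (urn_law (k n) n (k n) (real n * S n)). z ^ y)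
      \<longlonglongrightarrow> exp (of_real \<alpha> * (z - 1)) * exp (of_real c * (z - 1))" by (intro transfer)
  thus ?law by (simp only: of_real_add distrib_right exp_add)
  have "(\<lambda>n. (LINT y|measure_pmf (urn_equilibrium (k n) n). (1 + w0 n) ^ y) - 1) \<longlonglongrightarrow> 0"
  proof (rule Lim_null_comparison)
    show "eventually (\<lambda>n. norm ((LINT y|measure_pmf (urn_equilibrium (k n) n). (1 + w0 n) ^ y) - 1) \<le> norm (w0 n) * L n) sequentially"
      using urn w0_le
    proof eventually_elim
      case (elim n)
      show ?case unfolding L_def by (rule urn.norm_pgf_equilibrium_minus_1_le[OF elim])
    qed
    have "(\<lambda>n. norm (w0 n) * L n) \<longlonglongrightarrow> norm (0 :: complex) * \<alpha>" by (intro tendsto_intros w0 L)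
    thus "(\<lambda>n. norm (w0 n) * L n) \<longlonglongrightarrow> 0" by simp
  qed
  hence "(\<lambda>n. LINT y|measure_pmf (urn_equilibrium (k n) n). (1 + w0 n) ^ y) \<longlonglongrightarrow> 1"
    by (simp add: Lim_null[symmetric])
  moreover have "eventually (\<lambda>n. norm (exp (- of_real (L n) * (z - 1)) * (LINT y|measure_pmf (urn_equilibrium (k n) n). z ^ y)
      - exp (- of_real (L n) * w0 n) * (LINT y|measure_pmf (urn_equilibrium (k n) n). (1 + w0 n) ^ y)) \<le> err n) sequentially"
    using urn S
  proof eventually_elim
    case (elim n)
    thus ?case using urn.pgf_estimates(2)[OF elim(1,2) z] by (simp add: L_def w0_def err_def)
  qed
  ultimately have "(\<lambda>n. LINT y|measure_pmf (urn_equilibrium (k n) n). z ^ y)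
      \<longlonglongrightarrow> exp (of_real \<alpha> * (z - 1)) * 1" by (intro transfer)
  thus ?eq by simp
qed

lemma urn_tv_tendsto_poisson:
  fixes k :: "nat \<Rightarrow> nat" and S :: "nat \<Rightarrow> real" and \<alpha> c :: real
  assumes urn: "eventually (\<lambda>n. urn (k n) n) sequentially"
    and lim: "eventually (\<lambda>n. 0 \<le> S n) sequentially"
      "(\<lambda>n. (real (k n))\<^sup>2 / real n) \<longlonglongrightarrow> \<alpha>"
      "(\<lambda>n. real (k n) * exp (- 2 * S n)) \<longlonglongrightarrow> c"
      "(\<lambda>n. exp (- 2 * S n)) \<longlonglongrightarrow> 0"
      "(\<lambda>n. real (k n) / real n) \<longlonglongrightarrow> 0"
    and pos: "\<alpha> > 0" "c > 0"
  shows "(\<lambda>n. urn_tv (k n) n (real n * S n)) \<longlonglongrightarrow>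
    tv_dist (measure_pmf (poisson_pmf (\<alpha> + c))) (measure_pmf (poisson_pmf \<alpha>))"
proof -
  have iexp: "iexp (\<xi> * real y) = iexp \<xi> ^ y" for \<xi> y
    by (simp add: exp_of_nat_mult[symmetric] mult_ac)
  have "(\<lambda>n. pmf (urn_law (k n) n (k n) (real n * S n)) y) \<longlonglongrightarrow> pmf (poisson_pmf (\<alpha> + c)) y" for y
    by (rule pmf_tendsto_of_char, unfold iexp, subst poisson_pgf)
      (use pos pgf_limits(1)[OF urn lim] in auto)
  moreover have "(\<lambda>n. pmf (urn_equilibrium (k n) n) y) \<longlonglongrightarrow> pmf (poisson_pmf \<alpha>) y" for y
    by (rule pmf_tendsto_of_char, unfold iexp, subst poisson_pgf)
      (use pos pgf_limits(2)[OF urn lim] in auto)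
  ultimately have "(\<lambda>n. tv_dist (measure_pmf (urn_law (k n) n (k n) (real n * S n))) (measure_pmf (urn_equilibrium (k n) n)))
      \<longlonglongrightarrow> tv_dist (measure_pmf (poisson_pmf (\<alpha> + c))) (measure_pmf (poisson_pmf \<alpha>))"
    by (rule tv_dist_pmf_tendsto)
  moreover have "eventually (\<lambda>n. tv_dist (measure_pmf (urn_law (k n) n (k n) (real n * S n))) (measure_pmf (urn_equilibrium (k n) n))
      = urn_tv (k n) n (real n * S n)) sequentially"
    using urn by eventually_elim (simp add: urn.k_le urn.k_pos urn_tv_eq)
  ultimately show ?thesis by (rule Lim_transform_eventually)
qed

text \<open>Serves when \<open>q\<close> is nearly a point mass at \<open>x\<close>: then the
  right-hand side is essentially the mass that \<open>p\<close> puts elsewhere.\<close>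

lemma tv_dist_pmf_le_max:
  "tv_dist (measure_pmf p) (measure_pmf q) \<le> max (1 - pmf p x) (1 - pmf q x)"
proof (rule tv_dist_least)
  fix A
  have *: "pmf r x \<le> measure (measure_pmf r) A" if "x \<in> A" for r
    using that by (simp add: pmf.rep_eq measure_pmf.finite_measure_mono)
  have **: "measure (measure_pmf r) A \<le> 1 - pmf r x" if "x \<notin> A" for r
  proof -
    have "measure (measure_pmf r) A \<le> measure (measure_pmf r) (UNIV - {x})"
      using that by (intro measure_pmf.finite_measure_mono) auto
    thus ?thesis using measure_pmf.prob_compl[of "{x}" r] by (simp add: pmf.rep_eq)
  qed
  show "\<bar>measure (measure_pmf p) A - measure (measure_pmf q) A\<bar> \<le> max (1 - pmf p x) (1 - pmf q x)"
  proof (cases "x \<in> A")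
    case True
    show ?thesis
      using *[OF True, of p] *[OF True, of q] measure_pmf.prob_le_1[of p A] measure_pmf.prob_le_1[of q A]
      by linarith
  next
    case False
    show ?thesis
      using **[OF False, of p] **[OF False, of q]
        measure_nonneg[of "measure_pmf p" A] measure_nonneg[of "measure_pmf q" A]
      by linarith
  qed
qed

lemma pmf_0_eq_pgf: "(LINT y|measure_pmf p. (0 :: complex) ^ y) = of_real (pmf p 0)"
proof -
  have "(LINT y|measure_pmf p. (0 :: complex) ^ y) = (LINT y|measure_pmf p. of_real (indicator {0} y))"
    by (intro Bochner_Integration.integral_cong) (auto simp: indicator_def power_0_left)
  thus ?thesis by (simp add: pmf.rep_eq)
qed

text \<open>The equilibrium collapses to the point 0, so the distance is asymptotically the
  probability that a red ball is left in the first urn. The generating function at z = 0 gives its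
  complement, and the event {0} provides the matching lower bound.\<close>

lemma urn_tv_tendsto_gumbel:
  fixes k :: "nat \<Rightarrow> nat" and S :: "nat \<Rightarrow> real" and c :: real
  assumes urn: "eventually (\<lambda>n. urn (k n) n) sequentially"
    and lim: "eventually (\<lambda>n. 0 \<le> S n) sequentially"
      "(\<lambda>n. (real (k n))\<^sup>2 / real n) \<longlonglongrightarrow> 0"
      "(\<lambda>n. real (k n) * exp (- 2 * S n)) \<longlonglongrightarrow> c"
      "(\<lambda>n. exp (- 2 * S n)) \<longlonglongrightarrow> 0"
      "(\<lambda>n. real (k n) / real n) \<longlonglongrightarrow> 0"
    and c: "c > 0"
  shows "(\<lambda>n. urn_tv (k n) n (real n * S n)) \<longlonglongrightarrow> 1 - exp (- c)"
proof -
  define p where "p n = urn_law (k n) n (k n) (real n * S n)" for n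
  define q where "q n = urn_equilibrium (k n) n" for n
  have "(\<lambda>n. complex_of_real (pmf (p n) 0)) \<longlonglongrightarrow> of_real (exp (- c))"
    using pgf_limits(1)[OF urn lim, of 0] unfolding pmf_0_eq_pgf by (simp add: p_def exp_of_real[symmetric])
  hence p: "(\<lambda>n. pmf (p n) 0) \<longlonglongrightarrow> exp (- c)" by (simp only: tendsto_of_real_iff)
  have "(\<lambda>n. complex_of_real (pmf (q n) 0)) \<longlonglongrightarrow> of_real 1"
    using pgf_limits(2)[OF urn lim, of 0] unfolding pmf_0_eq_pgf by (simp add: q_def)
  hence q: "(\<lambda>n. pmf (q n) 0) \<longlonglongrightarrow> 1" by (simp only: tendsto_of_real_iff)
  have tv: "eventually (\<lambda>n. urn_tv (k n) n (real n * S n) = tv_dist (measure_pmf (p n)) (measure_pmf (q n))) sequentially"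
    using urn by eventually_elim (simp add: urn.k_le urn.k_pos urn_tv_eq p_def q_def)
  show ?thesis
  proof (rule tendsto_sandwich)
    show "eventually (\<lambda>n. pmf (q n) 0 - pmf (p n) 0 \<le> urn_tv (k n) n (real n * S n)) sequentially"
      using tv
    proof eventually_elim
      case (elim n)
      thus ?case using tv_dist_pmf_upper[of "{0}" "p n" "q n"] by (simp add: pmf.rep_eq abs_le_iff)
    qed
    show "eventually (\<lambda>n. urn_tv (k n) n (real n * S n) \<le> max (1 - pmf (p n) 0) (1 - pmf (q n) 0)) sequentially"
      using tv by eventually_elim (simp add: tv_dist_pmf_le_max)
    show "(\<lambda>n. pmf (q n) 0 - pmf (p n) 0) \<longlonglongrightarrow> 1 - exp (- c)" by (intro tendsto_intros p q)
    have "(\<lambda>n. max (1 - pmf (p n) 0) (1 - pmf (q n) 0)) \<longlonglongrightarrow> max (1 - exp (- c)) (1 - 1)"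
      by (intro tendsto_intros p q)
    thus "(\<lambda>n. max (1 - pmf (p n) 0) (1 - pmf (q n) 0)) \<longlonglongrightarrow> 1 - exp (- c)" using c by simp
  qed
qed

section \<open>Gaussian regime\<close>

text \<open>The law's time-0 term contributes the phase \<open>iexp (\<xi> * q)\<close>, from which
  the limiting mean \<open>q\<close> arises; undoing the compensator gives the Gaussian factor in
  both limits.\<close>

lemma char_limits:
  fixes k :: "nat \<Rightarrow> nat" and S :: "nat \<Rightarrow> real" and q \<xi> :: real
  assumes urn: "eventually (\<lambda>n. urn (k n) n) sequentially"
    and S: "eventually (\<lambda>n. 0 \<le> S n) sequentially"
    and q: "eventually (\<lambda>n. exp (- 2 * S n) = q / sqrt (real n)) sequentially"
    and sd: "filterlim (\<lambda>n. urn.sd (k n) n) at_top sequentially"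
  shows "(\<lambda>n. LINT y|measure_pmf (urn_law (k n) n (k n) (real n * S n)). iexp (\<xi> * (urn.dev (k n) n y / urn.sd (k n) n)))
      \<longlonglongrightarrow> iexp (\<xi> * q) * of_real (exp (- \<xi>\<^sup>2 / 2))" (is ?law)
    and "(\<lambda>n. LINT y|measure_pmf (urn_equilibrium (k n) n). iexp (\<xi> * (urn.dev (k n) n y / urn.sd (k n) n)))
      \<longlonglongrightarrow> of_real (exp (- \<xi>\<^sup>2 / 2))" (is ?eq)
proof -
  define \<xi>0 where "\<xi>0 n = \<xi> * exp (- 2 * S n)" for n
  define err where "err n = exp (\<xi>\<^sup>2 / 2) * (2 * \<xi>\<^sup>2 + \<bar>\<xi>\<bar> ^ 3) * (4 * q + 4) / urn.sd (k n) n" for n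
  have err: "err \<longlonglongrightarrow> 0" unfolding err_def[abs_def]
    by (rule real_tendsto_divide_at_top[OF tendsto_const sd])
  have sd1: "eventually (\<lambda>n. 1 \<le> urn.sd (k n) n) sequentially"
    using sd by (simp add: filterlim_at_top)
  have sqrt: "filterlim (\<lambda>n. sqrt (real n)) at_top sequentially"
    by (rule filterlim_compose[OF sqrt_at_top filterlim_real_sequentially])
  have "(\<lambda>n. \<xi> * (q / sqrt (real n))) \<longlonglongrightarrow> \<xi> * 0"
    by (intro tendsto_intros real_tendsto_divide_at_top[OF tendsto_const sqrt])
  hence "\<xi>0 \<longlonglongrightarrow> \<xi> * 0"
    by (rule Lim_transform_eventually) (use q in eventually_elim, simp add: \<xi>0_def)
  hence \<xi>0: "\<xi>0 \<longlonglongrightarrow> 0" by simp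
  have "(\<lambda>n. exp (complex_of_real ((\<xi>0 n)\<^sup>2 / 2))) \<longlonglongrightarrow> exp (complex_of_real (0\<^sup>2 / 2))"
    by (intro tendsto_intros \<xi>0) simp
  hence e0: "(\<lambda>n. exp (complex_of_real ((\<xi>0 n)\<^sup>2 / 2))) \<longlonglongrightarrow> 1" by simp
  have transfer: "f \<longlonglongrightarrow> l * of_real (exp (- \<xi>\<^sup>2 / 2))"
    if "eventually (\<lambda>n. norm (exp (of_real (\<xi>\<^sup>2 / 2)) * f n - exp (of_real ((\<xi>0 n)\<^sup>2 / 2)) * g n) \<le> err n) sequentially"
      "g \<longlonglongrightarrow> l" for f g :: "nat \<Rightarrow> complex" and l
  proof -
    have "(\<lambda>n. exp (of_real (\<xi>\<^sup>2 / 2)) * f n - exp (of_real ((\<xi>0 n)\<^sup>2 / 2)) * g n) \<longlonglongrightarrow> 0"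
      by (rule Lim_null_comparison[OF that(1) err])
    moreover have "(\<lambda>n. exp (of_real ((\<xi>0 n)\<^sup>2 / 2)) * g n) \<longlonglongrightarrow> 1 * l" by (intro tendsto_mult e0 that)
    ultimately have "(\<lambda>n. exp (of_real (\<xi>\<^sup>2 / 2)) * f n) \<longlonglongrightarrow> l"
      using Lim_transform by fastforce
    hence "(\<lambda>n. exp (of_real (- \<xi>\<^sup>2 / 2)) * (exp (of_real (\<xi>\<^sup>2 / 2)) * f n)) \<longlonglongrightarrow> exp (of_real (- \<xi>\<^sup>2 / 2)) * l"
      by (intro tendsto_intros)
    moreover have "exp (of_real (- \<xi>\<^sup>2 / 2)) * (exp (of_real (\<xi>\<^sup>2 / 2)) * c) = c" for c :: complex
      by (simp add: mult.assoc[symmetric] exp_add[symmetric])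
    ultimately have "f \<longlonglongrightarrow> exp (of_real (- \<xi>\<^sup>2 / 2)) * l" by (simp only:)
    thus ?thesis by (simp only: exp_of_real mult.commute)
  qed
  show ?law
  proof (rule transfer[OF _ tendsto_const])
    show "eventually (\<lambda>n. norm (exp (of_real (\<xi>\<^sup>2 / 2)) *
        (LINT y|measure_pmf (urn_law (k n) n (k n) (real n * S n)). iexp (\<xi> * (urn.dev (k n) n y / urn.sd (k n) n)))
        - exp (of_real ((\<xi>0 n)\<^sup>2 / 2)) * iexp (\<xi> * q)) \<le> err n) sequentially"
      using urn S sd1 q
    proof eventually_elim
      case (elim n)
      show ?case unfolding \<xi>0_def err_def urn.law_def[OF elim(1), symmetric]
        by (rule urn.char_estimates(1)[OF elim])
    qed
  qed
  have "(\<lambda>n. (LINT y|measure_pmf (urn_equilibrium (k n) n). iexp (\<xi>0 n * (urn.dev (k n) n y / urn.sd (k n) n))) - 1) \<longlonglongrightarrow> 0"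
  proof (rule Lim_null_comparison)
    show "eventually (\<lambda>n. norm ((LINT y|measure_pmf (urn_equilibrium (k n) n).
        iexp (\<xi>0 n * (urn.dev (k n) n y / urn.sd (k n) n))) - 1) \<le> \<bar>\<xi>0 n\<bar> * (4 * q + 3)) sequentially"
      using urn S sd1 q
    proof eventually_elim
      case (elim n)
      show ?case unfolding \<xi>0_def by (rule urn.char_estimates(3)[OF elim])
    qed
    have "(\<lambda>n. \<bar>\<xi>0 n\<bar> * (4 * q + 3)) \<longlonglongrightarrow> \<bar>0\<bar> * (4 * q + 3)" by (intro tendsto_intros \<xi>0)
    thus "(\<lambda>n. \<bar>\<xi>0 n\<bar> * (4 * q + 3)) \<longlonglongrightarrow> 0" by simp
  qed
  hence *: "(\<lambda>n. LINT y|measure_pmf (urn_equilibrium (k n) n). iexp (\<xi>0 n * (urn.dev (k n) n y / urn.sd (k n) n))) \<longlonglongrightarrow> 1"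
    by (simp only: Lim_null[symmetric])
  have "(\<lambda>n. LINT y|measure_pmf (urn_equilibrium (k n) n). iexp (\<xi> * (urn.dev (k n) n y / urn.sd (k n) n)))
      \<longlonglongrightarrow> 1 * of_real (exp (- \<xi>\<^sup>2 / 2))"
  proof (rule transfer[OF _ *])
    show "eventually (\<lambda>n. norm (exp (of_real (\<xi>\<^sup>2 / 2)) *
        (LINT y|measure_pmf (urn_equilibrium (k n) n). iexp (\<xi> * (urn.dev (k n) n y / urn.sd (k n) n)))
        - exp (of_real ((\<xi>0 n)\<^sup>2 / 2)) *
          (LINT y|measure_pmf (urn_equilibrium (k n) n). iexp (\<xi>0 n * (urn.dev (k n) n y / urn.sd (k n) n)))) \<le> err n) sequentially"
      using urn S sd1 q
    proof eventually_elim
      case (elim n)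
      show ?case unfolding \<xi>0_def err_def by (rule urn.char_estimates(2)[OF elim])
    qed
  qed
  thus ?eq by simp
qed

text \<open>The mean is subtracted before Levy's theorem is applied, so that one fixed limit law
  with a continuous distribution function serves for every \<open>m\<close>; uniformity over the
  whole line is unaffected by the shift back.\<close>

lemma uniform_limit_std_normal:
  fixes p :: "nat \<Rightarrow> nat pmf" and g :: "nat \<Rightarrow> nat \<Rightarrow> real" and m :: real
  assumes "\<And>\<xi>. (\<lambda>n. LINT y|measure_pmf (p n). iexp (\<xi> * g n y)) \<longlonglongrightarrow> iexp (\<xi> * m) * of_real (exp (- \<xi>\<^sup>2 / 2))"
  shows "uniform_limit UNIV (\<lambda>n x. measure (measure_pmf (p n)) {y. g n y \<le> x})
    (\<lambda>x. cdf std_normal_distribution (x - m)) sequentially"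
proof -
  define M where "M n = distr (measure_pmf (p n)) borel (\<lambda>y. g n y - m)" for n
  interpret N: real_distribution std_normal_distribution by (rule real_dist_normal_dist)
  have char: "(\<lambda>n. char (M n) \<xi>) \<longlonglongrightarrow> char std_normal_distribution \<xi>" for \<xi>
  proof -
    have "char (M n) \<xi> = iexp (- \<xi> * m) * (LINT y|measure_pmf (p n). iexp (\<xi> * g n y))" for n
    proof -
      have "iexp (\<xi> * (g n y - m)) = iexp (- \<xi> * m) * iexp (\<xi> * g n y)" for y
        by (simp add: exp_add[symmetric] algebra_simps)
      thus ?thesis unfolding M_def char_distr_pmf by simp
    qed
    moreover have "(\<lambda>n. iexp (- \<xi> * m) * (LINT y|measure_pmf (p n). iexp (\<xi> * g n y)))
        \<longlonglongrightarrow> iexp (- \<xi> * m) * (iexp (\<xi> * m) * of_real (exp (- \<xi>\<^sup>2 / 2)))"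
      by (intro tendsto_mult tendsto_const assms)
    moreover have "iexp (- \<xi> * m) * (iexp (\<xi> * m) * c) = c" for c
      by (simp add: mult.assoc[symmetric] exp_add[symmetric])
    ultimately show ?thesis unfolding char_std_normal_distribution by (simp only:)
  qed
  have rd: "real_distribution (M n)" for n unfolding M_def by (rule real_distribution_distr_pmf)
  have "weak_conv_m M std_normal_distribution"
    by (rule levy_continuity[OF rd real_dist_normal_dist char])
  hence conv: "(\<lambda>n. cdf (M n) x) \<longlonglongrightarrow> cdf std_normal_distribution x" for x
    by (simp add: weak_conv_m_def weak_conv_def isCont_cdf_std_normal)
  have "uniform_limit UNIV (\<lambda>n. cdf (M n)) (cdf std_normal_distribution) sequentially"
  proof (rule polya)
    fix n x
    interpret M: real_distribution "M n" by (rule rd)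
    show "mono (cdf (M n))" by (simp add: mono_def M.cdf_nondecreasing)
    show "0 \<le> cdf (M n) x" "cdf (M n) x \<le> 1" by (simp_all add: cdf_def M.prob_le_1)
  qed (simp_all add: mono_def N.cdf_nondecreasing isCont_cdf_std_normal N.cdf_lim_at_bot N.cdf_lim_at_top_prob conv)
  hence "uniform_limit UNIV (\<lambda>n x. cdf (M n) (x - m)) (\<lambda>x. cdf std_normal_distribution (x - m)) sequentially"
    by (intro uniform_limitI) (drule (1) uniform_limitD, erule eventually_mono, simp)
  moreover have "cdf (M n) (x - m) = measure (measure_pmf (p n)) {y. g n y \<le> x}" for n x
    unfolding M_def cdf_distr_pmf by simp
  ultimately show ?thesis by simp
qed

text \<open>The lower bound tests the cut \<open>q / 2\<close>, which is optimal for the limit laws.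
  For the upper bound the optimal cut of the urn is unknown and varies with n; uniform convergence
  turns it into a cut for the Gaussian laws, and no cut exceeds their distance.\<close>

lemma urn_tv_tendsto_gaussian:
  fixes k :: "nat \<Rightarrow> nat" and S :: "nat \<Rightarrow> real" and q :: real
  assumes urn: "eventually (\<lambda>n. urn (k n) n) sequentially"
    and lim: "eventually (\<lambda>n. 0 \<le> S n) sequentially"
      "eventually (\<lambda>n. exp (- 2 * S n) = q / sqrt (real n)) sequentially"
      "filterlim (\<lambda>n. urn.sd (k n) n) at_top sequentially"
    and q: "q > 0"
  shows "(\<lambda>n. urn_tv (k n) n (real n * S n)) \<longlonglongrightarrow> tv_dist (gaussian q 1) (gaussian 0 1)"
proof (rule tendstoI)
  fix e :: real assume e: "e > 0"
  let ?\<Phi> = "cdf std_normal_distribution" and ?D = "tv_dist (gaussian q 1) (gaussian 0 1)"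
  define g where "g n y = urn.dev (k n) n y / urn.sd (k n) n" for n y
  define F where "F n x = measure (measure_pmf (urn_law (k n) n (k n) (real n * S n))) {y. g n y \<le> x}" for n x
  define G where "G n x = measure (measure_pmf (urn_equilibrium (k n) n)) {y. g n y \<le> x}" for n x
  have "uniform_limit UNIV F (\<lambda>x. ?\<Phi> (x - q)) sequentially"
    unfolding F_def[abs_def] by (rule uniform_limit_std_normal) (use char_limits(1)[OF urn lim] in \<open>simp only: g_def\<close>)
  hence F: "eventually (\<lambda>n. \<forall>x\<in>UNIV. dist (F n x) (?\<Phi> (x - q)) < e / 2) sequentially"
    using e unfolding uniform_limit_iff by (meson half_gt_zero)
  have "uniform_limit UNIV G (\<lambda>x. ?\<Phi> (x - 0)) sequentially"
    unfolding G_def[abs_def]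
  proof (rule uniform_limit_std_normal)
    show "(\<lambda>n. LINT y|measure_pmf (urn_equilibrium (k n) n). iexp (\<xi> * g n y)) \<longlonglongrightarrow> iexp (\<xi> * 0) * of_real (exp (- \<xi>\<^sup>2 / 2))" for \<xi>
      using char_limits(2)[OF urn lim, of \<xi>] by (simp add: g_def)
  qed
  hence G: "eventually (\<lambda>n. \<forall>x\<in>UNIV. dist (G n x) (?\<Phi> x) < e / 2) sequentially"
    using e unfolding uniform_limit_iff diff_zero by (meson half_gt_zero)
  have D_ge: "?\<Phi> x - ?\<Phi> (x - q) \<le> ?D" for x
  proof -
    have "{..x} \<in> sets (gaussian q 1)" by (simp add: gaussian_def)
    from tv_dist_upper[OF prob_space_gaussian prob_space_gaussian this, of 0]
    show ?thesis unfolding measure_gaussian_atMost diff_zero by linarith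
  qed
  show "eventually (\<lambda>n. dist (urn_tv (k n) n (real n * S n)) ?D < e) sequentially"
    using F G urn
  proof eventually_elim
    case (elim n)
    note urn = \<open>urn (k n) n\<close>
    have F: "\<bar>F n x - ?\<Phi> (x - q)\<bar> < e / 2" and G: "\<bar>G n x - ?\<Phi> x\<bar> < e / 2" for x
      using elim(1,2) by (auto simp: dist_real_def)
    have sd: "urn.sd (k n) n > 0" by (rule urn.sd_pos[OF urn])
    have "G n (q / 2) - F n (q / 2) \<le> urn_tv (k n) n (real n * S n)"
      unfolding urn_tv_eq[OF urn.k_le[OF urn] urn.k_pos[OF urn]] F_def G_def
      using tv_dist_pmf_upper[of "{y. g n y \<le> q / 2}" "urn_law (k n) n (k n) (real n * S n)" "urn_equilibrium (k n) n"]
      by (simp add: abs_le_iff)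
    hence lower: "?D - e < urn_tv (k n) n (real n * S n)"
      using F[of "q / 2"] G[of "q / 2"] unfolding tv_dist_gaussian[OF q] by linarith
    obtain y where "urn_tv (k n) n (real n * S n) = measure (measure_pmf (urn_equilibrium (k n) n)) {x. real x \<le> y}
        - measure (measure_pmf (urn_law (k n) n (k n) (real n * S n))) {x. real x \<le> y}"
      using urn.urn_tv_eq_cdf_diff[OF urn] by blast
    moreover define y' where "y' = (y - (real (k n))\<^sup>2 / real n) / urn.sd (k n) n"
    have "real x \<le> y \<longleftrightarrow> g n x \<le> y'" for x
      unfolding g_def y'_def urn.dev_def[OF urn] using sd by (simp add: divide_le_cancel)
    ultimately have "urn_tv (k n) n (real n * S n) = G n y' - F n y'" by (simp add: F_def G_def)
    hence "urn_tv (k n) n (real n * S n) < ?D + e" using F[of y'] G[of y'] D_ge[of y'] by linarith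
    thus ?case using lower by (simp add: dist_real_def abs_less_iff)
  qed
qed

section \<open>Cutoff times\<close>

lemma exp_cutoff_time:
  fixes x :: real
  assumes "x > 0"
  shows "exp (- 2 * (ln x / 2 + \<theta>)) = exp (- 2 * \<theta>) / x"
proof -
  have "- 2 * (ln x / 2 + \<theta>) = - 2 * \<theta> - ln x" by simp
  thus ?thesis using assms by (simp only: exp_diff exp_ln)
qed

lemma eventually_cutoff_time_nonneg:
  fixes f :: "'a \<Rightarrow> real"
  assumes "filterlim f at_top F"
  shows "eventually (\<lambda>n. 0 \<le> ln (f n) / 2 + \<theta>) F"
proof -
  have "filterlim (\<lambda>n. ln (f n)) at_top F" by (rule filterlim_compose[OF ln_at_top assms])
  hence "eventually (\<lambda>n. - 2 * \<theta> \<le> ln (f n)) F" by (simp add: filterlim_at_top)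
  thus ?thesis by eventually_elim simp
qed

theorem theorem1:
  fixes k :: "nat \<Rightarrow> nat" and \<theta> :: real
  assumes k_range: "\<And>n. n \<ge> 2 \<Longrightarrow> k n \<in> {1..n div 2}"
  shows
    "(filterlim (\<lambda>n. real (k n) / sqrt (real n)) at_top sequentially \<longrightarrow>
        (\<lambda>n. urn_tv (k n) n (1/4 * real n * ln (real n) + \<theta> * real n))
          \<longlonglongrightarrow> tv_dist (gaussian (exp (- 2 * \<theta>)) 1) (gaussian 0 1))
   \<and> (\<forall>\<alpha>::real. \<alpha> > 0 \<longrightarrow> (\<lambda>n. real (k n) / sqrt (real n)) \<longlonglongrightarrow> sqrt \<alpha> \<longrightarrow>
        (\<lambda>n. urn_tv (k n) n (1/4 * real n * ln (real n) + \<theta> * real n))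
          \<longlonglongrightarrow> tv_dist (measure_pmf (poisson_pmf (\<alpha> + sqrt \<alpha> * exp (- 2 * \<theta>))))
                       (measure_pmf (poisson_pmf \<alpha>))
      \<and> (\<lambda>n. urn_tv (k n) n (1/2 * real n * ln (real (k n)) + \<theta> * real n))
          \<longlonglongrightarrow> tv_dist (measure_pmf (poisson_pmf (\<alpha> + exp (- 2 * \<theta>))))
                       (measure_pmf (poisson_pmf \<alpha>)))
   \<and> ((\<lambda>n. real (k n) / sqrt (real n)) \<longlonglongrightarrow> 0 \<longrightarrow> filterlim k at_top sequentially \<longrightarrow>
        (\<forall>(M :: 'w measure) G. standard_gumbel M G \<longrightarrow>
          (\<lambda>n. urn_tv (k n) n (1/2 * real n * ln (real (k n)) + \<theta> * real n))
            \<longlonglongrightarrow> \<P>(\<omega> in M. G \<omega> > 2 * \<theta>)))"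
proof -
  \<comment> \<open>The times divided by n. Writing ln n / 4 as half of the logarithm of the square
    root gives both the form ln x / 2 + \<theta>, for which exp (- 2 S) is exp (- 2 \<theta>) /
    x.\<close>
  define S S' where "S n = ln (sqrt (real n)) / 2 + \<theta>" and "S' n = ln (real (k n)) / 2 + \<theta>" for n
  have ev2: "eventually (\<lambda>n::nat. 2 \<le> n) sequentially" by (rule eventually_ge_at_top)
  have urn: "eventually (\<lambda>n. urn (k n) n) sequentially"
    using ev2
  proof eventually_elim
    case (elim n)
    thus ?case using k_range[OF elim] by unfold_locales auto
  qed
  have sqrt: "filterlim (\<lambda>n. sqrt (real n)) at_top sequentially"
    by (rule filterlim_compose[OF sqrt_at_top filterlim_real_sequentially])
  have inv_sqrt: "(\<lambda>n. c / sqrt (real n)) \<longlonglongrightarrow> 0" for c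
    by (rule real_tendsto_divide_at_top[OF tendsto_const sqrt])
  have time: "1/4 * real n * ln (real n) + \<theta> * real n = real n * S n"
    "1/2 * real n * ln (real (k n)) + \<theta> * real n = real n * S' n" for n
    by (cases "n = 0"; simp add: S_def S'_def ln_sqrt algebra_simps)+
  have S: "eventually (\<lambda>n. 0 \<le> S n) sequentially"
    unfolding S_def by (rule eventually_cutoff_time_nonneg[OF sqrt])
  have exp_S: "eventually (\<lambda>n. exp (- 2 * S n) = exp (- 2 * \<theta>) / sqrt (real n)) sequentially"
    using ev2 by eventually_elim (simp only: S_def, rule exp_cutoff_time, simp)
  have exp_S': "eventually (\<lambda>n. exp (- 2 * S' n) = exp (- 2 * \<theta>) / real (k n)) sequentially"
    using urn by eventually_elim (simp only: S'_def, rule exp_cutoff_time, simp add: urn.k_pos)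
  have S0: "(\<lambda>n. exp (- 2 * S n)) \<longlonglongrightarrow> 0"
    by (rule Lim_transform_eventually[OF inv_sqrt[of "exp (- 2 * \<theta>)"]]) (use exp_S in eventually_elim, simp)
  have k2: "(\<lambda>n. (real (k n))\<^sup>2 / real n) \<longlonglongrightarrow> l\<^sup>2" and kn: "(\<lambda>n. real (k n) / real n) \<longlonglongrightarrow> 0"
    if "(\<lambda>n. real (k n) / sqrt (real n)) \<longlonglongrightarrow> l" for l
  proof -
    have "(\<lambda>n. (real (k n) / sqrt (real n))\<^sup>2) \<longlonglongrightarrow> l\<^sup>2" by (intro tendsto_intros that)
    thus "(\<lambda>n. (real (k n))\<^sup>2 / real n) \<longlonglongrightarrow> l\<^sup>2" by (simp add: power_divide)
    have "(\<lambda>n. real (k n) / sqrt (real n) * (1 / sqrt (real n))) \<longlonglongrightarrow> l * 0" by (intro tendsto_mult that inv_sqrt)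
    thus "(\<lambda>n. real (k n) / real n) \<longlonglongrightarrow> 0" by simp
  qed
  have S': "eventually (\<lambda>n. 0 \<le> S' n) sequentially" "(\<lambda>n. exp (- 2 * S' n)) \<longlonglongrightarrow> 0"
    if "filterlim (\<lambda>n. real (k n)) at_top sequentially"
  proof -
    show "eventually (\<lambda>n. 0 \<le> S' n) sequentially"
      unfolding S'_def by (rule eventually_cutoff_time_nonneg[OF that])
    have "(\<lambda>n. exp (- 2 * \<theta>) / real (k n)) \<longlonglongrightarrow> 0" by (rule real_tendsto_divide_at_top[OF tendsto_const that])
    thus "(\<lambda>n. exp (- 2 * S' n)) \<longlonglongrightarrow> 0"
      by (rule Lim_transform_eventually) (use exp_S' in eventually_elim, simp)
  qed
  have kS': "(\<lambda>n. real (k n) * exp (- 2 * S' n)) \<longlonglongrightarrow> exp (- 2 * \<theta>)"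
  proof (rule Lim_transform_eventually[OF tendsto_const])
    show "eventually (\<lambda>n. exp (- 2 * \<theta>) = real (k n) * exp (- 2 * S' n)) sequentially"
      using exp_S' urn
    proof eventually_elim
      case (elim n)
      show ?case unfolding elim(1) using urn.k_pos[OF elim(2)] by simp
    qed
  qed
  show ?thesis unfolding time
  proof (intro conjI impI allI)
    assume a: "filterlim (\<lambda>n. real (k n) / sqrt (real n)) at_top sequentially"
    \<comment> \<open>The factor 1 / 2 bounds 1 - k / n from below, so k may even be proportional to
      n.\<close>
    have "filterlim (\<lambda>n. 1 / 2 * (real (k n) / sqrt (real n))) at_top sequentially"
      by (rule filterlim_tendsto_pos_mult_at_top[OF tendsto_const _ a]) simp
    moreover have "eventually (\<lambda>n. 1 / 2 * (real (k n) / sqrt (real n)) \<le> urn.sd (k n) n) sequentially"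
      using urn
    proof eventually_elim
      case (elim n)
      thus ?case using urn.sd_ge[OF elim] by simp
    qed
    ultimately have "filterlim (\<lambda>n. urn.sd (k n) n) at_top sequentially" by (rule filterlim_at_top_mono)
    thus "(\<lambda>n. urn_tv (k n) n (real n * S n)) \<longlonglongrightarrow> tv_dist (gaussian (exp (- 2 * \<theta>)) 1) (gaussian 0 1)"
      by (intro urn_tv_tendsto_gaussian urn S exp_S) simp_all
  next
    fix \<alpha> :: real assume \<alpha>: "\<alpha> > 0" and b: "(\<lambda>n. real (k n) / sqrt (real n)) \<longlonglongrightarrow> sqrt \<alpha>"
    have k2': "(\<lambda>n. (real (k n))\<^sup>2 / real n) \<longlonglongrightarrow> \<alpha>" using k2[OF b] \<alpha> by simp
    have "(\<lambda>n. exp (- 2 * \<theta>) * (real (k n) / sqrt (real n))) \<longlonglongrightarrow> exp (- 2 * \<theta>) * sqrt \<alpha>"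
      by (intro tendsto_intros b)
    hence "(\<lambda>n. real (k n) * exp (- 2 * S n)) \<longlonglongrightarrow> exp (- 2 * \<theta>) * sqrt \<alpha>"
      by (rule Lim_transform_eventually) (use exp_S in eventually_elim, simp)
    hence kS: "(\<lambda>n. real (k n) * exp (- 2 * S n)) \<longlonglongrightarrow> sqrt \<alpha> * exp (- 2 * \<theta>)" by (simp add: mult.commute)
    show "(\<lambda>n. urn_tv (k n) n (real n * S n)) \<longlonglongrightarrow>
        tv_dist (measure_pmf (poisson_pmf (\<alpha> + sqrt \<alpha> * exp (- 2 * \<theta>)))) (measure_pmf (poisson_pmf \<alpha>))"
      by (rule urn_tv_tendsto_poisson[OF urn S k2' kS S0 kn[OF b]]) (use \<alpha> in auto)
    \<comment> \<open>A positive limit of the ratio forces \<open>k\<close> to diverge, as the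
      second time scale requires.\<close>
    have "filterlim (\<lambda>n. real (k n) / sqrt (real n) * sqrt (real n)) at_top sequentially"
      by (rule filterlim_tendsto_pos_mult_at_top[OF b _ sqrt]) (use \<alpha> in simp)
    moreover have "eventually (\<lambda>n. real (k n) / sqrt (real n) * sqrt (real n) = real (k n)) sequentially"
      using ev2 by eventually_elim simp
    ultimately have kinf: "filterlim (\<lambda>n. real (k n)) at_top sequentially"
      by (simp add: filterlim_cong)
    show "(\<lambda>n. urn_tv (k n) n (real n * S' n)) \<longlonglongrightarrow>
        tv_dist (measure_pmf (poisson_pmf (\<alpha> + exp (- 2 * \<theta>)))) (measure_pmf (poisson_pmf \<alpha>))"
      by (rule urn_tv_tendsto_poisson[OF urn S'(1)[OF kinf] k2' kS' S'(2)[OF kinf] kn[OF b]]) (use \<alpha> in auto)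
  next
    fix M :: "'w measure" and G
    assume c: "(\<lambda>n. real (k n) / sqrt (real n)) \<longlonglongrightarrow> 0" and "filterlim k at_top sequentially"
      and gumbel: "standard_gumbel M G"
    hence kinf: "filterlim (\<lambda>n. real (k n)) at_top sequentially"
      by (intro filterlim_compose[OF filterlim_real_sequentially])
    interpret prob_space M using gumbel by (simp add: standard_gumbel_def)
    have [measurable]: "G \<in> borel_measurable M" using gumbel by (simp add: standard_gumbel_def)
    have "{\<omega> \<in> space M. G \<omega> > 2 * \<theta>} = space M - {\<omega> \<in> space M. G \<omega> \<le> 2 * \<theta>}" by auto
    hence "\<P>(\<omega> in M. G \<omega> > 2 * \<theta>) = 1 - \<P>(\<omega> in M. G \<omega> \<le> 2 * \<theta>)"
      using prob_compl[of "{\<omega> \<in> space M. G \<omega> \<le> 2 * \<theta>}"] by simp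
    also have "\<P>(\<omega> in M. G \<omega> \<le> 2 * \<theta>) = exp (- exp (- (2 * \<theta>)))"
      using gumbel unfolding standard_gumbel_def by blast
    finally have "\<P>(\<omega> in M. G \<omega> > 2 * \<theta>) = 1 - exp (- exp (- 2 * \<theta>))" by simp
    moreover have "(\<lambda>n. urn_tv (k n) n (real n * S' n)) \<longlonglongrightarrow> 1 - exp (- exp (- 2 * \<theta>))"
      by (rule urn_tv_tendsto_gumbel[OF urn S'(1)[OF kinf] _ kS' S'(2)[OF kinf] kn[OF c]])
        (use k2[OF c] in auto)
    ultimately show "(\<lambda>n. urn_tv (k n) n (real n * S' n)) \<longlonglongrightarrow> \<P>(\<omega> in M. G \<omega> > 2 * \<theta>)" by simp
  qed
qed

end
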